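(* Let $a,b$ be nonzero integers, $X_{a,b}=\{(x,x',y,y',z)\in\mathbb{C}^5: xx'=z^a+1,\ yy'=z^b+1,\ z\ne 0\}$, and $h:X_{a,b}\to\mathbb{R}^3$, $h(x,x',y,y',z)=(|x|^2-|x'|^2,|y|^2-|y'|^2,\log|z|)$. Write $(u,v,w)$ for the coordinates on $\mathbb{R}^3$, let $U=\mathbb{R}^3\setminus\{(u,v,w): uv=w=0\}$ be the complement of the $u$-axis and the $v$-axis, let $V_{u^\pm}$ and $V_{v^\pm}$ be the strictly positive and strictly negative half-axes of the $u$-axis and of the $v$-axis, and let $O$ be the origin. Then: (1) Each fiber of $h$ over $U$ is a $3$-torus $T^3$. The fundamental group of $U$ is free of rank $3$, and with a suitable choice of basis, the monodromy action on $H^1$ of the fibers is given by the matrices $$\begin{pmatrix} 1 & 0 & 0 \\ 0 & 1 & 0 \\ 0 & b & 1 \end{pmatrix},\quad\begin{pmatrix} 1 & 0 & 0 \\ 0 & 1 & 0 \\ a & 0 & 1 \end{pmatrix},\quad\begin{pmatrix} 1 & 0 & 0 \\ 0 & 1 & 0 \\ -a & 0 & 1 \end{pmatrix}.$$ (2) Each fiber over $V_{u^\pm}$ is a $3$-torus with $b$ $2$-tori collapsed to $b$ singular circles. Each fiber over $V_{v^\pm}$ is a $3$-torus with $a$ $2$-tori collapsed to $a$ singular circles. (3) The fiber over $O$ satisfies: (a) if $\mathrm{ord}_2(a)\ne\mathrm{ord}_2(b)$, then $h^{-1}(O)$ is a $3$-torus with $a+b$ $2$-tori collapsed to $a+b$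 singular circles; (b) if $\mathrm{ord}_2(a)=\mathrm{ord}_2(b)$, then $h^{-1}(O)$ is a $3$-torus with $a+b-\gcd(a,b)$ $2$-tori collapsed to $a+b-\gcd(a,b)$ singular circles and $\gcd(a,b)$ $2$-tori collapsed to $\gcd(a,b)$ singular points.
   Context: $\mathrm{ord}_2$ is the 2-adic valuation of an integer. The three matrices are the actions of three free generators of $\pi_1(U)$. Here the $3$-torus is viewed as $S^1\times S^1\times S^1$ fibered over its last factor with fibers $2$-tori $S^1\times S^1$; a $2$-torus fiber is collapsed to a circle when one of its two circle factors is contracted to a point, and collapsed to a point when both are.
   Formalization: In (3b) the a+b-gcd(a,b) collapsed 2-tori include the gcd(a,b) ones collapsed to points (so only a+b-2gcd(a,b) become circles); read as disjoint counts the claim fails, e.g. a=b=1. For negative a, b all counts of 2-tori use |a|, |b|. *)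

theory Defs
  imports "HOL-Homology.Homology" "HOL-Computational_Algebra.Computational_Algebra"
begin

section \<open>The fundamental group\<close>

definition loops_at :: "'a::topological_space set \<Rightarrow> 'a \<Rightarrow> (real \<Rightarrow> 'a) set" where
  "loops_at S p =
     {\<gamma>. path \<gamma> \<and> path_image \<gamma> \<subseteq> S \<and> pathstart \<gamma> = p \<and> pathfinish \<gamma> = p}"

definition loop_class :: "'a::topological_space set \<Rightarrow> (real \<Rightarrow> 'a) \<Rightarrow> (real \<Rightarrow> 'a) set" where
  "loop_class S \<gamma> = {\<delta>. homotopic_paths S \<gamma> \<delta>}"

definition fundamental_group ::
  "'a::topological_space set \<Rightarrow> 'a \<Rightarrow> (real \<Rightarrow> 'a) set monoid" where
  "fundamental_group S p =
     \<lparr>carrier = loop_class S ` loops_at S p,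
      monoid.mult = (\<lambda>A B. \<Union>\<gamma>\<in>A. \<Union>\<delta>\<in>B. loop_class S (\<gamma> +++ \<delta>)),
      one = loop_class S (\<lambda>_. p)\<rparr>"


section \<open>Free groups\<close>

text \<open>A letter \<open>(i, True)\<close> stands for the generator \<open>g i\<close>, and \<open>(i, False)\<close> for its inverse.\<close>

definition reduced_word :: "('i \<times> bool) list \<Rightarrow> bool" where
  "reduced_word = successively (\<lambda>(i, s) (j, t). \<not> (i = j \<and> s \<noteq> t))"

definition word_value :: "('a, 'b) monoid_scheme \<Rightarrow> ('i \<Rightarrow> 'a) \<Rightarrow> ('i \<times> bool) list \<Rightarrow> 'a" where
  "word_value G g w =
     foldr (\<lambda>(i, s) x. (if s then g i else inv\<^bsub>G\<^esub> (g i)) \<otimes>\<^bsub>G\<^esub> x) w \<one>\<^bsub>G\<^esub>"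

definition free_basis :: "('a, 'b) monoid_scheme \<Rightarrow> ('i \<Rightarrow> 'a) \<Rightarrow> bool" where
  "free_basis G g \<longleftrightarrow>
     group G \<and> range g \<subseteq> carrier G \<and>
     bij_betw (word_value G g) {w. reduced_word w} (carrier G)"


section \<open>Singular cohomology with integer coefficients\<close>

definition cochain_group :: "nat \<Rightarrow> 'a topology \<Rightarrow> ('a chain \<Rightarrow> int) monoid" where
  "cochain_group p X =
     \<lparr>carrier = hom (chain_group p X) integer_group \<inter> extensional (carrier (chain_group p X)),
      monoid.mult = (\<lambda>\<phi> \<psi>. restrict (\<lambda>c. \<phi> c + \<psi> c) (carrier (chain_group p X))),
      one = restrict (\<lambda>_. 0) (carrier (chain_group p X))\<rparr>"

definition cocycles :: "nat \<Rightarrow> 'a topology \<Rightarrow> ('a chain \<Rightarrow> int) set" where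
  "cocycles p X =
     {\<phi> \<in> carrier (cochain_group p X).
        \<forall>c \<in> carrier (chain_group (Suc p) X). \<phi> (chain_boundary (Suc p) c) = 0}"

text \<open>For \<open>p = 0\<close> this is the trivial subgroup, because \<open>chain_boundary 0\<close> is zero.\<close>

definition coboundaries :: "nat \<Rightarrow> 'a topology \<Rightarrow> ('a chain \<Rightarrow> int) set" where
  "coboundaries p X =
     (\<lambda>\<psi>. restrict (\<lambda>c. \<psi> (chain_boundary p c)) (carrier (chain_group p X)))
       ` carrier (cochain_group (p - 1) X)"

definition cohomology_group :: "nat \<Rightarrow> 'a topology \<Rightarrow> ('a chain \<Rightarrow> int) set monoid" where
  "cohomology_group p X =
     (cochain_group p X)\<lparr>carrier := cocycles p X\<rparr> Mod coboundaries p X"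

text \<open>The map \<open>H\<^sup>p(Y) \<rightarrow> H\<^sup>p(X)\<close> induced by \<open>f : X \<rightarrow> Y\<close>; it does not depend on \<open>Y\<close> otherwise
  than through the class it is applied to.\<close>

definition cohomology_induced ::
  "nat \<Rightarrow> 'a topology \<Rightarrow> ('a \<Rightarrow> 'b) \<Rightarrow> ('b chain \<Rightarrow> int) set \<Rightarrow> ('a chain \<Rightarrow> int) set" where
  "cohomology_induced p X f C =
     (\<Union>\<phi>\<in>C. coboundaries p X #>\<^bsub>cochain_group p X\<^esub>
        restrict (\<lambda>c. \<phi> (chain_map p f c)) (carrier (chain_group p X)))"


section \<open>Integral bases and matrices\<close>

definition integral_basis :: "('a, 'b) monoid_scheme \<Rightarrow> ('n::finite \<Rightarrow> 'a) \<Rightarrow> bool" where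
  "integral_basis G e \<longleftrightarrow>
     comm_group G \<and> range e \<subseteq> carrier G \<and>
     bij_betw (\<lambda>k::int^'n. \<Otimes>\<^bsub>G\<^esub>i\<in>UNIV. e i [^]\<^bsub>G\<^esub> (k $ i)) UNIV (carrier G)"

text \<open>Column convention, in additive notation: \<open>f (e j) = (\<Sum>i. M $ i $ j * e i)\<close>.\<close>

definition acts_by_matrix ::
  "('a, 'b) monoid_scheme \<Rightarrow> ('n::finite \<Rightarrow> 'a) \<Rightarrow> ('a \<Rightarrow> 'a) \<Rightarrow> int^'n^'n \<Rightarrow> bool" where
  "acts_by_matrix G e f M \<longleftrightarrow>
     (\<forall>j. f (e j) = (\<Otimes>\<^bsub>G\<^esub>i\<in>UNIV. e i [^]\<^bsub>G\<^esub> (M $ i $ j)))"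


section \<open>Monodromy on cohomology\<close>

definition fibre_over :: "'e set \<Rightarrow> ('e \<Rightarrow> 'b) \<Rightarrow> 'b \<Rightarrow> 'e set" where
  "fibre_over E h p = {x \<in> E. h x = p}"

definition fibre_transport ::
  "'e::topological_space set \<Rightarrow> ('e \<Rightarrow> 'b::topological_space) \<Rightarrow> (real \<Rightarrow> 'b) \<Rightarrow> ('e \<Rightarrow> 'e) \<Rightarrow> bool"
  where
  "fibre_transport E h \<gamma> T \<longleftrightarrow>
     (\<exists>H. continuous_on ({0..1} \<times> fibre_over E h (pathstart \<gamma>)) H \<and>
          (\<forall>x \<in> fibre_over E h (pathstart \<gamma>).
             (\<forall>t\<in>{0..1}. H (t, x) \<in> fibre_over E h (\<gamma> t)) \<and>
             H (0, x) = x \<and> H (1, x) = T x))"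

text \<open>\<open>\<rho>\<close> is the monodromy action of the fundamental group of \<open>(S, p)\<close> on \<open>H\<^sup>k\<close> of the fibre
  over \<open>p\<close>: every loop \<open>\<gamma>\<close> can be lifted to a transport of the fibre, and for every choice \<open>T\<close>
  of such a transport the class of \<open>\<gamma>\<close> acts by \<open>T\<^sup>*\<close>.  With the convention that
  \<open>\<gamma> +++ \<delta>\<close> runs through \<open>\<gamma>\<close> first, this is a left action.\<close>

definition monodromy_action ::
  "nat \<Rightarrow> 'e::topological_space set \<Rightarrow> ('e \<Rightarrow> 'b::topological_space) \<Rightarrow> 'b set \<Rightarrow> 'b \<Rightarrow>
   ((real \<Rightarrow> 'b) set \<Rightarrow> ('e chain \<Rightarrow> int) set \<Rightarrow> ('e chain \<Rightarrow> int) set) \<Rightarrow> bool" where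
  "monodromy_action k E h S p \<rho> \<longleftrightarrow>
     (\<forall>\<gamma> \<in> loops_at S p.
        (\<exists>T. fibre_transport E h \<gamma> T) \<and>
        (\<forall>T. fibre_transport E h \<gamma> T \<longrightarrow>
          (\<forall>c \<in> carrier (cohomology_group k (top_of_set (fibre_over E h p))).
             \<rho> (loop_class S \<gamma>) c =
               cohomology_induced k (top_of_set (fibre_over E h p)) T c)))"


section \<open>Three-tori with collapsed two-tori\<close>

abbreviation unit_circle :: "complex set" where
  "unit_circle \<equiv> sphere 0 1"

definition torus3 :: "(complex \<times> complex \<times> complex) set" where
  "torus3 = unit_circle \<times> unit_circle \<times> unit_circle"

text \<open>\<open>F\<close> is the quotient of \<open>torus3\<close>, fibred over its last factor, by contracting the first
  circle factor of the fibres over \<open>A\<close> and the second circle factor of the fibres over \<open>B\<close>.\<close>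

definition torus3_contracted ::
  "complex set \<Rightarrow> complex set \<Rightarrow> 'e::topological_space set \<Rightarrow> bool" where
  "torus3_contracted A B F \<longleftrightarrow>
     (\<exists>q. quotient_map (top_of_set torus3) (top_of_set F) q \<and>
        (\<forall>r s t r' s' t'. (r, s, t) \<in> torus3 \<longrightarrow> (r', s', t') \<in> torus3 \<longrightarrow>
           (q (r, s, t) = q (r', s', t') \<longleftrightarrow>
              t = t' \<and> (r = r' \<or> t \<in> A) \<and> (s = s' \<or> t \<in> B))))"

text \<open>A three-torus with \<open>m\<close> two-tori collapsed to circles and \<open>n\<close> two-tori collapsed to points.
  The count \<open>m\<close> is inclusive: it is the number of two-tori with at least one circle factor
  contracted, so that the \<open>n\<close> two-tori with both factors contracted are among the \<open>m\<close>.\<close>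

definition collapsed_torus3 :: "nat \<Rightarrow> nat \<Rightarrow> 'e::topological_space set \<Rightarrow> bool" where
  "collapsed_torus3 m n F \<longleftrightarrow>
     (\<exists>A B. A \<subseteq> unit_circle \<and> B \<subseteq> unit_circle \<and> finite A \<and> finite B \<and>
        card (A \<union> B) = m \<and> card (A \<inter> B) = n \<and> torus3_contracted A B F)"


section \<open>The fibration\<close>

type_synonym complex5 = "complex \<times> complex \<times> complex \<times> complex \<times> complex"
type_synonym real3 = "real \<times> real \<times> real"

definition X_ab :: "int \<Rightarrow> int \<Rightarrow> complex5 set" where
  "X_ab a b =
     {(x, x', y, y', z). x * x' = z powi a + 1 \<and> y * y' = z powi b + 1 \<and> z \<noteq> 0}"

definition h_map :: "complex5 \<Rightarrow> real3" where
  "h_map = (\<lambda>(x, x', y, y', z).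
     ((cmod x)\<^sup>2 - (cmod x')\<^sup>2, (cmod y)\<^sup>2 - (cmod y')\<^sup>2, ln (cmod z)))"

definition U_base :: "real3 set" where
  "U_base = UNIV - {(u, v, w). u * v = 0 \<and> w = 0}"

abbreviation h_fibre :: "int \<Rightarrow> int \<Rightarrow> real3 \<Rightarrow> complex5 set" where
  "h_fibre a b p \<equiv> fibre_over (X_ab a b) h_map p"

end

theory Submission
  imports Defs "HOL-Complex_Analysis.Complex_Analysis"
begin

text \<open>A fibre of \<open>h\<close> is the union over the circle \<open>|z| = e\<^sup>w\<close> of the products of the solution sets of
  \<open>x x' = z\<^sup>a + 1\<close>, \<open>|x|\<^sup>2 - |x'|\<^sup>2 = u\<close> and of \<open>y y' = z\<^sup>b + 1\<close>, \<open>|y|\<^sup>2 - |y'|\<^sup>2 = v\<close>.  Each solution set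
  is an orbit of the unit circle, and is a point exactly when \<open>u = 0\<close> and \<open>z\<^sup>a = -1\<close>, respectively \<open>v = 0\<close>
  and \<open>z\<^sup>b = -1\<close>, which forces \<open>w = 0\<close>.  The two equations have common roots only if the 2-adic
  valuations of \<open>a\<close> and \<open>b\<close> agree, and then they have \<open>gcd a b\<close> of them.

  Over \<open>U\<close>, the nonvanishing functions on a fibre give winding classes in \<open>H\<^sup>1\<close>, and \<open>z\<close> together with a
  phase of each orbit gives a basis.  The phase of the first orbit can be chosen continuously in the
  angle of \<open>(u, w)\<close>; one turn of that angle multiplies it by a power of \<open>z\<close> with exponent \<open>\<plusminus>a\<close>.
  Likewise for \<open>(v, w)\<close> and \<open>b\<close>.  So the monodromy of a loop depends only on how often it turns around
  the two axes.

  \<open>U\<close> is covered by two simply connected charts, which meet in the four quadrants of the plane \<open>w = 0\<close>.  A loop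
  through one quadrant and back through an adjacent one turns around one half-axis, and the covering
  space with one sheet per reduced word shows that three such loops form a free basis.\<close>

section \<open>Singular cohomology classes\<close>

text \<open>The action must be computed for every transport \<open>T\<close> of a fibre, on integral
  singular cohomology. Nonvanishing functions do both: along any transport \<open>H\<close> the
  phase of \<open>H (t, q)\<close>, taken at the lifted angle, is a nonvanishing homotopy, and its
  two ends compare a class with its image under \<open>T\<close>. The obstacle is the phase itself.
  Either of \<open>x\<close> and \<open>x'\<close> may vanish on a fibre, so both must enter, and a
  positive combination of \<open>x\<close> and \<open>cnj x'\<close> fails where the two can be
  opposite. This is excluded only on the side of |z| = 1 where \<open>z powi a\<close> has modulus
  at most 1. On the other side \<open>z powi a * cnj x'\<close> takes the place of
  \<open>cnj x'\<close>, and the passage between the two sides is where powers of \<open>z\<close>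
  enter. The entries b, a, -a record a walk through the quadrants (-,+), (+,+), (+,-), (-,-) of the
  (u, v) plane: \<open>u\<close> changes sign upwards, then \<open>v\<close> once, then
  \<open>u\<close> downwards, so two of the three loops turn oppositely around the same kind of
  axis. The sign that remains depends on the chart of the base point and on the signs of
  \<open>a\<close> and \<open>b\<close>; it is absorbed into the signs of the first two basis
  classes.\<close>

lemma cochain_group_carrierD:
  assumes "f \<in> carrier (cochain_group p X)"
  shows "\<And>c d. singular_chain p X c \<Longrightarrow> singular_chain p X d \<Longrightarrow> f (c + d) = f c + f d"
    and "f 0 = 0"
    and "\<And>c. singular_chain p X c \<Longrightarrow> f (- c) = - f c"
    and "\<And>c d. singular_chain p X c \<Longrightarrow> singular_chain p X d \<Longrightarrow> f (c - d) = f c - f d"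
    and "\<And>c. \<not> singular_chain p X c \<Longrightarrow> f c = undefined"
proof -
  have h: "f \<in> hom (chain_group p X) integer_group"
    and e: "f \<in> extensional (singular_chain_set p X)"
    using assms by (auto simp: cochain_group_def)
  show add: "f (c + d) = f c + f d" if "singular_chain p X c" "singular_chain p X d" for c d
    using h that by (auto simp: hom_def)
  show zero: "f 0 = 0"
    using add[of 0 0] by simp
  show neg: "f (- c) = - f c" if "singular_chain p X c" for c
    using add[of c "- c"] zero that by (simp add: singular_chain_minus)
  show "f (c - d) = f c - f d" if "singular_chain p X c" "singular_chain p X d" for c d
    using add[of c "- d"] neg that by (simp add: singular_chain_minus)
  show "f c = undefined" if "\<not> singular_chain p X c" for c
    using e that by (auto simp: extensional_def)
qed

lemma cochain_group_carrierI:
  assumes "\<And>c d. singular_chain p X c \<Longrightarrow> singular_chain p X d \<Longrightarrow> f (c + d) = f c + f d"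
  shows "restrict f (singular_chain_set p X) \<in> carrier (cochain_group p X)"
  using assms by (auto simp: cochain_group_def hom_def singular_chain_add)

lemma comm_group_cochain_group: "comm_group (cochain_group p X)"
proof (rule comm_groupI)
  fix f assume f: "f \<in> carrier (cochain_group p X)"
  show "\<exists>g\<in>carrier (cochain_group p X). g \<otimes>\<^bsub>cochain_group p X\<^esub> f = \<one>\<^bsub>cochain_group p X\<^esub>"
  proof
    show "restrict (\<lambda>c. - f c) (singular_chain_set p X) \<in> carrier (cochain_group p X)"
      by (rule cochain_group_carrierI) (simp add: cochain_group_carrierD[OF f])
  qed (auto simp: cochain_group_def)
next
  fix f g assume fg: "f \<in> carrier (cochain_group p X)" "g \<in> carrier (cochain_group p X)"
  have "restrict (\<lambda>c. f c + g c) (singular_chain_set p X) \<in> carrier (cochain_group p X)"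
    by (rule cochain_group_carrierI)
       (simp add: cochain_group_carrierD(1)[OF fg(1)] cochain_group_carrierD(1)[OF fg(2)])
  then show "f \<otimes>\<^bsub>cochain_group p X\<^esub> g \<in> carrier (cochain_group p X)"
    by (simp add: cochain_group_def)
next
  show "\<one>\<^bsub>cochain_group p X\<^esub> \<in> carrier (cochain_group p X)"
    using cochain_group_carrierI[of p X "\<lambda>_. 0"] by (simp add: cochain_group_def)
qed (auto simp: cochain_group_def fun_eq_iff restrict_def extensional_def)

lemma mult_cochain_group:
  "f \<otimes>\<^bsub>cochain_group p X\<^esub> g = restrict (\<lambda>c. f c + g c) (singular_chain_set p X)"
  by (simp add: cochain_group_def)

lemma one_cochain_group:
  "\<one>\<^bsub>cochain_group p X\<^esub> = restrict (\<lambda>c. 0) (singular_chain_set p X)"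
  by (simp add: cochain_group_def)

lemma inv_cochain_group:
  assumes f: "f \<in> carrier (cochain_group p X)"
  shows "inv\<^bsub>cochain_group p X\<^esub> f = restrict (\<lambda>c. - f c) (singular_chain_set p X)"
proof -
  interpret comm_group "cochain_group p X" by (rule comm_group_cochain_group)
  have "restrict (\<lambda>c. - f c) (singular_chain_set p X) \<in> carrier (cochain_group p X)"
    by (rule cochain_group_carrierI) (simp add: cochain_group_carrierD[OF f])
  then show ?thesis
    by (intro inv_equality f) (auto simp: mult_cochain_group one_cochain_group)
qed

lemma subgroup_cocycles: "subgroup (cocycles p X) (cochain_group p X)"
proof -
  interpret comm_group "cochain_group p X" by (rule comm_group_cochain_group)
  have b: "singular_chain p X (chain_boundary (Suc p) c)" if "singular_chain (Suc p) X c" for c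
    using that by (rule singular_chain_boundary_alt)
  show ?thesis
  proof (rule subgroupI)
    have "\<one>\<^bsub>cochain_group p X\<^esub> \<in> cocycles p X"
      using b one_closed unfolding cocycles_def by (simp add: one_cochain_group)
    then show "cocycles p X \<noteq> {}" by blast
  next
    fix f assume "f \<in> cocycles p X"
    then show "inv\<^bsub>cochain_group p X\<^esub> f \<in> cocycles p X"
      using b inv_closed unfolding cocycles_def by (fastforce simp: inv_cochain_group)
  next
    fix f g assume "f \<in> cocycles p X" "g \<in> cocycles p X"
    then show "f \<otimes>\<^bsub>cochain_group p X\<^esub> g \<in> cocycles p X"
      using b m_closed[of f g] unfolding cocycles_def by (simp add: mult_cochain_group)
  qed (auto simp: cocycles_def)
qed

lemma coboundaries_subset: "coboundaries p X \<subseteq> cocycles p X"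
proof
  fix f assume "f \<in> coboundaries p X"
  then obtain g where g: "g \<in> carrier (cochain_group (p - 1) X)"
    and f: "f = restrict (\<lambda>c. g (chain_boundary p c)) (singular_chain_set p X)"
    by (auto simp: coboundaries_def)
  have b: "singular_chain (p - 1) X (chain_boundary p c)" if "singular_chain p X c" for c
    using singular_chain_boundary[OF that] by simp
  have "f \<in> carrier (cochain_group p X)"
    unfolding f by (rule cochain_group_carrierI)
      (use b in \<open>simp add: chain_boundary_add cochain_group_carrierD[OF g, simplified]\<close>)
  moreover have "f (chain_boundary (Suc p) c) = 0" if "singular_chain (Suc p) X c" for c
  proof -
    have "chain_boundary p (chain_boundary (Suc p) c) = 0"
      using chain_boundary_boundary_alt[OF that] by simp
    then show ?thesis
      using singular_chain_boundary_alt[OF that] cochain_group_carrierD(2)[OF g] by (simp add: f)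
  qed
  ultimately show "f \<in> cocycles p X"
    by (simp add: cocycles_def)
qed

lemma subgroup_coboundaries: "subgroup (coboundaries p X) (cochain_group p X)"
proof -
  interpret comm_group "cochain_group p X" by (rule comm_group_cochain_group)
  interpret P: comm_group "cochain_group (p - 1) X" by (rule comm_group_cochain_group)
  have b: "singular_chain (p - 1) X (chain_boundary p c)" if "singular_chain p X c" for c
    using singular_chain_boundary[OF that] by simp
  define D where "D = (\<lambda>\<psi>. restrict (\<lambda>c. \<psi> (chain_boundary p c)) (singular_chain_set p X) :: _ \<Rightarrow> int)"
  have cb: "coboundaries p X = D ` carrier (cochain_group (p - 1) X)"
    by (simp add: coboundaries_def D_def)
  have sub: "coboundaries p X \<subseteq> carrier (cochain_group p X)"
    using coboundaries_subset by (auto simp: cocycles_def)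
  have "D \<in> hom (cochain_group (p - 1) X) (cochain_group p X)"
    using sub b unfolding cb
    by (auto simp: hom_def D_def mult_cochain_group)
  then interpret group_hom "cochain_group (p - 1) X" "cochain_group p X" D
    by unfold_locales
  show ?thesis
    unfolding cb by (rule img_is_subgroup)
qed

abbreviation cocycle_group :: "nat \<Rightarrow> 'a topology \<Rightarrow> ('a chain \<Rightarrow> int) monoid" where
  "cocycle_group p X \<equiv> (cochain_group p X)\<lparr>carrier := cocycles p X\<rparr>"

lemma comm_group_cocycle_group: "comm_group (cocycle_group p X)"
proof (rule group.group_comm_groupI)
  interpret comm_group "cochain_group p X" by (rule comm_group_cochain_group)
  show "Group.group (cocycle_group p X)"
    by (rule subgroup.subgroup_is_group[OF subgroup_cocycles]) (rule is_group)
qed (auto simp: cochain_group_def add.commute)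

lemma subgroup_coboundaries_cocycles: "subgroup (coboundaries p X) (cocycle_group p X)"
  by (rule group.subgroup_incl[OF _ subgroup_coboundaries subgroup_cocycles coboundaries_subset])
     (rule comm_group.axioms(2)[OF comm_group_cochain_group])

lemma comm_group_cohomology_group: "comm_group (cohomology_group p X)"
  unfolding cohomology_group_def
  by (rule comm_group.abelian_FactGroup[OF comm_group_cocycle_group subgroup_coboundaries_cocycles])

text \<open>The coset is formed in the whole cochain group. The cocycles inherit its multiplication,
  so it is the same set as the coset used in \<open>cohomology_group\<close>.\<close>

definition cohomology_class :: "nat \<Rightarrow> 'a topology \<Rightarrow> ('a chain \<Rightarrow> int) \<Rightarrow> ('a chain \<Rightarrow> int) set" where
  "cohomology_class p X f = coboundaries p X #>\<^bsub>cochain_group p X\<^esub> f"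

lemma hom_cohomology_class:
  "cohomology_class p X \<in> hom (cocycle_group p X) (cohomology_group p X)"
proof -
  interpret normal "coboundaries p X" "cocycle_group p X"
    using comm_group.normal_iff_subgroup[OF comm_group_cocycle_group] subgroup_coboundaries_cocycles by blast
  have "cohomology_class p X = (\<lambda>f. coboundaries p X #>\<^bsub>cocycle_group p X\<^esub> f)"
    by (simp add: fun_eq_iff cohomology_class_def r_coset_def)
  then show ?thesis
    using r_coset_hom_Mod by (simp add: cohomology_group_def)
qed

lemma carrier_cohomology_group:
  "carrier (cohomology_group p X) = cohomology_class p X ` cocycles p X"
  by (auto simp: cohomology_group_def carrier_FactGroup cohomology_class_def r_coset_def)

lemma cohomology_class_self:
  "f \<in> cocycles p X \<Longrightarrow> f \<in> cohomology_class p X f"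
  unfolding cohomology_class_def
  by (rule group.rcos_self[OF comm_group.axioms(2)[OF comm_group_cochain_group] _ subgroup_coboundaries])
     (simp add: cocycles_def)

lemma mem_cohomology_class_iff:
  assumes "f \<in> cocycles p X" "g \<in> cocycles p X"
  shows "f \<in> cohomology_class p X g \<longleftrightarrow> cohomology_class p X f = cohomology_class p X g"
  using assms cohomology_class_self[of f]
    group.repr_independence[OF comm_group.axioms(2)[OF comm_group_cochain_group] _ _ subgroup_coboundaries, of f p X g]
  by (auto simp: cohomology_class_def cocycles_def)

text \<open>Cochains are extensional, so the equality of functions in the coset condition reduces to
  an equality on singular chains.\<close>

lemma cohomology_class_eq_iff:
  assumes f: "f \<in> cocycles p X" and g: "g \<in> cocycles p X"
  shows "cohomology_class p X f = cohomology_class p X g \<longleftrightarrow>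
    (\<exists>\<psi>\<in>carrier (cochain_group (p - 1) X). \<forall>c. singular_chain p X c \<longrightarrow>
       f c = g c + \<psi> (chain_boundary p c))"
proof -
  have "f \<in> cohomology_class p X g \<longleftrightarrow> (\<exists>\<psi>\<in>carrier (cochain_group (p - 1) X).
     f = restrict (\<lambda>c. restrict (\<lambda>c. \<psi> (chain_boundary p c)) (singular_chain_set p X) c + g c) (singular_chain_set p X))"
    by (simp add: cohomology_class_def r_coset_def mult_cochain_group coboundaries_def)
  also have "\<dots> \<longleftrightarrow> (\<exists>\<psi>\<in>carrier (cochain_group (p - 1) X). \<forall>c. singular_chain p X c \<longrightarrow>
       f c = g c + \<psi> (chain_boundary p c))"
  proof (intro bex_cong refl)
    fix \<psi>
    have "f c = undefined" if "\<not> singular_chain p X c" for c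
      using that f cochain_group_carrierD(5)[of f p X c] by (simp add: cocycles_def)
    then show "(f = restrict (\<lambda>c. restrict (\<lambda>c. \<psi> (chain_boundary p c)) (singular_chain_set p X) c + g c) (singular_chain_set p X))
      = (\<forall>c. singular_chain p X c \<longrightarrow> f c = g c + \<psi> (chain_boundary p c))"
      by (auto simp: fun_eq_iff restrict_def)
  qed
  finally show ?thesis
    using mem_cohomology_class_iff[OF f g] by simp
qed

section \<open>Pullback along continuous maps\<close>

definition pullback_cochain :: "nat \<Rightarrow> 'a topology \<Rightarrow> ('a \<Rightarrow> 'b) \<Rightarrow> ('b chain \<Rightarrow> int) \<Rightarrow> 'a chain \<Rightarrow> int" where
  "pullback_cochain p X T f = restrict (\<lambda>c. f (chain_map p T c)) (singular_chain_set p X)"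

lemma pullback_cocycle:
  assumes T: "continuous_map X Y T" and f: "f \<in> cocycles p Y"
  shows "pullback_cochain p X T f \<in> cocycles p X"
proof -
    have fc: "f \<in> carrier (cochain_group p Y)" using f by (simp add: cocycles_def)
    have "pullback_cochain p X T f \<in> carrier (cochain_group p X)"
      unfolding pullback_cochain_def
      by (rule cochain_group_carrierI)
         (simp add: chain_map_add cochain_group_carrierD[OF fc] singular_chain_chain_map[OF _ T])
    moreover have "pullback_cochain p X T f (chain_boundary (Suc p) c) = 0"
      if c: "singular_chain (Suc p) X c" for c
    proof -
      have "chain_map p T (chain_boundary (Suc p) c) = chain_boundary (Suc p) (chain_map (Suc p) T c)"
        using chain_boundary_chain_map[OF c, of T] by simp
      then show ?thesis
        using f singular_chain_chain_map[OF c T] singular_chain_boundary_alt[OF c]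
        by (simp add: pullback_cochain_def cocycles_def)
    qed
    ultimately show ?thesis by (simp add: cocycles_def)
qed

lemma pullback_mult:
  assumes T: "continuous_map X Y T"
  shows "pullback_cochain p X T (f \<otimes>\<^bsub>cochain_group p Y\<^esub> g) =
      pullback_cochain p X T f \<otimes>\<^bsub>cochain_group p X\<^esub> pullback_cochain p X T g"
    unfolding mult_cochain_group pullback_cochain_def
    by (rule restrict_ext) (simp add: singular_chain_chain_map[OF _ T])

text \<open>The pulled-back potential is the new potential, because chain maps commute with the
  boundary.\<close>

lemma pullback_coboundary:
  assumes T: "continuous_map X Y T" and h: "h \<in> coboundaries p Y"
  shows "pullback_cochain p X T h \<in> coboundaries p X"
proof -
  obtain \<psi> where \<psi>: "\<psi> \<in> carrier (cochain_group (p - 1) Y)"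
    and hd: "h = restrict (\<lambda>c. \<psi> (chain_boundary p c)) (singular_chain_set p Y)"
    using h by (auto simp: coboundaries_def)
  let ?\<psi>' = "restrict (\<lambda>c. \<psi> (chain_map (p - 1) T c)) (singular_chain_set (p - 1) X)"
  have "?\<psi>' \<in> carrier (cochain_group (p - 1) X)"
    by (rule cochain_group_carrierI)
         (simp add: chain_map_add cochain_group_carrierD[OF \<psi>] singular_chain_chain_map[OF _ T])
  moreover have "pullback_cochain p X T h = restrict (\<lambda>c. ?\<psi>' (chain_boundary p c)) (singular_chain_set p X)"
    unfolding pullback_cochain_def hd
  proof (rule restrict_ext)
    fix c assume c: "c \<in> singular_chain_set p X"
    then have "chain_boundary p (chain_map p T c) = chain_map (p - 1) T (chain_boundary p c)"
      using chain_boundary_chain_map[of p X c T] by simp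
    moreover have "singular_chain (p - 1) X (chain_boundary p c)"
      using singular_chain_boundary[of p X c] c by simp
    ultimately show "restrict (\<lambda>c. \<psi> (chain_boundary p c)) (singular_chain_set p Y) (chain_map p T c) =
         ?\<psi>' (chain_boundary p c)"
      using singular_chain_chain_map[OF _ T, of p c] c by simp
  qed
  ultimately show ?thesis
    unfolding coboundaries_def carrier_chain_group by - (rule image_eqI[where x="?\<psi>'"], assumption+)
qed

text \<open>\<open>cohomology_induced\<close> is a union over all representatives of a class.
  Pullback respects coboundaries, so every representative contributes the same coset and the union
  collapses to it.\<close>

lemma cohomology_induced_class:
  assumes T: "continuous_map X Y T" and f: "f \<in> cocycles p Y"
  shows "cohomology_induced p X T (cohomology_class p Y f) = cohomology_class p X (pullback_cochain p X T f)"
proof -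
  have cong: "cohomology_class p X (pullback_cochain p X T g) = cohomology_class p X (pullback_cochain p X T f)"
    if g: "g \<in> cohomology_class p Y f" for g
  proof -
    obtain h where h: "h \<in> coboundaries p Y" and gh: "g = h \<otimes>\<^bsub>cochain_group p Y\<^esub> f"
      using g by (auto simp: cohomology_class_def r_coset_def)
    have hc: "h \<in> cocycles p Y" using h coboundaries_subset by blast
    have pf: "pullback_cochain p X T f \<in> cocycles p X" and pg: "pullback_cochain p X T h \<in> cocycles p X"
      using pullback_cocycle[OF T] f hc by blast+
    have "pullback_cochain p X T g = pullback_cochain p X T h \<otimes>\<^bsub>cochain_group p X\<^esub> pullback_cochain p X T f"
      by (simp add: gh pullback_mult[OF T])
    moreover have pg': "pullback_cochain p X T g \<in> cocycles p X"
      using subgroup.m_closed[OF subgroup_cocycles pg pf] calculation by simp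
    ultimately have "pullback_cochain p X T g \<in> cohomology_class p X (pullback_cochain p X T f)"
      using pullback_coboundary[OF T h] by (auto simp: cohomology_class_def r_coset_def)
    then show ?thesis
      using mem_cohomology_class_iff[OF pg' pf] by simp
  qed
  have "cohomology_induced p X T (cohomology_class p Y f) =
    (\<Union>g\<in>cohomology_class p Y f. cohomology_class p X (pullback_cochain p X T g))"
    by (simp add: cohomology_induced_def cohomology_class_def pullback_cochain_def)
  then show ?thesis
    using UN_constant_eq[OF cohomology_class_self[OF f], of "\<lambda>g. cohomology_class p X (pullback_cochain p X T g)"] cong
    by simp
qed

lemma hom_cohomology_induced:
  assumes T: "continuous_map X Y T"
  shows "cohomology_induced p X T \<in> hom (cohomology_group p Y) (cohomology_group p X)"
proof (rule homI)
  fix c assume "c \<in> carrier (cohomology_group p Y)"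
  then show "cohomology_induced p X T c \<in> carrier (cohomology_group p X)"
    using pullback_cocycle[OF T]
    by (auto simp: carrier_cohomology_group cohomology_induced_class[OF T])
next
  fix c d assume "c \<in> carrier (cohomology_group p Y)" "d \<in> carrier (cohomology_group p Y)"
  then obtain f g where fg: "f \<in> cocycles p Y" "g \<in> cocycles p Y"
    and cd: "c = cohomology_class p Y f" "d = cohomology_class p Y g"
    by (auto simp: carrier_cohomology_group)
  have m: "cohomology_class p Y f \<otimes>\<^bsub>cohomology_group p Y\<^esub> cohomology_class p Y g
       = cohomology_class p Y (f \<otimes>\<^bsub>cochain_group p Y\<^esub> g)"
    using hom_mult[OF hom_cohomology_class, of f p Y g] fg by simp
  have fgm: "f \<otimes>\<^bsub>cochain_group p Y\<^esub> g \<in> cocycles p Y"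
    using subgroup.m_closed[OF subgroup_cocycles] fg by blast
  have pf: "pullback_cochain p X T f \<in> cocycles p X" "pullback_cochain p X T g \<in> cocycles p X"
    using pullback_cocycle[OF T] fg by blast+
  have "pullback_cochain p X T (f \<otimes>\<^bsub>cochain_group p Y\<^esub> g) =
     pullback_cochain p X T f \<otimes>\<^bsub>cochain_group p X\<^esub> pullback_cochain p X T g"
    by (rule pullback_mult[OF T])
  then show "cohomology_induced p X T (c \<otimes>\<^bsub>cohomology_group p Y\<^esub> d) =
     cohomology_induced p X T c \<otimes>\<^bsub>cohomology_group p X\<^esub> cohomology_induced p X T d"
    unfolding cd m cohomology_induced_class[OF T fgm] cohomology_induced_class[OF T fg(1)]
      cohomology_induced_class[OF T fg(2)]
    using hom_mult[OF hom_cohomology_class, of _ p X] pf by simp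
qed

section \<open>Cochains of degree one\<close>

text \<open>Barycentric coordinates identifying [0,1] with the standard 1-simplex, so that a
  singular edge becomes a path to which winding numbers apply.\<close>

definition edge_point :: "real \<Rightarrow> nat \<Rightarrow> real" where
  "edge_point u = (\<lambda>i. if i = 0 then 1 - u else if i = 1 then u else 0)"

definition triangle_point :: "real \<Rightarrow> real \<Rightarrow> nat \<Rightarrow> real" where
  "triangle_point s t = (\<lambda>i. if i = 0 then 1 - s - t else if i = 1 then s else if i = 2 then t else 0)"

definition path_simplex :: "(real \<Rightarrow> 'a) \<Rightarrow> (nat \<Rightarrow> real) \<Rightarrow> 'a" where
  "path_simplex g = restrict (\<lambda>x. g (x 1)) (standard_simplex 1)"

definition point_simplex :: "'a \<Rightarrow> (nat \<Rightarrow> real) \<Rightarrow> 'a" where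
  "point_simplex a = restrict (\<lambda>_. a) (standard_simplex 0)"

lemma edge_point_in_simplex [simp]: "edge_point u \<in> standard_simplex (Suc 0) \<longleftrightarrow> u \<in> {0..1}"
  by (force simp: edge_point_def standard_simplex_def)

lemma triangle_point_in_simplex:
  "0 \<le> s \<Longrightarrow> 0 \<le> t \<Longrightarrow> s + t \<le> 1 \<Longrightarrow> triangle_point s t \<in> standard_simplex 2"
  by (auto simp: triangle_point_def standard_simplex_def numeral_2_eq_2)

lemma edge_point_eq:
  assumes "x \<in> standard_simplex (Suc 0)" shows "x = edge_point (x (Suc 0))" "x (Suc 0) \<in> {0..1}"
proof -
  have "x 0 + x (Suc 0) = 1" "\<forall>i>Suc 0. x i = 0"
    using assms by (auto simp: standard_simplex_def)
  then show "x = edge_point (x (Suc 0))"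
    by (auto simp: edge_point_def fun_eq_iff)
  show "x (Suc 0) \<in> {0..1}"
    using assms by (auto simp: standard_simplex_def)
qed

lemma continuous_map_edge_point:
  "continuous_map (top_of_set {0..1}) (subtopology (powertop_real UNIV) (standard_simplex (Suc 0))) edge_point"
proof -
  have "continuous_on {0..1} (\<lambda>u. edge_point u k)" for k
    unfolding edge_point_def by (cases "k = 0"; cases "k = 1") (auto intro!: continuous_intros)
  then show ?thesis
    by (auto simp: continuous_map_in_subtopology continuous_map_componentwise)
qed

lemma path_singular_simplex:
  assumes "singular_simplex (Suc 0) (top_of_set F) \<sigma>"
  shows "path (\<sigma> \<circ> edge_point)" "path_image (\<sigma> \<circ> edge_point) \<subseteq> F"
  using continuous_map_compose[OF continuous_map_edge_point, of "top_of_set F" \<sigma>] assms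
  by (auto simp: singular_simplex_def path_def path_image_def)

lemma singular_simplex_path_simplex:
  assumes "path g" "path_image g \<subseteq> F"
  shows "singular_simplex (Suc 0) (top_of_set F) (path_simplex g)"
proof -
  have 1: "continuous_map (subtopology (powertop_real UNIV) (standard_simplex (Suc 0))) (top_of_set {0..1}) (\<lambda>x. x 1)"
    using edge_point_eq(2)
    by (auto simp: continuous_map_in_subtopology
        intro!: continuous_map_from_subtopology continuous_map_product_projection)
  have 2: "continuous_map (top_of_set {0..1}) (top_of_set F) g"
    using assms by (auto simp: path_def path_image_def)
  show ?thesis
    using continuous_map_compose[OF 1 2] by (auto simp: singular_simplex_def path_simplex_def o_def)
qed

lemma path_simplex_edge_point [simp]: "u \<in> {0..1} \<Longrightarrow> path_simplex g (edge_point u) = g u"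
  by (auto simp: path_simplex_def edge_point_def standard_simplex_def)

lemma edge_point_0: "edge_point 0 = (\<lambda>j. if j = 0 then 1 else 0)"
  by (auto simp: edge_point_def)

lemma point_simplex_vertex [simp]: "point_simplex a (edge_point 0) = a"
  by (simp add: point_simplex_def edge_point_0 standard_simplex_0)

text \<open>Face 0 omits vertex 0 and therefore gives the end point: the boundary is end minus
  start.\<close>

lemma chain_boundary_edge:
  "chain_boundary (Suc 0) (frag_of \<sigma>) =
     frag_of (point_simplex (\<sigma> (edge_point 1))) - frag_of (point_simplex (\<sigma> (edge_point 0)))"
proof -
  have "simplical_face 0 (\<lambda>j. if j = 0 then 1 else 0) = edge_point 1"
    by (auto simp: simplical_face_def edge_point_def fun_eq_iff)
  moreover have "simplical_face (Suc 0) (\<lambda>j. if j = 0 then 1 else 0) = edge_point 0"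
    by (auto simp: simplical_face_def edge_point_def fun_eq_iff)
  ultimately have "singular_face (Suc 0) 0 \<sigma> = point_simplex (\<sigma> (edge_point 1))"
    "singular_face (Suc 0) (Suc 0) \<sigma> = point_simplex (\<sigma> (edge_point 0))"
    unfolding singular_face_def point_simplex_def by (auto simp: standard_simplex_0 intro!: restrict_ext)
  then show ?thesis
    by (simp add: chain_boundary_of)
qed

text \<open>The edge opposite vertex \<open>k\<close> in the coordinates of
  \<open>triangle_point\<close>, traversed in increasing order of its vertices.\<close>

definition triangle_face :: "nat \<Rightarrow> real \<Rightarrow> real \<times> real" where
  "triangle_face k u = (if k = 0 then (1 - u, u) else if k = 1 then (0, u) else (u, 0))"

lemma singular_face_triangle:
  assumes "k \<le> 2" "u \<in> {0..1}"
  shows "singular_face 2 k \<tau> (edge_point u) = \<tau> (case_prod triangle_point (triangle_face k u))"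
proof -
  have "simplical_face k (edge_point u) = case_prod triangle_point (triangle_face k u)"
    using assms(1) by (auto simp: simplical_face_def edge_point_def triangle_face_def triangle_point_def fun_eq_iff
      numeral_2_eq_2 le_Suc_eq)
  then show ?thesis
    using assms(2) by (simp add: singular_face_def)
qed

lemma chain_boundary_triangle:
  "chain_boundary 2 (frag_of \<tau>) =
     frag_of (singular_face 2 0 \<tau>) - frag_of (singular_face 2 1 \<tau>) + frag_of (singular_face 2 2 \<tau>)"
  by (simp add: chain_boundary_of numeral_2_eq_2)

lemma continuous_on_triangle:
  assumes "singular_simplex 2 (top_of_set F) \<tau>"
  defines "D \<equiv> {(s, t). 0 \<le> s \<and> 0 \<le> t \<and> s + t \<le> (1::real)}"
  shows "continuous_on D (\<tau> \<circ> case_prod triangle_point)" "(\<tau> \<circ> case_prod triangle_point) ` D \<subseteq> F"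
proof -
  have "continuous_on D (\<lambda>x. case_prod triangle_point x k)" for k
    unfolding triangle_point_def case_prod_unfold
    by (cases "k = 0"; cases "k = 1"; cases "k = 2") (auto intro!: continuous_intros)
  moreover have "case_prod triangle_point ` D \<subseteq> standard_simplex 2"
    by (auto simp: D_def triangle_point_in_simplex)
  ultimately have "continuous_map (top_of_set D)
     (subtopology (powertop_real UNIV) (standard_simplex 2)) (case_prod triangle_point)"
    by (auto simp: continuous_map_in_subtopology continuous_map_componentwise)
  from continuous_map_compose[OF this, of "top_of_set F" \<tau>] assms(1)
  have "continuous_map (top_of_set D) (top_of_set F) (\<tau> \<circ> case_prod triangle_point)"
    by (simp add: singular_simplex_def)
  then show "continuous_on D (\<tau> \<circ> case_prod triangle_point)" "(\<tau> \<circ> case_prod triangle_point) ` D \<subseteq> F"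
    by (simp_all add: image_subset_iff_funcset o_def)
qed

text \<open>The linear extension of \<open>k\<close> to chains. Each generator is sent into the free
  abelian group on \<open>()\<close>, whose single coefficient is then read off.\<close>

definition frag_eval :: "('a \<Rightarrow> int) \<Rightarrow> ('a \<Rightarrow>\<^sub>0 int) \<Rightarrow> int" where
  "frag_eval k c = Poly_Mapping.lookup (frag_extend (\<lambda>x. frag_cmul (k x) (frag_of ())) c) ()"

lemma frag_eval_simps [simp]:
  "frag_eval k 0 = 0"
  "frag_eval k (frag_of x) = k x"
  "frag_eval k (c + d) = frag_eval k c + frag_eval k d"
  "frag_eval k (c - d) = frag_eval k c - frag_eval k d"
  by (auto simp: frag_eval_def frag_extend_add frag_extend_diff lookup_add lookup_minus)

definition cochain_of :: "nat \<Rightarrow> 'a topology \<Rightarrow> (((nat \<Rightarrow> real) \<Rightarrow> 'a) \<Rightarrow> int) \<Rightarrow> 'a chain \<Rightarrow> int" where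
  "cochain_of p X k = restrict (frag_eval k) (singular_chain_set p X)"

lemma cochain_of_in_carrier: "cochain_of p X k \<in> carrier (cochain_group p X)"
  unfolding cochain_of_def by (rule cochain_group_carrierI) simp

lemma cochain_of_simplex [simp]: "singular_simplex p X \<sigma> \<Longrightarrow> cochain_of p X k (frag_of \<sigma>) = k \<sigma>"
  by (simp add: cochain_of_def singular_chain_of)

text \<open>Only compatibility with differences is asked for, so the rule also covers composites
  such as a cochain after the boundary or after a chain map. The induction has to carry along that
  its chains are singular chains of \<open>X\<close>.\<close>

lemma cochain_eq_on_simplices:
  assumes c: "singular_chain p X c"
    and f: "f 0 = 0" "\<And>c d. singular_chain p X c \<Longrightarrow> singular_chain p X d \<Longrightarrow> f (c - d) = f c - f d"
    and g: "g 0 = 0" "\<And>c d. singular_chain p X c \<Longrightarrow> singular_chain p X d \<Longrightarrow> g (c - d) = g c - g d"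
    and eq: "\<And>\<sigma>. singular_simplex p X \<sigma> \<Longrightarrow> f (frag_of \<sigma>) = (g (frag_of \<sigma>) :: int)"
  shows "f c = g c"
proof -
  have "singular_chain p X c \<and> f c = g c"
    using c unfolding singular_chain_def
  proof (induction rule: frag_induction)
    case (one x)
    then show ?case using eq by simp
  next
    case (diff a b)
    then show ?case
      using f(2)[of a b] g(2)[of a b] keys_diff[of a b] unfolding singular_chain_def by fastforce
  qed (use f g in auto)
  then show ?thesis by simp
qed

lemma cocycle1I:
  assumes f: "f \<in> carrier (cochain_group (Suc 0) X)"
    and tri: "\<And>\<tau>. singular_simplex 2 X \<tau> \<Longrightarrow>
      f (frag_of (singular_face 2 0 \<tau>)) + f (frag_of (singular_face 2 2 \<tau>)) = f (frag_of (singular_face 2 1 \<tau>))"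
  shows "f \<in> cocycles (Suc 0) X"
proof -
  note fD = cochain_group_carrierD[OF f]
  have "f (chain_boundary 2 c) = 0" if c: "singular_chain 2 X c" for c
  proof (rule cochain_eq_on_simplices[OF c, where g = "\<lambda>_. 0"])
    fix \<sigma> assume s: "singular_simplex 2 X \<sigma>"
    have "singular_chain (Suc 0) X (frag_of (singular_face 2 k \<sigma>))" if "k \<le> 2" for k
      using singular_simplex_singular_face[OF s, of k] that by (simp add: singular_chain_of numeral_2_eq_2)
    then show "f (chain_boundary 2 (frag_of \<sigma>)) = 0"
      using tri[OF s] by (simp add: chain_boundary_triangle fD singular_chain_diff del: One_nat_def)
  qed (use singular_chain_boundary_alt[of 1 X] in \<open>auto simp: fD chain_boundary_diff numeral_2_eq_2\<close>)
  then show ?thesis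
    using f by (simp add: cocycles_def numeral_2_eq_2)
qed

text \<open>Singular 0-simplices are points, so any function on points is a 0-cochain, whose
  coboundary on an edge is the difference of the endpoint values.\<close>

lemma cohomology_class1_eqI:
  assumes f: "f \<in> cocycles (Suc 0) X" and g: "g \<in> cocycles (Suc 0) X"
    and eq: "\<And>\<sigma>. singular_simplex (Suc 0) X \<sigma> \<Longrightarrow>
       f (frag_of \<sigma>) = g (frag_of \<sigma>) + (\<psi> (\<sigma> (edge_point 1)) - \<psi> (\<sigma> (edge_point 0)))"
  shows "cohomology_class (Suc 0) X f = cohomology_class (Suc 0) X g"
proof -
  have fc: "f \<in> carrier (cochain_group (Suc 0) X)" and gc: "g \<in> carrier (cochain_group (Suc 0) X)"
    using f g by (auto simp: cocycles_def)
  note D = cochain_group_carrierD[OF fc] cochain_group_carrierD[OF gc]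
  let ?\<psi> = "cochain_of 0 X (\<lambda>s. \<psi> (s (edge_point 0)))"
  note DP = cochain_group_carrierD[OF cochain_of_in_carrier[of 0 X "\<lambda>s. \<psi> (s (edge_point 0))"]]
  have "f c = g c + ?\<psi> (chain_boundary (Suc 0) c)" if c: "singular_chain (Suc 0) X c" for c
  proof (rule cochain_eq_on_simplices[OF c])
    fix \<sigma> assume s: "singular_simplex (Suc 0) X \<sigma>"
    then have "singular_chain 0 X (chain_boundary (Suc 0) (frag_of \<sigma>))"
      using singular_chain_boundary_alt[of 0 X] by (simp add: singular_chain_of)
    then have "?\<psi> (chain_boundary (Suc 0) (frag_of \<sigma>)) = \<psi> (\<sigma> (edge_point 1)) - \<psi> (\<sigma> (edge_point 0))"
      by (simp add: cochain_of_def chain_boundary_edge)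
    then show "f (frag_of \<sigma>) = g (frag_of \<sigma>) + ?\<psi> (chain_boundary (Suc 0) (frag_of \<sigma>))"
      using eq[OF s] by simp
  qed (use singular_chain_boundary_alt[of 0 X] in \<open>auto simp: D DP chain_boundary_diff\<close>)
  then show ?thesis
    unfolding cohomology_class_eq_iff[OF f g] using cochain_of_in_carrier[of 0 X] by fastforce
qed

text \<open>The boundary of a closed edge is 0, so coboundaries vanish on it and the value of a
  cocycle there depends on its class alone.\<close>

lemma coboundary1_loop:
  assumes f: "f \<in> cocycles (Suc 0) X" and g: "g \<in> cocycles (Suc 0) X"
    and eq: "cohomology_class (Suc 0) X f = cohomology_class (Suc 0) X g"
    and s: "singular_simplex (Suc 0) X \<sigma>" "\<sigma> (edge_point 0) = \<sigma> (edge_point 1)"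
  shows "f (frag_of \<sigma>) = g (frag_of \<sigma>)"
proof -
  obtain \<psi> where p: "\<psi> \<in> carrier (cochain_group 0 X)"
    "f (frag_of \<sigma>) = g (frag_of \<sigma>) + \<psi> (chain_boundary (Suc 0) (frag_of \<sigma>))"
    using eq s unfolding cohomology_class_eq_iff[OF f g] by (auto simp: singular_chain_of)
  then show ?thesis
    using s(2) cochain_group_carrierD(2)[OF p(1)] by (simp add: chain_boundary_edge)
qed

section \<open>Classes of nonvanishing functions\<close>

text \<open>Winding numbers of paths that are not closed are complex numbers. Any continuous
  logarithm computes them, which turns the additivity statements that follow into telescoping
  sums.\<close>

lemma winding_number_exp_log:
  assumes "path q" "\<And>t. t \<in> {0..1} \<Longrightarrow> p t = exp (q t)"
  shows "winding_number p 0 = (q 1 - q 0) / (2 * of_real pi * \<i>)"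
  using winding_number_cong[of p "exp \<circ> q" 0] winding_number_compose_exp[OF assms(1)] assms(2)
  by (simp add: pathstart_def pathfinish_def)

lemma winding_number_mult:
  assumes "path p" "0 \<notin> path_image p" "path q" "0 \<notin> path_image q"
  shows "winding_number (\<lambda>t. p t * q t) 0 = winding_number p 0 + winding_number q 0"
proof -
  obtain l where l: "path l" "\<And>t. t \<in> {0..1} \<Longrightarrow> p t = 0 + exp (l t)"
    using winding_number_as_continuous_log[OF assms(1,2)] by metis
  obtain m where m: "path m" "\<And>t. t \<in> {0..1} \<Longrightarrow> q t = 0 + exp (m t)"
    using winding_number_as_continuous_log[OF assms(3,4)] by metis
  have "winding_number (\<lambda>t. p t * q t) 0 = ((l 1 + m 1) - (l 0 + m 0)) / (2 * of_real pi * \<i>)"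
    by (rule winding_number_exp_log[where q = "\<lambda>t. l t + m t"])
       (use l m in \<open>auto simp: path_def exp_add intro: continuous_intros\<close>)
  then show ?thesis
    using winding_number_exp_log[of l p] winding_number_exp_log[of m q] l m
    by (simp add: diff_divide_distrib add_divide_distrib)
qed

text \<open>A logarithm exists on the contractible square; up to a common factor, both sides are its
  increment from (0,0) to (1,1).\<close>

lemma winding_number_square:
  fixes h :: "real \<times> real \<Rightarrow> complex"
  assumes h: "continuous_on ({0..1} \<times> {0..1}) h" "\<And>z. z \<in> {0..1} \<times> {0..1} \<Longrightarrow> h z \<noteq> 0"
  shows "winding_number (\<lambda>t. h (0, t)) 0 + winding_number (\<lambda>t. h (t, 1)) 0 =
         winding_number (\<lambda>t. h (t, 0)) 0 + winding_number (\<lambda>t. h (1, t)) 0"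
proof -
  have "contractible ({0..1} \<times> {0..1} :: (real \<times> real) set)"
    by (intro convex_imp_contractible convex_Times) auto
  then obtain l where l: "continuous_on ({0..1} \<times> {0..1}) l" "\<And>z. z \<in> {0..1} \<times> {0..1} \<Longrightarrow> h z = exp (l z)"
    using continuous_logarithm_on_contractible[OF h(1)] h(2) by metis
  have c: "path (\<lambda>t. l (g t))" if "continuous_on {0..1} g" "g ` {0..1} \<subseteq> {0..1} \<times> {0..1}" for g
    unfolding path_def using continuous_on_compose2[OF l(1) that] .
  have "winding_number (\<lambda>t. h (0, t)) 0 = (l (0, 1) - l (0, 0)) / (2 * of_real pi * \<i>)"
    by (rule winding_number_exp_log[OF c]) (use l in \<open>auto intro!: continuous_intros\<close>)
  moreover have "winding_number (\<lambda>t. h (1, t)) 0 = (l (1, 1) - l (1, 0)) / (2 * of_real pi * \<i>)"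
    by (rule winding_number_exp_log[OF c]) (use l in \<open>auto intro!: continuous_intros\<close>)
  moreover have "winding_number (\<lambda>t. h (t, 0)) 0 = (l (1, 0) - l (0, 0)) / (2 * of_real pi * \<i>)"
    by (rule winding_number_exp_log[OF c]) (use l in \<open>auto intro!: continuous_intros\<close>)
  moreover have "winding_number (\<lambda>t. h (t, 1)) 0 = (l (1, 1) - l (0, 1)) / (2 * of_real pi * \<i>)"
    by (rule winding_number_exp_log[OF c]) (use l in \<open>auto intro!: continuous_intros\<close>)
  ultimately show ?thesis
    by (simp add: diff_divide_distrib)
qed

lemma winding_number_triangle_faces:
  fixes h :: "real \<times> real \<Rightarrow> complex"
  assumes h: "continuous_on {(s, t). 0 \<le> s \<and> 0 \<le> t \<and> s + t \<le> 1} h"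
    "\<And>s t. 0 \<le> s \<Longrightarrow> 0 \<le> t \<Longrightarrow> s + t \<le> 1 \<Longrightarrow> h (s, t) \<noteq> 0"
  shows "winding_number (\<lambda>u. h (triangle_face 0 u)) 0 + winding_number (\<lambda>u. h (triangle_face 2 u)) 0 =
         winding_number (\<lambda>u. h (triangle_face 1 u)) 0"
proof -
  let ?D = "{(s, t). 0 \<le> s \<and> 0 \<le> t \<and> s + t \<le> (1::real)}"
  have "?D = ({0..} \<times> {0..}) \<inter> {z. (1, 1) \<bullet> z \<le> 1}"
    by auto
  then have "convex ?D"
    by (metis convex_Int convex_Times convex_halfspace_le convex_real_interval(1))
  then obtain l where l: "continuous_on ?D l" "\<And>z. z \<in> ?D \<Longrightarrow> h z = exp (l z)"
    using continuous_logarithm_on_contractible[OF h(1)] h(2) convex_imp_contractible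
    by (metis (mono_tags, lifting) case_prodE mem_Collect_eq)
  have c: "path (\<lambda>t. l (g t))" if "continuous_on {0..1} g" "g ` {0..1} \<subseteq> ?D" for g
    unfolding path_def using continuous_on_compose2[OF l(1) that] .
  have "winding_number (\<lambda>u. h (triangle_face 0 u)) 0 = (l (0, 1) - l (1, 0)) / (2 * of_real pi * \<i>)"
    by (subst winding_number_exp_log[OF c[of "triangle_face 0"]])
       (use l in \<open>auto intro!: continuous_intros simp: triangle_face_def\<close>)
  moreover have "winding_number (\<lambda>u. h (triangle_face 1 u)) 0 = (l (0, 1) - l (0, 0)) / (2 * of_real pi * \<i>)"
    by (subst winding_number_exp_log[OF c[of "triangle_face 1"]])
       (use l in \<open>auto intro!: continuous_intros simp: triangle_face_def\<close>)
  moreover have "winding_number (\<lambda>u. h (triangle_face 2 u)) 0 = (l (1, 0) - l (0, 0)) / (2 * of_real pi * \<i>)"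
    by (subst winding_number_exp_log[OF c[of "triangle_face 2"]])
       (use l in \<open>auto intro!: continuous_intros simp: triangle_face_def\<close>)
  ultimately show ?thesis
    by (simp add: diff_divide_distrib)
qed

lemma exp_2pi_eq_1_imp_int:
  assumes "exp (2 * of_real pi * \<i> * z) = 1"
  shows "z \<in> \<int>"
proof -
  obtain n :: int where "Im z = 0" "Re z = of_int n"
    using assms by (auto simp: exp_eq_1)
  then have "z = of_int n"
    by (simp add: complex_eq_iff)
  then show ?thesis by simp
qed

text \<open>The turning of a nonvanishing function along a singular edge is not an integer; correcting
  it by a fixed branch of the logarithm at the two endpoints makes it one without changing the
  complex cohomology class.\<close>

definition turning :: "('a \<Rightarrow> complex) \<Rightarrow> ((nat \<Rightarrow> real) \<Rightarrow> 'a) \<Rightarrow> int" where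
  "turning \<phi> \<sigma> = \<lfloor>Re (winding_number (\<phi> \<circ> \<sigma> \<circ> edge_point) 0 -
     (Ln (\<phi> (\<sigma> (edge_point 1))) - Ln (\<phi> (\<sigma> (edge_point 0)))) / (2 * of_real pi * \<i>))\<rfloor>"

text \<open>Multiplied by 2 pi i and exponentiated, the right-hand side becomes 1. It is therefore
  an integer, and the floor in \<open>turning\<close> loses nothing.\<close>

lemma of_int_turning:
  assumes p: "path (\<phi> \<circ> \<sigma> \<circ> edge_point)" "0 \<notin> path_image (\<phi> \<circ> \<sigma> \<circ> edge_point)"
  shows "of_int (turning \<phi> \<sigma>) = winding_number (\<phi> \<circ> \<sigma> \<circ> edge_point) 0 -
     (Ln (\<phi> (\<sigma> (edge_point 1))) - Ln (\<phi> (\<sigma> (edge_point 0)))) / (2 * of_real pi * \<i>)" (is "_ = ?w - (?l1 - ?l0) / ?c")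
proof -
  let ?p = "\<phi> \<circ> \<sigma> \<circ> edge_point"
  have nz: "?p 0 \<noteq> 0" "?p 1 \<noteq> 0"
    using p(2) by (auto simp: path_image_def image_iff)
  have "exp (?c * (?w - (?l1 - ?l0) / ?c)) = exp (?c * ?w) * exp ?l0 / exp ?l1"
  proof -
    have "?c * (?w - (?l1 - ?l0) / ?c) = ?c * ?w + ?l0 - ?l1"
      by (simp add: field_simps)
    then show ?thesis
      by (simp only: exp_add exp_diff)
  qed
  also have "\<dots> = 1"
    using winding_number_exp_2pi[OF p] nz by (simp add: pathstart_def pathfinish_def mult_ac)
  finally have "?w - (?l1 - ?l0) / ?c \<in> \<int>"
    by (rule exp_2pi_eq_1_imp_int)
  then obtain n where n: "?w - (?l1 - ?l0) / ?c = of_int n"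
    by (auto elim!: Ints_cases)
  show ?thesis
    unfolding turning_def n by simp
qed

definition nonvanishing_on :: "'a::topological_space set \<Rightarrow> ('a \<Rightarrow> complex) \<Rightarrow> bool" where
  "nonvanishing_on F \<phi> \<longleftrightarrow> continuous_on F \<phi> \<and> (\<forall>x\<in>F. \<phi> x \<noteq> 0)"

definition turning_cochain :: "'a::topological_space set \<Rightarrow> ('a \<Rightarrow> complex) \<Rightarrow> 'a chain \<Rightarrow> int" where
  "turning_cochain F \<phi> = cochain_of 1 (top_of_set F) (turning \<phi>)"

definition turning_class :: "'a::topological_space set \<Rightarrow> ('a \<Rightarrow> complex) \<Rightarrow> ('a chain \<Rightarrow> int) set" where
  "turning_class F \<phi> = cohomology_class 1 (top_of_set F) (turning_cochain F \<phi>)"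

lemma nonvanishing_path:
  assumes "nonvanishing_on F \<phi>" "path g" "path_image g \<subseteq> F"
  shows "path (\<phi> \<circ> g)" "0 \<notin> path_image (\<phi> \<circ> g)"
  using assms by (auto simp: nonvanishing_on_def path_image_compose intro: path_continuous_image continuous_on_subset)

lemma turning_cochain_simplex:
  assumes "nonvanishing_on F \<phi>" "singular_simplex (Suc 0) (top_of_set F) \<sigma>"
  shows "of_int (turning_cochain F \<phi> (frag_of \<sigma>)) = winding_number (\<phi> \<circ> \<sigma> \<circ> edge_point) 0 -
     (Ln (\<phi> (\<sigma> (edge_point 1))) - Ln (\<phi> (\<sigma> (edge_point 0)))) / (2 * of_real pi * \<i>)"
  using nonvanishing_path[OF assms(1) path_singular_simplex[OF assms(2)]] assms(2)
  by (simp add: turning_cochain_def of_int_turning o_assoc)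

text \<open>The winding numbers of the faces add up because a logarithm exists on the triangle, and
  the endpoint corrections telescope.\<close>

lemma turning_cochain_cocycle:
  assumes \<phi>: "nonvanishing_on F \<phi>"
  shows "turning_cochain F \<phi> \<in> cocycles (Suc 0) (top_of_set F)"
proof (rule cocycle1I)
  show "turning_cochain F \<phi> \<in> carrier (cochain_group (Suc 0) (top_of_set F))"
    using cochain_of_in_carrier[of "Suc 0"] by (simp add: turning_cochain_def)
  fix \<tau> assume \<tau>: "singular_simplex 2 (top_of_set F) \<tau>"
  define h where "h = \<phi> \<circ> \<tau> \<circ> case_prod triangle_point"
  note ct = continuous_on_triangle[OF \<tau>]
  have h: "continuous_on {(s, t). 0 \<le> s \<and> 0 \<le> t \<and> s + t \<le> 1} h"
    using \<phi> ct unfolding h_def nonvanishing_on_def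
    by (metis (no_types, lifting) comp_assoc continuous_on_compose continuous_on_subset)
  have h0: "h (s, t) \<noteq> 0" if "0 \<le> s" "0 \<le> t" "s + t \<le> 1" for s t
    using \<phi> ct(2) that by (auto simp: h_def nonvanishing_on_def image_subset_iff)
  have face: "singular_simplex (Suc 0) (top_of_set F) (singular_face 2 k \<tau>)" if "k \<le> 2" for k
    using singular_simplex_singular_face[OF \<tau>, of k] that by (simp add: numeral_2_eq_2)
  have w: "winding_number (\<phi> \<circ> singular_face 2 k \<tau> \<circ> edge_point) 0 = winding_number (\<lambda>u. h (triangle_face k u)) 0"
    if "k \<le> 2" for k
    by (rule winding_number_cong) (use that in \<open>simp add: h_def singular_face_triangle\<close>)
  have v: "singular_face 2 k \<tau> (edge_point u) = \<tau> (case_prod triangle_point (triangle_face k u))"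
    if "k \<le> 2" "u \<in> {0..1}" for k u
    using that by (rule singular_face_triangle)
  have "complex_of_int (turning_cochain F \<phi> (frag_of (singular_face 2 0 \<tau>)) + turning_cochain F \<phi> (frag_of (singular_face 2 2 \<tau>)))
     = of_int (turning_cochain F \<phi> (frag_of (singular_face 2 1 \<tau>)))"
    using winding_number_triangle_faces[OF h h0]
    by (simp add: turning_cochain_simplex[OF \<phi> face] w v triangle_face_def diff_divide_distrib del: One_nat_def)
  then show "turning_cochain F \<phi> (frag_of (singular_face 2 0 \<tau>)) + turning_cochain F \<phi> (frag_of (singular_face 2 2 \<tau>))
     = turning_cochain F \<phi> (frag_of (singular_face 2 1 \<tau>))"
    by (simp only: of_int_eq_iff)
qed

text \<open>The potential need not be integral, but its real part changes by integers along edges.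
  Its floor is then an integral potential with the same differences.\<close>

lemma cohomology_class1_eqI_complex:
  assumes f: "f \<in> cocycles (Suc 0) X" and g: "g \<in> cocycles (Suc 0) X"
    and eq: "\<And>\<sigma>. singular_simplex (Suc 0) X \<sigma> \<Longrightarrow>
       complex_of_int (f (frag_of \<sigma>)) = of_int (g (frag_of \<sigma>)) + (\<psi> (\<sigma> (edge_point 1)) - \<psi> (\<sigma> (edge_point 0)))"
  shows "cohomology_class (Suc 0) X f = cohomology_class (Suc 0) X g"
proof (rule cohomology_class1_eqI[OF f g])
  fix \<sigma> assume "singular_simplex (Suc 0) X \<sigma>"
  from arg_cong[OF eq[OF this], of Re]
  have "Re (\<psi> (\<sigma> (edge_point 1))) = Re (\<psi> (\<sigma> (edge_point 0))) + of_int (f (frag_of \<sigma>) - g (frag_of \<sigma>))"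
    by simp
  then have "\<lfloor>Re (\<psi> (\<sigma> (edge_point 1)))\<rfloor> = \<lfloor>Re (\<psi> (\<sigma> (edge_point 0)))\<rfloor> + (f (frag_of \<sigma>) - g (frag_of \<sigma>))"
    by (metis floor_add_int)
  then show "f (frag_of \<sigma>) = g (frag_of \<sigma>) + (\<lfloor>Re (\<psi> (\<sigma> (edge_point 1)))\<rfloor> - \<lfloor>Re (\<psi> (\<sigma> (edge_point 0)))\<rfloor>)"
    by simp
qed

lemma turning_class_closed:
  "nonvanishing_on F \<phi> \<Longrightarrow> turning_class F \<phi> \<in> carrier (cohomology_group 1 (top_of_set F))"
  using turning_cochain_cocycle by (auto simp: turning_class_def carrier_cohomology_group)

lemma nonvanishing_on_mult:
  "nonvanishing_on F \<phi> \<Longrightarrow> nonvanishing_on F \<psi> \<Longrightarrow> nonvanishing_on F (\<lambda>x. \<phi> x * \<psi> x)"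
  by (auto simp: nonvanishing_on_def intro!: continuous_intros)

lemma nonvanishing_on_powi:
  "nonvanishing_on F \<phi> \<Longrightarrow> nonvanishing_on F (\<lambda>x. \<phi> x powi n)"
  by (auto simp: nonvanishing_on_def intro!: continuous_intros)

lemma nonvanishing_on_power:
  "nonvanishing_on F \<phi> \<Longrightarrow> nonvanishing_on F (\<lambda>x. \<phi> x ^ n)"
  by (auto simp: nonvanishing_on_def intro!: continuous_intros)

text \<open>Winding numbers are additive while the principal logarithm is not; the defect depends on
  the endpoints alone and so is a coboundary.\<close>

lemma turning_class_mult:
  assumes \<phi>: "nonvanishing_on F \<phi>" and \<psi>: "nonvanishing_on F \<psi>"
  shows "turning_class F (\<lambda>x. \<phi> x * \<psi> x) =
    turning_class F \<phi> \<otimes>\<^bsub>cohomology_group 1 (top_of_set F)\<^esub> turning_class F \<psi>"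
proof -
  let ?X = "top_of_set F" and ?L = "\<lambda>\<phi> x. Ln (\<phi> x) / (2 * of_real pi * \<i>)"
  have m: "turning_class F \<phi> \<otimes>\<^bsub>cohomology_group 1 ?X\<^esub> turning_class F \<psi> =
     cohomology_class 1 ?X (turning_cochain F \<phi> \<otimes>\<^bsub>cochain_group 1 ?X\<^esub> turning_cochain F \<psi>)"
    using hom_mult[OF hom_cohomology_class, of "turning_cochain F \<phi>" 1 ?X "turning_cochain F \<psi>"]
      turning_cochain_cocycle[OF \<phi>] turning_cochain_cocycle[OF \<psi>]
    by (simp add: turning_class_def)
  have "cohomology_class (Suc 0) ?X (turning_cochain F (\<lambda>x. \<phi> x * \<psi> x)) =
     cohomology_class (Suc 0) ?X (turning_cochain F \<phi> \<otimes>\<^bsub>cochain_group (Suc 0) ?X\<^esub> turning_cochain F \<psi>)"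
  proof (rule cohomology_class1_eqI_complex)
    fix \<sigma> assume \<sigma>: "singular_simplex (Suc 0) ?X \<sigma>"
    note p = path_singular_simplex[OF \<sigma>]
    have "winding_number ((\<lambda>x. \<phi> x * \<psi> x) \<circ> \<sigma> \<circ> edge_point) 0 =
      winding_number (\<phi> \<circ> \<sigma> \<circ> edge_point) 0 + winding_number (\<psi> \<circ> \<sigma> \<circ> edge_point) 0"
      using winding_number_mult[OF nonvanishing_path[OF \<phi> p] nonvanishing_path[OF \<psi> p]] by (simp add: o_def)
    then show "complex_of_int (turning_cochain F (\<lambda>x. \<phi> x * \<psi> x) (frag_of \<sigma>)) =
       of_int ((turning_cochain F \<phi> \<otimes>\<^bsub>cochain_group (Suc 0) ?X\<^esub> turning_cochain F \<psi>) (frag_of \<sigma>)) +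
       ((?L \<phi> (\<sigma> (edge_point 1)) + ?L \<psi> (\<sigma> (edge_point 1)) - ?L (\<lambda>x. \<phi> x * \<psi> x) (\<sigma> (edge_point 1))) -
        (?L \<phi> (\<sigma> (edge_point 0)) + ?L \<psi> (\<sigma> (edge_point 0)) - ?L (\<lambda>x. \<phi> x * \<psi> x) (\<sigma> (edge_point 0))))"
      using \<sigma> by (simp add: mult_cochain_group singular_chain_of turning_cochain_simplex[OF _ \<sigma>]
          \<phi> \<psi> nonvanishing_on_mult[OF \<phi> \<psi>] diff_divide_distrib)
  qed (use turning_cochain_cocycle nonvanishing_on_mult[OF \<phi> \<psi>] \<phi> \<psi> subgroup.m_closed[OF subgroup_cocycles] in blast)+
  then show ?thesis
    using m by (simp add: turning_class_def)
qed

lemma group_cohomology_group: "Group.group (cohomology_group p X)"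
  by (rule comm_group.axioms(2)[OF comm_group_cohomology_group])

lemma turning_class_one: "turning_class F (\<lambda>x. 1) = \<one>\<^bsub>cohomology_group 1 (top_of_set F)\<^esub>"
proof -
  interpret Group.group "cohomology_group 1 (top_of_set F)" by (rule group_cohomology_group)
  have "nonvanishing_on F (\<lambda>x. 1)" by (simp add: nonvanishing_on_def)
  then have c: "turning_class F (\<lambda>x. 1) \<in> carrier (cohomology_group 1 (top_of_set F))"
    and "turning_class F (\<lambda>x. 1) \<otimes>\<^bsub>cohomology_group 1 (top_of_set F)\<^esub> turning_class F (\<lambda>x. 1) =
      turning_class F (\<lambda>x. 1)"
    using turning_class_closed turning_class_mult[of F "\<lambda>x. 1" "\<lambda>x. 1"] by simp_all
  then show ?thesis
    using l_cancel_one[OF c c] by blast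
qed

lemma turning_class_powi:
  assumes \<phi>: "nonvanishing_on F \<phi>"
  shows "turning_class F (\<lambda>x. \<phi> x powi n) = turning_class F \<phi> [^]\<^bsub>cohomology_group 1 (top_of_set F)\<^esub> n"
proof -
  interpret Group.group "cohomology_group 1 (top_of_set F)" by (rule group_cohomology_group)
  note cl = turning_class_closed[OF \<phi>]
  have nat: "turning_class F (\<lambda>x. \<phi> x ^ k) = turning_class F \<phi> [^]\<^bsub>cohomology_group 1 (top_of_set F)\<^esub> k" for k
  proof (induction k)
    case (Suc k)
    from turning_class_mult[OF nonvanishing_on_power[OF \<phi>] \<phi>] Suc show ?case by (simp add: mult.commute)
  qed (simp add: turning_class_one[simplified])
  show ?thesis
  proof (cases n)
    case (nonneg k)
    then show ?thesis using nat by (simp add: int_pow_int)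
  next
    case (neg k)
    have v: "nonvanishing_on F (\<lambda>x. \<phi> x powi n)" "nonvanishing_on F (\<lambda>x. \<phi> x ^ Suc k)"
      using nonvanishing_on_powi[OF \<phi>] nonvanishing_on_power[OF \<phi>] by blast+
    have "turning_class F (\<lambda>x. \<phi> x powi n * \<phi> x ^ Suc k) = \<one>\<^bsub>cohomology_group 1 (top_of_set F)\<^esub>"
    proof -
      \<comment> \<open>Off \<open>F\<close> the function may vanish, and the product is then not 1.
        Equality is therefore shown for the cochains, which see only simplices in
        \<open>F\<close>.\<close>
      have "turning_cochain F (\<lambda>x. \<phi> x powi n * \<phi> x ^ Suc k) = turning_cochain F (\<lambda>x. 1)"
        unfolding turning_cochain_def cochain_of_def
      proof (rule restrict_ext)
        fix c assume c: "c \<in> singular_chain_set 1 (top_of_set F)"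
        show "frag_eval (turning (\<lambda>x. \<phi> x powi n * \<phi> x ^ Suc k)) c = frag_eval (turning (\<lambda>x. 1)) c"
        proof (rule cochain_eq_on_simplices[of 1 "top_of_set F" c])
          fix \<sigma> assume "singular_simplex 1 (top_of_set F) \<sigma>"
          then have "path_image (\<sigma> \<circ> edge_point) \<subseteq> F"
            using path_singular_simplex(2)[of F \<sigma>] by simp
          then have "\<sigma> (edge_point u) \<in> F" if "u \<in> {0..1}" for u
            using that by (auto simp: path_image_def)
          then have e: "\<phi> (\<sigma> (edge_point u)) powi n * \<phi> (\<sigma> (edge_point u)) ^ Suc k = 1" if "u \<in> {0..1}" for u
            using that \<phi> neg unfolding nonvanishing_on_def
            by (metis left_inverse power_int_minus power_int_of_nat power_eq_0_iff)
          have "winding_number ((\<lambda>x. \<phi> x powi n * \<phi> x ^ Suc k) \<circ> \<sigma> \<circ> edge_point) 0 =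
             winding_number ((\<lambda>x. 1) \<circ> \<sigma> \<circ> edge_point) 0"
            by (rule winding_number_cong) (use e in simp)
          then show "frag_eval (turning (\<lambda>x. \<phi> x powi n * \<phi> x ^ Suc k)) (frag_of \<sigma>) = frag_eval (turning (\<lambda>x. 1)) (frag_of \<sigma>)"
            using e[of 0] e[of 1] by (simp add: turning_def)
        qed (use c in auto)
      qed
      then show ?thesis
        unfolding turning_class_one[symmetric] turning_class_def by (rule arg_cong)
    qed
    then have "inv\<^bsub>cohomology_group 1 (top_of_set F)\<^esub> turning_class F (\<lambda>x. \<phi> x ^ Suc k) =
        turning_class F (\<lambda>x. \<phi> x powi n)"
      using turning_class_closed[OF v(1)] turning_class_closed[OF v(2)]
      by (intro inv_equality) (simp_all only: turning_class_mult[OF v])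
    then have "turning_class F (\<lambda>x. \<phi> x powi n) = inv\<^bsub>cohomology_group 1 (top_of_set F)\<^esub> (turning_class F \<phi> [^]\<^bsub>cohomology_group 1 (top_of_set F)\<^esub> Suc k)"
      unfolding nat by (rule sym)
    then show ?thesis
      unfolding neg using cl by (simp only: int_pow_neg_int)
  qed
qed

text \<open>The square formula gives the potential between the two cocycles: it is the winding
  number of the track of a point under the homotopy, up to the endpoint terms coming from the branch
  of the logarithm.\<close>

lemma turning_class_homotopic:
  assumes H: "continuous_on ({0..1} \<times> F) H" and nz: "\<And>t x. t \<in> {0..1} \<Longrightarrow> x \<in> F \<Longrightarrow> H (t, x) \<noteq> 0"
  shows "turning_class F (\<lambda>x. H (0, x)) = turning_class F (\<lambda>x. H (1::real, x))"
proof -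
  let ?L = "\<lambda>s x. Ln (H (s, x)) / (2 * of_real pi * \<i>)" and ?W = "\<lambda>x. winding_number (\<lambda>t. H (t, x)) 0"
  have v: "nonvanishing_on F (\<lambda>x. H (s, x))" if "s \<in> {0..1}" for s
    using that nz by (auto simp: nonvanishing_on_def intro!: continuous_on_compose2[OF H] continuous_intros)
  show ?thesis
    unfolding turning_class_def One_nat_def
  proof (rule cohomology_class1_eqI_complex)
    fix \<sigma> assume \<sigma>: "singular_simplex (Suc 0) (top_of_set F) \<sigma>"
    note p = path_singular_simplex[OF \<sigma>]
    have \<sigma>F: "\<sigma> (edge_point t) \<in> F" if "t \<in> {0..1}" for t
      using p(2) that by (auto simp: path_image_def)
    have "continuous_on ({0..1} \<times> {0..1}) (\<lambda>z. (\<sigma> \<circ> edge_point) (snd z))"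
      by (rule continuous_on_compose2[OF p(1)[unfolded path_def]]) (auto intro: continuous_intros)
    then have "continuous_on ({0..1} \<times> {0..1}) (\<lambda>z. H (fst z, (\<sigma> \<circ> edge_point) (snd z)))"
      by (intro continuous_on_compose2[OF H] continuous_intros) (use \<sigma>F in auto)
    from winding_number_square[OF this] nz \<sigma>F
    have "winding_number (\<lambda>t. H (0, \<sigma> (edge_point t))) 0 + ?W (\<sigma> (edge_point 1)) =
       ?W (\<sigma> (edge_point 0)) + winding_number (\<lambda>t. H (1, \<sigma> (edge_point t))) 0"
      by auto
    then show "complex_of_int (turning_cochain F (\<lambda>x. H (0, x)) (frag_of \<sigma>)) =
       of_int (turning_cochain F (\<lambda>x. H (1, x)) (frag_of \<sigma>)) +
       ((?L 1 (\<sigma> (edge_point 1)) - ?L 0 (\<sigma> (edge_point 1)) - ?W (\<sigma> (edge_point 1))) -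
        (?L 1 (\<sigma> (edge_point 0)) - ?L 0 (\<sigma> (edge_point 0)) - ?W (\<sigma> (edge_point 0))))"
      by (simp add: turning_cochain_simplex[OF v \<sigma>] diff_divide_distrib o_def algebra_simps)
  qed (rule turning_cochain_cocycle, rule v, simp)+
qed

lemma nonvanishing_on_compose:
  assumes "nonvanishing_on F' \<phi>" "continuous_on F T" "T ` F \<subseteq> F'"
  shows "nonvanishing_on F (\<phi> \<circ> T)"
  using assms by (auto simp: nonvanishing_on_def o_def intro: continuous_on_compose2)

lemma turning_class_induced:
  assumes T: "continuous_on F T" "T ` F \<subseteq> F'" and \<phi>: "nonvanishing_on F' \<phi>"
  shows "cohomology_induced 1 (top_of_set F) T (turning_class F' \<phi>) = turning_class F (\<phi> \<circ> T)"
proof -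
  have cT: "continuous_map (top_of_set F) (top_of_set F') T"
    using T by (auto simp: image_subset_iff_funcset)
  have "pullback_cochain 1 (top_of_set F) T (turning_cochain F' \<phi>) = turning_cochain F (\<phi> \<circ> T)"
    unfolding pullback_cochain_def turning_cochain_def[of F] cochain_of_def
  proof (rule restrict_ext)
    fix c assume c: "c \<in> singular_chain_set 1 (top_of_set F)"
    note D = cochain_group_carrierD[OF cochain_of_in_carrier[of 1 "top_of_set F'" "turning \<phi>"], folded turning_cochain_def]
    show "turning_cochain F' \<phi> (chain_map 1 T c) = frag_eval (turning (\<phi> \<circ> T)) c"
    proof (rule cochain_eq_on_simplices[of 1 "top_of_set F" c])
      fix \<sigma> assume \<sigma>: "singular_simplex 1 (top_of_set F) \<sigma>"
      have e: "simplex_map (Suc 0) T \<sigma> (edge_point u) = T (\<sigma> (edge_point u))" if "u \<in> {0..1}" for u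
        using that by (simp add: simplex_map_def)
      have "winding_number (\<phi> \<circ> simplex_map (Suc 0) T \<sigma> \<circ> edge_point) 0 = winding_number (\<phi> \<circ> T \<circ> \<sigma> \<circ> edge_point) 0"
        by (rule winding_number_cong) (simp add: e)
      then have "turning \<phi> (simplex_map (Suc 0) T \<sigma>) = turning (\<phi> \<circ> T) \<sigma>"
        by (simp add: turning_def e)
      then show "turning_cochain F' \<phi> (chain_map 1 T (frag_of \<sigma>)) = frag_eval (turning (\<phi> \<circ> T)) (frag_of \<sigma>)"
        using singular_simplex_simplex_map[OF \<sigma> cT] by (simp add: turning_cochain_def)
    qed (use c D singular_chain_chain_map[OF _ cT] in \<open>auto simp: chain_map_diff\<close>)
  qed
  then show ?thesis
    using cohomology_induced_class[OF cT, of "turning_cochain F' \<phi>" 1] turning_cochain_cocycle[OF \<phi>]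
    by (simp add: turning_class_def)
qed

text \<open>The straight-line contraction to 0 makes the cycle homologous to its image in a
  one-point space, where cycles of positive degree bound.\<close>

lemma cycle_in_normed_space_is_boundary:
  fixes c :: "'v::real_normed_vector chain"
  assumes c: "singular_relcycle p euclidean {} c" and p: "1 \<le> p"
  shows "singular_relboundary p euclidean {} c"
proof -
  let ?X = "euclidean :: 'v topology" and ?z = "\<lambda>_::'v. 0::'v"
  have "homotopic_with (\<lambda>h. h \<in> {} \<rightarrow> {}) ?X ?X id ?z"
    unfolding homotopic_with_def
    by (rule exI[where x = "\<lambda>(t, x). (1 - t) *\<^sub>R x"])
       (auto simp: prod_topology_subtopology continuous_map_iff_continuous2 case_prod_unfold
          intro!: continuous_intros)
  from homotopic_imp_homologous_rel_chain_maps[OF this c]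
  have "singular_relboundary p ?X {} (c - chain_map p ?z c)"
    using c chain_map_ident[of p ?X c] by (simp add: homologous_rel_def singular_cycle)
  moreover have "singular_relboundary p ?X {} (chain_map p ?z c)"
  proof -
    have "continuous_map ?X (subtopology ?X {0}) ?z"
      by (simp add: continuous_map_in_subtopology)
    then have "singular_relcycle p (subtopology ?X {0}) {} (chain_map p ?z c)"
      using singular_relcycle_chain_map[OF c, of "subtopology ?X {0}" ?z "{}"] by simp
    then have "singular_relboundary p (subtopology ?X {0}) {} (chain_map p ?z c)"
      using singular_boundary_eq_cycle_singleton[of "subtopology ?X {0}" "0" p] p by simp
    then show ?thesis
      using singular_boundary_mono[where X = ?X and S = UNIV] by fastforce
  qed
  ultimately show ?thesis
    using singular_relboundary_add by fastforce
qed

text \<open>The segment from 0 to \<open>g 0\<close>, plus the path, minus the segment from 0 to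
  \<open>g 1\<close> is a cycle and hence a boundary. So the values on segments from 0 form a
  potential.\<close>

lemma cocycle_potential:
  fixes f :: "'v::real_normed_vector chain \<Rightarrow> int"
  assumes f: "f \<in> cocycles (Suc 0) euclidean" and g: "path g"
  shows "f (frag_of (path_simplex g)) =
     f (frag_of (path_simplex (linepath 0 (g 1)))) - f (frag_of (path_simplex (linepath 0 (g 0))))"
proof -
  let ?l = "\<lambda>v. frag_of (path_simplex (linepath (0::'v) v))" and ?g = "frag_of (path_simplex g)"
  have fc: "f \<in> carrier (cochain_group (Suc 0) euclidean)"
    using f by (simp add: cocycles_def)
  have ch: "singular_chain (Suc 0) euclidean (frag_of (path_simplex h))" if "path h" for h :: "real \<Rightarrow> 'v"
    using singular_simplex_path_simplex[OF that, of UNIV] by (simp add: singular_chain_of)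
  note chs = ch[OF path_linepath, of 0] ch[OF g]
  let ?c = "?l (g 0) + ?g - ?l (g 1)"
  have "chain_boundary (Suc 0) ?c = 0"
    by (simp add: chain_boundary_add chain_boundary_diff chain_boundary_edge linepath_def)
  then have "singular_relboundary (Suc 0) euclidean {} ?c"
    by (intro cycle_in_normed_space_is_boundary)
       (auto simp: singular_cycle intro!: singular_chain_add singular_chain_diff chs)
  then obtain d where d: "singular_chain 2 euclidean d" "chain_boundary 2 d = ?c"
    by (auto simp: singular_boundary numeral_2_eq_2)
  then have "f ?c = 0"
    using f by (auto simp: cocycles_def numeral_2_eq_2)
  then show ?thesis
    using cochain_group_carrierD(1)[OF fc chs] cochain_group_carrierD(4)[OF fc singular_chain_add[OF chs] chs(1)]
    by simp
qed

lemma additive_int_vec: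
  fixes h :: "int ^ 'n \<Rightarrow> int"
  assumes add: "\<And>m m'. h (m + m') = h m + h m'"
  shows "h m = (\<Sum>i\<in>UNIV. m $ i * h (axis i 1))"
proof -
  have h0: "h 0 = 0" using add[of 0 0] by simp
  have ax: "h (axis i k) = k * h (axis i 1)" for i k
  proof (induction k rule: int_induct[where k = 0])
    case base
    then show ?case by (simp add: h0 axis_eq_0_iff[THEN iffD2])
  next
    case (step1 k)
    have "axis i (k + 1) = axis i k + axis i 1" by (simp add: axis_def vec_eq_iff)
    then show ?case using step1 by (simp add: add algebra_simps)
  next
    case (step2 k)
    have "axis i k = axis i (k - 1) + axis i 1" by (simp add: axis_def vec_eq_iff)
    then have "h (axis i k) = h (axis i (k - 1)) + h (axis i 1)" by (simp only: add)
    then show ?case using step2 by (simp add: algebra_simps)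
  qed
  have "h (\<Sum>i\<in>I. axis i (m $ i)) = (\<Sum>i\<in>I. m $ i * h (axis i 1))" if "finite I" for I
    using that by (induction I) (simp_all add: h0 add ax[of _ "m $ _"])
  moreover have "(\<Sum>i\<in>UNIV. axis i (m $ i)) = m"
    by (simp add: vec_eq_iff axis_def if_distrib cong: if_cong)
  ultimately show ?thesis
    by (metis finite_class.finite_UNIV)
qed

section \<open>The first cohomology of a torus\<close>

lemma finprod_turning_class:
  assumes "\<And>i. nonvanishing_on F (\<phi> i)" "finite I"
  shows "(\<Otimes>\<^bsub>cohomology_group 1 (top_of_set F)\<^esub>i\<in>I. turning_class F (\<phi> i) [^]\<^bsub>cohomology_group 1 (top_of_set F)\<^esub> (k i :: int))
       = turning_class F (\<lambda>x. \<Prod>i\<in>I. \<phi> i x powi k i)"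
    and "nonvanishing_on F (\<lambda>x. \<Prod>i\<in>I. \<phi> i x powi k i)"
proof -
  interpret comm_group "cohomology_group 1 (top_of_set F)" by (rule comm_group_cohomology_group)
  have cl: "turning_class F (\<phi> i) [^]\<^bsub>cohomology_group 1 (top_of_set F)\<^esub> k i \<in> carrier (cohomology_group 1 (top_of_set F))" for i
    by (rule int_pow_closed[OF turning_class_closed[OF assms(1)]])
  have "(\<Otimes>\<^bsub>cohomology_group 1 (top_of_set F)\<^esub>i\<in>I. turning_class F (\<phi> i) [^]\<^bsub>cohomology_group 1 (top_of_set F)\<^esub> k i)
       = turning_class F (\<lambda>x. \<Prod>i\<in>I. \<phi> i x powi k i) \<and> nonvanishing_on F (\<lambda>x. \<Prod>i\<in>I. \<phi> i x powi k i)"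
    using assms(2)
  proof induction
    case empty
    then show ?case using turning_class_one[of F] finprod_empty by (simp add: nonvanishing_on_def del: One_nat_def)
  next
    case (insert j I)
    have v: "nonvanishing_on F (\<lambda>x. \<phi> j x powi k j)" by (rule nonvanishing_on_powi[OF assms(1)])
    have "(\<Otimes>\<^bsub>cohomology_group 1 (top_of_set F)\<^esub>i\<in>insert j I. turning_class F (\<phi> i) [^]\<^bsub>cohomology_group 1 (top_of_set F)\<^esub> k i) =
      turning_class F (\<phi> j) [^]\<^bsub>cohomology_group 1 (top_of_set F)\<^esub> k j \<otimes>\<^bsub>cohomology_group 1 (top_of_set F)\<^esub>
       (\<Otimes>\<^bsub>cohomology_group 1 (top_of_set F)\<^esub>i\<in>I. turning_class F (\<phi> i) [^]\<^bsub>cohomology_group 1 (top_of_set F)\<^esub> k i)"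
      by (rule finprod_insert[OF insert.hyps]) (use cl in auto)
    also have "\<dots> = turning_class F (\<lambda>x. \<phi> j x powi k j) \<otimes>\<^bsub>cohomology_group 1 (top_of_set F)\<^esub>
      turning_class F (\<lambda>x. \<Prod>i\<in>I. \<phi> i x powi k i)"
      using insert.IH by (simp only: turning_class_powi[OF assms(1)])
    also have "\<dots> = turning_class F (\<lambda>x. \<phi> j x powi k j * (\<Prod>i\<in>I. \<phi> i x powi k i))"
      using turning_class_mult[OF v] insert.IH by simp
    finally show ?case
      using insert.hyps nonvanishing_on_mult[OF v] insert.IH by simp
  qed
  then show "(\<Otimes>\<^bsub>cohomology_group 1 (top_of_set F)\<^esub>i\<in>I. turning_class F (\<phi> i) [^]\<^bsub>cohomology_group 1 (top_of_set F)\<^esub> k i)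
       = turning_class F (\<lambda>x. \<Prod>i\<in>I. \<phi> i x powi k i)"
    "nonvanishing_on F (\<lambda>x. \<Prod>i\<in>I. \<phi> i x powi k i)"
    by auto
qed

text \<open>A cocycle on a torus pulls back to a coboundary on the universal cover.  Its potential is
  additive under integral translations, and the resulting periods are the coordinates of the class.\<close>

theorem integral_basis_turning_class:
  fixes \<phi> :: "'n::finite \<Rightarrow> 'a::topological_space \<Rightarrow> complex" and P :: "real ^ 'n \<Rightarrow> 'a"
  assumes \<phi>: "\<And>i. continuous_on F (\<phi> i)" "\<And>i x. x \<in> F \<Longrightarrow> cmod (\<phi> i x) = 1"
    and P: "continuous_on UNIV P" "\<And>v. P v \<in> F"
    and \<phi>P: "\<And>i v. \<phi> i (P v) = exp (2 * of_real pi * \<i> * of_real (v $ i))"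
    and inj: "\<And>x v. x \<in> F \<Longrightarrow> (\<And>i. \<phi> i x = exp (2 * of_real pi * \<i> * of_real (v $ i))) \<Longrightarrow> P v = x"
  shows "integral_basis (cohomology_group 1 (top_of_set F)) (\<lambda>i. turning_class F (\<phi> i))"
proof -
  let ?X = "top_of_set F" and ?c = "2 * of_real pi * \<i> :: complex"
  define \<Phi> where "\<Phi> = (\<lambda>(k :: int^'n) x. \<Prod>i\<in>UNIV. \<phi> i x powi (k $ i))"
  have cP: "continuous_map euclidean ?X P"
    using P by (simp add: continuous_map_in_subtopology image_subset_iff)
  have nv: "nonvanishing_on F (\<phi> i)" for i
    using \<phi> unfolding nonvanishing_on_def by (metis norm_zero zero_neq_one)
  have nv\<Phi>: "nonvanishing_on F (\<Phi> k)" for k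
    unfolding \<Phi>_def by (rule finprod_turning_class(2)[OF nv]) simp
  have W: "winding_number (\<lambda>t. \<Phi> k (P (v t))) 0 = (\<Sum>i\<in>UNIV. of_int (k $ i) * of_real (v 1 $ i - v 0 $ i))"
    if v: "path v" for k v
  proof -
    have "path (\<lambda>t. ?c * (\<Sum>i\<in>UNIV. of_int (k $ i) * of_real (v t $ i)))"
      using v by (auto simp: path_def intro!: continuous_intros)
    moreover have "\<Phi> k (P (v t)) = exp (?c * (\<Sum>i\<in>UNIV. of_int (k $ i) * of_real (v t $ i)))" for t
      unfolding \<Phi>_def \<phi>P by (simp add: sum_distrib_left exp_sum exp_power_int mult_ac)
    ultimately have "winding_number (\<lambda>t. \<Phi> k (P (v t))) 0 = (?c * (\<Sum>i\<in>UNIV. of_int (k $ i) * of_real (v 1 $ i)) -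
         ?c * (\<Sum>i\<in>UNIV. of_int (k $ i) * of_real (v 0 $ i))) / ?c"
      by (rule winding_number_exp_log)
    then show ?thesis
      by (simp add: diff_divide_distrib sum_subtractf right_diff_distrib)
  qed
  \<comment> \<open>Continuous logarithms of the coordinates along the path are purely imaginary,
    because the coordinates have modulus 1. Divided by 2 pi, their imaginary parts lift the path
    through \<open>P\<close>.\<close>
  have lift: "\<exists>v. path v \<and> (\<forall>t\<in>{0..1}. g t = P (v t))" if g: "path g" "path_image g \<subseteq> F" for g
  proof -
    have "\<exists>q. path q \<and> (\<forall>t\<in>{0..1}. \<phi> i (g t) = exp (q t))" for i
    proof -
      obtain q where "path q" "\<And>t. t \<in> {0..1} \<Longrightarrow> (\<phi> i \<circ> g) t = 0 + exp (q t)"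
        using winding_number_as_continuous_log[OF nonvanishing_path[OF nv[of i] g]] by blast
      then show ?thesis by (intro exI[of _ q]) auto
    qed
    then have "\<exists>q. \<forall>i. path (q i) \<and> (\<forall>t\<in>{0..1}. \<phi> i (g t) = exp (q i t))"
      by (intro choice) blast
    then obtain q where q: "\<And>i. path (q i)" "\<And>i t. t \<in> {0..1} \<Longrightarrow> \<phi> i (g t) = exp (q i t)"
      by blast
    define v where "v t = (\<chi> i. Im (q i t) / (2 * pi))" for t
    have "path v"
      using q(1) unfolding path_def v_def by (intro continuous_intros) auto
    moreover have "P (v t) = g t" if t: "t \<in> {0..1}" for t
    proof (rule inj)
      show gF: "g t \<in> F" using g(2) t by (auto simp: path_image_def)
      fix i
      have "Re (q i t) = 0"
        using \<phi>(2)[OF gF, of i] q(2)[OF t, of i] by simp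
      then have "q i t = ?c * of_real (v t $ i)"
        by (simp add: v_def complex_eq_iff)
      then show "\<phi> i (g t) = exp (?c * of_real (v t $ i))"
        using q(2)[OF t] by simp
    qed
    ultimately show ?thesis by metis
  qed
  have simp_lift: "\<exists>v. path v \<and> \<sigma> = simplex_map (Suc 0) P (path_simplex v)"
    if \<sigma>: "singular_simplex (Suc 0) ?X \<sigma>" for \<sigma>
  proof -
    obtain v where v: "path v" "\<And>t. t \<in> {0..1} \<Longrightarrow> \<sigma> (edge_point t) = P (v t)"
      using lift[OF path_singular_simplex[OF \<sigma>]] by auto
    have "\<sigma> x = simplex_map (Suc 0) P (path_simplex v) x" for x
    proof (cases "x \<in> standard_simplex (Suc 0)")
      case True
      then show ?thesis
        using edge_point_eq[OF True] v(2)[of "x (Suc 0)"] by (simp add: simplex_map_def path_simplex_def)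
    next
      case False
      then show ?thesis
        using \<sigma> by (simp add: simplex_map_def singular_simplex_def extensional_def)
    qed
    then show ?thesis using v(1) by blast
  qed
  have turn: "of_int (turning_cochain F (\<Phi> k) (frag_of (simplex_map (Suc 0) P (path_simplex v)))) =
      (\<Sum>i\<in>UNIV. of_int (k $ i) * of_real (v 1 $ i - v 0 $ i)) - (Ln (\<Phi> k (P (v 1))) - Ln (\<Phi> k (P (v 0)))) / ?c"
    if v: "path v" for k v
  proof -
    have s: "singular_simplex (Suc 0) ?X (simplex_map (Suc 0) P (path_simplex v))"
      using singular_simplex_simplex_map[OF _ cP] singular_simplex_path_simplex[OF v, of UNIV] by simp
    have e: "simplex_map (Suc 0) P (path_simplex v) (edge_point u) = P (v u)" if "u \<in> {0..1}" for u
      using that by (simp add: simplex_map_def)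
    have "winding_number (\<Phi> k \<circ> simplex_map (Suc 0) P (path_simplex v) \<circ> edge_point) 0 = winding_number (\<lambda>t. \<Phi> k (P (v t))) 0"
      by (rule winding_number_cong) (simp add: e)
    then show ?thesis
      by (simp add: turning_cochain_simplex[OF nv\<Phi> s] W[OF v] e)
  qed
  have prod: "(\<Otimes>\<^bsub>cohomology_group 1 ?X\<^esub>i\<in>UNIV. turning_class F (\<phi> i) [^]\<^bsub>cohomology_group 1 ?X\<^esub> (k $ i)) = turning_class F (\<Phi> k)" for k
    unfolding \<Phi>_def by (rule finprod_turning_class(1)[OF nv]) simp
  \<comment> \<open>The \<open>j\<close>-th exponent is read off on the image of the segment from 0
    to the \<open>j\<close>-th unit vector, which is a closed edge in \<open>F\<close>.\<close>
  have "inj (\<lambda>k. turning_class F (\<Phi> k))"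
  proof (rule injI)
    fix k k' assume eq: "turning_class F (\<Phi> k) = turning_class F (\<Phi> k')"
    have "k $ j = k' $ j" for j
    proof -
      define v where "v = (\<lambda>t::real. axis j t :: real^'n)"
      have v: "path v"
      proof -
        have "continuous_on {0..1} (\<lambda>t::real. if i = j then t else 0)" for i
          by (cases "i = j") auto
        then show ?thesis
          unfolding v_def path_def axis_def by (intro continuous_intros)
      qed
      have Pv: "P (v 0) = P (v 1)"
        by (rule inj) (use P \<phi>P in \<open>auto simp: v_def axis_def\<close>)
      have s: "singular_simplex (Suc 0) ?X (simplex_map (Suc 0) P (path_simplex v))"
        using singular_simplex_simplex_map[OF _ cP] singular_simplex_path_simplex[OF v, of UNIV] by simp
      have "turning_cochain F (\<Phi> k) (frag_of (simplex_map (Suc 0) P (path_simplex v))) =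
        turning_cochain F (\<Phi> k') (frag_of (simplex_map (Suc 0) P (path_simplex v)))"
        by (rule coboundary1_loop[OF _ _ _ s])
           (use turning_cochain_cocycle nv\<Phi> eq Pv in \<open>auto simp: turning_class_def simplex_map_def\<close>)
      then have "(\<Sum>i\<in>UNIV. complex_of_int (k $ i) * of_real (v 1 $ i - v 0 $ i)) = (\<Sum>i\<in>UNIV. of_int (k' $ i) * of_real (v 1 $ i - v 0 $ i))"
        using turn[OF v, of k] turn[OF v, of k'] Pv by simp
      moreover have "(\<Sum>i\<in>UNIV. complex_of_int (k $ i) * of_real (v 1 $ i - v 0 $ i)) = of_int (k $ j)" for k :: "int ^ 'n"
      proof -
        have "complex_of_int (k $ i) * of_real (v 1 $ i - v 0 $ i) = (if i = j then of_int (k $ j) else 0)" for i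
          by (simp add: v_def axis_def)
        then show ?thesis by simp
      qed
      ultimately show ?thesis by simp
    qed
    then show "k = k'" by (simp add: vec_eq_iff)
  qed
  moreover have "\<exists>k. c = turning_class F (\<Phi> k)" if c: "c \<in> carrier (cohomology_group 1 ?X)" for c
  proof -
    obtain f where f: "f \<in> cocycles (Suc 0) ?X" and cf: "c = cohomology_class (Suc 0) ?X f"
      using c by (auto simp: carrier_cohomology_group)
    define f' where "f' = pullback_cochain (Suc 0) euclidean P f"
    have f': "f' \<in> cocycles (Suc 0) euclidean"
      unfolding f'_def by (rule pullback_cocycle[OF cP f])
    define pot where "pot v = f' (frag_of (path_simplex (linepath 0 v)))" for v :: "real^'n"
    have pot: "f (frag_of (simplex_map (Suc 0) P (path_simplex v))) = pot (v 1) - pot (v 0)" if "path v" for v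
    proof -
      have "f' (frag_of (path_simplex v)) = f (frag_of (simplex_map (Suc 0) P (path_simplex v)))"
        using singular_simplex_path_simplex[OF that, of UNIV]
        by (simp add: f'_def pullback_cochain_def singular_chain_of)
      then show ?thesis
        using cocycle_potential[OF f' that] by (simp add: pot_def)
    qed
    define emb where "emb m = ((\<chi> i. of_int (m $ i)) :: real ^ 'n)" for m :: "int ^ 'n"
    have per: "P (emb m + v) = P v" for m v
    proof (rule inj)
      show "\<phi> i (P v) = exp (?c * complex_of_real ((emb m + v) $ i))" for i
      proof -
        have "exp (?c * of_int (m $ i)) = 1"
          by (auto simp: exp_eq_1)
        then show ?thesis
          by (simp add: \<phi>P emb_def ring_distribs exp_add)
      qed
    qed (rule P)
    have pot0: "pot 0 = 0"
      using cocycle_potential[OF f' path_linepath[of 0 0]] by (simp add: pot_def linepath_refl)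
    have shift: "pot (emb m + v) = pot (emb m) + pot v" for m v
    proof -
      have "simplex_map (Suc 0) P (path_simplex (\<lambda>t. emb m + linepath 0 v t)) = simplex_map (Suc 0) P (path_simplex (linepath 0 v))"
        by (auto simp: simplex_map_def path_simplex_def per)
      moreover have "path (\<lambda>t. emb m + linepath 0 v t)"
        using path_linepath[of 0 v] unfolding path_def by (intro continuous_intros)
      ultimately show ?thesis
        using pot[of "\<lambda>t. emb m + linepath 0 v t"] pot[OF path_linepath[of 0 v]] by (simp add: linepath_def pot0)
    qed
    \<comment> \<open>The periods of the cocycle: the values of its potential at the unit lattice
      vectors.\<close>
    define k :: "int ^ 'n" where "k = (\<chi> i. pot (emb (axis i 1)))"
    have "pot (emb (m + m')) = pot (emb m) + pot (emb m')" for m m'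
    proof -
      have "emb (m + m') = emb m + emb m'" by (simp add: emb_def vec_eq_iff)
      then show ?thesis by (simp add: shift)
    qed
    then have potk: "pot (emb m) = (\<Sum>i\<in>UNIV. m $ i * k $ i)" for m
      unfolding k_def vec_lambda_beta by (rule additive_int_vec)
    \<comment> \<open>Subtracting the linear form with the same periods leaves a function invariant
      under lattice translations, that is, a function on \<open>F\<close>.\<close>
    define red where "red v = complex_of_int (pot v) - (\<Sum>i\<in>UNIV. of_int (k $ i) * of_real (v $ i))" for v
    have red: "red v = red v'" if "P v = P v'" for v v'
    proof -
      have "\<exists>m::int. v $ i = m + v' $ i" for i
      proof -
        have "exp (?c * of_real (v $ i - v' $ i)) = 1"
          using \<phi>P[of i v] \<phi>P[of i v'] that by (simp add: right_diff_distrib exp_diff)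
        from exp_2pi_eq_1_imp_int[OF this] obtain m where "complex_of_real (v $ i - v' $ i) = of_int m"
          by (auto elim!: Ints_cases)
        then have "v $ i - v' $ i = of_int m"
          by (metis of_real_eq_iff of_real_of_int_eq)
        then show ?thesis by (intro exI[of _ m]) simp
      qed
      then obtain m where m: "\<And>i. v $ i = of_int (m i) + v' $ i" by metis
      then have "v = emb (\<chi> i. m i) + v'" by (simp add: vec_eq_iff emb_def)
      then have "pot v = (\<Sum>i\<in>UNIV. m i * k $ i) + pot v'" by (simp add: shift potk)
      then show ?thesis
        by (simp add: red_def m ring_distribs sum.distrib mult.commute)
    qed
    \<comment> \<open>A set-theoretic section of \<open>P\<close> is enough, because 0-cochains need
      not be continuous.\<close>
    define s where "s x = (SOME v. P v = x)" for x
    have s: "P (s x) = x" if "x = P v" for x v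
      unfolding s_def using that by (metis (mono_tags) someI_ex)
    have "cohomology_class (Suc 0) ?X f = cohomology_class (Suc 0) ?X (turning_cochain F (\<Phi> k))"
    proof (rule cohomology_class1_eqI_complex[OF f])
      show "turning_cochain F (\<Phi> k) \<in> cocycles (Suc 0) ?X"
        using turning_cochain_cocycle[OF nv\<Phi>] .
      fix \<sigma> assume "singular_simplex (Suc 0) ?X \<sigma>"
      then obtain v where v: "path v" and \<sigma>: "\<sigma> = simplex_map (Suc 0) P (path_simplex v)"
        using simp_lift by blast
      have e: "\<sigma> (edge_point u) = P (v u)" if "u \<in> {0..1}" for u
        using that by (simp add: \<sigma> simplex_map_def)
      have "red (s (P (v u))) = red (v u)" for u
        using s red by metis
      moreover have "of_int (f (frag_of \<sigma>)) = red (v 1) - red (v 0) + (\<Sum>i\<in>UNIV. of_int (k $ i) * of_real (v 1 $ i - v 0 $ i))"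
        unfolding \<sigma> pot[OF v] by (simp add: red_def sum_subtractf right_diff_distrib)
      ultimately show "of_int (f (frag_of \<sigma>)) = of_int (turning_cochain F (\<Phi> k) (frag_of \<sigma>)) +
        ((red (s (\<sigma> (edge_point 1))) + Ln (\<Phi> k (\<sigma> (edge_point 1))) / ?c) -
         (red (s (\<sigma> (edge_point 0))) + Ln (\<Phi> k (\<sigma> (edge_point 0))) / ?c))"
        using turn[OF v, of k] e[of 0] e[of 1] unfolding \<sigma> by (simp add: diff_divide_distrib)
    qed
    then show ?thesis
      unfolding cf turning_class_def by auto
  qed
  ultimately have "bij_betw (\<lambda>k. turning_class F (\<Phi> k)) UNIV (carrier (cohomology_group 1 ?X))"
    unfolding bij_betw_def using turning_class_closed[OF nv\<Phi>] by blast
  then show ?thesis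
    unfolding integral_basis_def prod
    using comm_group_cohomology_group turning_class_closed[OF nv] by blast
qed

section \<open>Loop classes and free bases\<close>

lemma loops_atD:
  assumes "\<gamma> \<in> loops_at S p"
  shows "path \<gamma>" "path_image \<gamma> \<subseteq> S" "pathstart \<gamma> = p" "pathfinish \<gamma> = p"
  using assms by (auto simp: loops_at_def)

lemma loop_class_eq_iff:
  assumes "\<gamma> \<in> loops_at S p"
  shows "loop_class S \<gamma> = loop_class S \<delta> \<longleftrightarrow> homotopic_paths S \<gamma> \<delta>"
proof
  assume "loop_class S \<gamma> = loop_class S \<delta>"
  moreover have "\<gamma> \<in> loop_class S \<gamma>"
    using loops_atD[OF assms] by (simp add: loop_class_def)
  ultimately show "homotopic_paths S \<gamma> \<delta>"
    by (auto simp: loop_class_def intro: homotopic_paths_sym)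
next
  assume "homotopic_paths S \<gamma> \<delta>"
  then show "loop_class S \<gamma> = loop_class S \<delta>"
    unfolding loop_class_def by (metis (no_types, lifting) Collect_cong homotopic_paths_sym homotopic_paths_trans)
qed

lemma loops_at_join:
  "\<gamma> \<in> loops_at S p \<Longrightarrow> \<delta> \<in> loops_at S p \<Longrightarrow> \<gamma> +++ \<delta> \<in> loops_at S p"
  by (simp add: loops_at_def path_image_join)

lemma loops_at_reversepath: "\<gamma> \<in> loops_at S p \<Longrightarrow> reversepath \<gamma> \<in> loops_at S p"
  by (simp add: loops_at_def)

lemma loops_at_const:
  fixes p :: "'a::real_normed_vector"
  shows "p \<in> S \<Longrightarrow> linepath p p \<in> loops_at S p"
  by (simp add: loops_at_def)

text \<open>The product of classes is defined as a union over all pairs of representatives; homotopy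
  invariance of concatenation makes its members equal.\<close>

lemma fundamental_group_mult:
  assumes \<gamma>: "\<gamma> \<in> loops_at S p" and \<delta>: "\<delta> \<in> loops_at S p"
  shows "loop_class S \<gamma> \<otimes>\<^bsub>fundamental_group S p\<^esub> loop_class S \<delta> = loop_class S (\<gamma> +++ \<delta>)"
proof -
  have "loop_class S (\<gamma>' +++ \<delta>') = loop_class S (\<gamma> +++ \<delta>)"
    if "\<gamma>' \<in> loop_class S \<gamma>" "\<delta>' \<in> loop_class S \<delta>" for \<gamma>' \<delta>'
  proof -
    have "homotopic_paths S (\<gamma> +++ \<delta>) (\<gamma>' +++ \<delta>')"
      using that loops_atD[OF \<gamma>] loops_atD[OF \<delta>]
      by (intro homotopic_paths_join) (auto simp: loop_class_def)
    then show ?thesis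
      using loop_class_eq_iff[OF loops_at_join[OF \<gamma> \<delta>]] by blast
  qed
  moreover have m: "\<gamma> \<in> loop_class S \<gamma>" "\<delta> \<in> loop_class S \<delta>"
    using loops_atD[OF \<gamma>] loops_atD[OF \<delta>] by (auto simp: loop_class_def)
  ultimately have "(\<Union>\<gamma>'\<in>loop_class S \<gamma>. \<Union>\<delta>'\<in>loop_class S \<delta>. loop_class S (\<gamma>' +++ \<delta>')) = loop_class S (\<gamma> +++ \<delta>)"
    by (intro UN_constant_eq[OF m(1)] ballI UN_constant_eq[OF m(2)]) blast
  then show ?thesis
    unfolding fundamental_group_def by simp
qed

lemma fundamental_group_one:
  fixes p :: "'a::real_normed_vector"
  shows "\<one>\<^bsub>fundamental_group S p\<^esub> = loop_class S (linepath p p)"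
  by (simp add: fundamental_group_def linepath_refl)

lemma carrier_fundamental_group: "carrier (fundamental_group S p) = loop_class S ` loops_at S p"
  by (simp add: fundamental_group_def)

lemma loop_class_eqI:
  "\<gamma> \<in> loops_at S p \<Longrightarrow> homotopic_paths S \<gamma> \<delta> \<Longrightarrow> loop_class S \<gamma> = loop_class S \<delta>"
  by (simp add: loop_class_eq_iff)

lemma group_fundamental_group:
  fixes p :: "'a::real_normed_vector"
  assumes p: "p \<in> S"
  shows "Group.group (fundamental_group S p)"
proof (rule groupI)
  fix x assume "x \<in> carrier (fundamental_group S p)"
  then obtain \<gamma> where \<gamma>: "\<gamma> \<in> loops_at S p" "x = loop_class S \<gamma>"
    by (auto simp: carrier_fundamental_group)
  note D = loops_atD[OF \<gamma>(1)]
  show "\<one>\<^bsub>fundamental_group S p\<^esub> \<otimes>\<^bsub>fundamental_group S p\<^esub> x = x"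
    unfolding fundamental_group_one \<gamma>(2) fundamental_group_mult[OF loops_at_const[OF p] \<gamma>(1)]
    using homotopic_paths_lid[of \<gamma> S] D
    by (intro loop_class_eqI[OF loops_at_join[OF loops_at_const[OF p] \<gamma>(1)]]) simp
  have "loop_class S (reversepath \<gamma>) \<otimes>\<^bsub>fundamental_group S p\<^esub> x = \<one>\<^bsub>fundamental_group S p\<^esub>"
    unfolding fundamental_group_one \<gamma>(2) fundamental_group_mult[OF loops_at_reversepath[OF \<gamma>(1)] \<gamma>(1)]
    using homotopic_paths_linv[of \<gamma> S] D
    by (intro loop_class_eqI[OF loops_at_join[OF loops_at_reversepath[OF \<gamma>(1)] \<gamma>(1)]]) simp
  then show "\<exists>y\<in>carrier (fundamental_group S p). y \<otimes>\<^bsub>fundamental_group S p\<^esub> x = \<one>\<^bsub>fundamental_group S p\<^esub>"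
    using loops_at_reversepath[OF \<gamma>(1)] by (auto simp: carrier_fundamental_group)
next
  fix x y assume "x \<in> carrier (fundamental_group S p)" "y \<in> carrier (fundamental_group S p)"
  then obtain \<gamma> \<delta> where \<gamma>: "\<gamma> \<in> loops_at S p" "x = loop_class S \<gamma>" and \<delta>: "\<delta> \<in> loops_at S p" "y = loop_class S \<delta>"
    by (auto simp: carrier_fundamental_group)
  show "x \<otimes>\<^bsub>fundamental_group S p\<^esub> y \<in> carrier (fundamental_group S p)"
    using loops_at_join[OF \<gamma>(1) \<delta>(1)]
    by (simp add: \<gamma>(2) \<delta>(2) fundamental_group_mult[OF \<gamma>(1) \<delta>(1)] carrier_fundamental_group)
  fix z assume "z \<in> carrier (fundamental_group S p)"
  then obtain \<epsilon> where \<epsilon>: "\<epsilon> \<in> loops_at S p" "z = loop_class S \<epsilon>"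
    by (auto simp: carrier_fundamental_group)
  have "homotopic_paths S ((\<gamma> +++ \<delta>) +++ \<epsilon>) (\<gamma> +++ (\<delta> +++ \<epsilon>))"
    using loops_atD[OF \<gamma>(1)] loops_atD[OF \<delta>(1)] loops_atD[OF \<epsilon>(1)]
    by (intro homotopic_paths_sym[OF homotopic_paths_assoc]) auto
  then have "loop_class S ((\<gamma> +++ \<delta>) +++ \<epsilon>) = loop_class S (\<gamma> +++ (\<delta> +++ \<epsilon>))"
    by (rule loop_class_eqI[OF loops_at_join[OF loops_at_join[OF \<gamma>(1) \<delta>(1)] \<epsilon>(1)]])
  then show "x \<otimes>\<^bsub>fundamental_group S p\<^esub> y \<otimes>\<^bsub>fundamental_group S p\<^esub> z =
      x \<otimes>\<^bsub>fundamental_group S p\<^esub> (y \<otimes>\<^bsub>fundamental_group S p\<^esub> z)"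
    by (simp add: \<gamma>(2) \<delta>(2) \<epsilon>(2) fundamental_group_mult \<gamma>(1) \<delta>(1) \<epsilon>(1) loops_at_join)
qed (use loops_at_const[OF p] in \<open>auto simp: fundamental_group_one carrier_fundamental_group\<close>)

lemma fundamental_group_inv:
  fixes p :: "'a::real_normed_vector"
  assumes p: "p \<in> S" and \<gamma>: "\<gamma> \<in> loops_at S p"
  shows "inv\<^bsub>fundamental_group S p\<^esub> (loop_class S \<gamma>) = loop_class S (reversepath \<gamma>)"
proof (rule group.inv_equality[OF group_fundamental_group[OF p]])
  show "loop_class S (reversepath \<gamma>) \<otimes>\<^bsub>fundamental_group S p\<^esub> loop_class S \<gamma> = \<one>\<^bsub>fundamental_group S p\<^esub>"
    unfolding fundamental_group_one fundamental_group_mult[OF loops_at_reversepath[OF \<gamma>] \<gamma>]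
    using homotopic_paths_linv[of \<gamma> S] loops_atD[OF \<gamma>]
    by (intro loop_class_eqI[OF loops_at_join[OF loops_at_reversepath[OF \<gamma>] \<gamma>]]) simp
qed (use \<gamma> loops_at_reversepath[OF \<gamma>] in \<open>auto simp: carrier_fundamental_group\<close>)

text \<open>Left multiplication by a letter, acting on reduced words. Every letter acts as a
  permutation, which is why reduced words can label the sheets of a covering.\<close>

fun push_letter :: "'i \<times> bool \<Rightarrow> ('i \<times> bool) list \<Rightarrow> ('i \<times> bool) list" where
  "push_letter l [] = [l]"
| "push_letter l (m # r) = (if fst m = fst l \<and> snd m \<noteq> snd l then r else l # m # r)"

lemma reduced_word_Cons:
  "reduced_word (l # r) \<longleftrightarrow> reduced_word r \<and> (r = [] \<or> \<not> (fst (hd r) = fst l \<and> snd (hd r) \<noteq> snd l))"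
  by (cases r) (auto simp: reduced_word_def case_prod_unfold)

lemma reduced_word_Nil [simp]: "reduced_word []"
  by (simp add: reduced_word_def)

lemma push_letter_reduced: "reduced_word r \<Longrightarrow> reduced_word (push_letter l r)"
  by (cases r) (auto simp: reduced_word_Cons)

lemma push_letter_inverse:
  assumes "reduced_word r" "s \<noteq> t"
  shows "push_letter (i, s) (push_letter (i, t) r) = r"
  using assms by (cases r; cases "tl r") (auto simp: reduced_word_Cons)

lemma bij_betw_push_letter:
  "bij_betw (push_letter (i, s)) {r. reduced_word r} {r. reduced_word r}"
  by (rule bij_betw_byWitness[where f' = "push_letter (i, \<not> s)"])
     (auto simp: push_letter_inverse push_letter_reduced)

lemma reduced_word_append2: "reduced_word (v @ w) \<Longrightarrow> reduced_word w"
  by (simp add: reduced_word_def successively_append_iff)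

text \<open>Letters pushed from left to right pile up in reverse order, and none cancels while the
  pile is reduced.\<close>

lemma fold_push_letter:
  "reduced_word (rev w @ r) \<Longrightarrow> fold push_letter w r = rev w @ r"
proof (induction w arbitrary: r)
  case (Cons l w)
  then have "reduced_word (l # r)"
    using reduced_word_append2[of "rev w" "l # r"] by simp
  then have "push_letter l r = l # r"
    by (cases r) (auto simp: reduced_word_Cons)
  then show ?case
    using Cons by simp
qed simp

lemma reduced_word_rev: "reduced_word (rev w) \<longleftrightarrow> reduced_word w"
  unfolding reduced_word_def successively_rev
  by (rule successively_cong) (auto split: prod.splits)

section \<open>Values of words in a group\<close>

lemma word_value_Nil [simp]: "word_value G g [] = \<one>\<^bsub>G\<^esub>"
  by (simp add: word_value_def)

lemma word_value_Cons:
  "word_value G g ((i, s) # w) = (if s then g i else inv\<^bsub>G\<^esub> (g i)) \<otimes>\<^bsub>G\<^esub> word_value G g w"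
  by (simp add: word_value_def)

lemma (in Group.group) word_value_closed:
  "range g \<subseteq> carrier G \<Longrightarrow> word_value G g w \<in> carrier G"
  by (induction w) (auto simp: word_value_Cons image_subset_iff)

lemma (in Group.group) word_value_push_letter:
  assumes g: "range g \<subseteq> carrier G"
  shows "word_value G g (push_letter (i, s) r) = (if s then g i else inv\<^bsub>G\<^esub> (g i)) \<otimes>\<^bsub>G\<^esub> word_value G g r"
proof (cases r)
  case (Cons m r')
  obtain j t where m: "m = (j, t)" by (cases m)
  have "g j \<in> carrier G" "word_value G g r' \<in> carrier G"
    using g word_value_closed[OF g] by auto
  then show ?thesis
    by (auto simp: Cons m word_value_Cons m_assoc[symmetric])
qed (simp add: word_value_Cons)

text \<open>The values of reduced words form a subgroup, since pushing a letter multiplies by a generator.\<close>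

lemma (in Group.group) word_value_surj:
  assumes g: "range g \<subseteq> carrier G"
    and gen: "\<And>N. subgroup N G \<Longrightarrow> range g \<subseteq> N \<Longrightarrow> carrier G \<subseteq> N"
  shows "word_value G g ` {w. reduced_word w} = carrier G"
proof
  let ?N = "word_value G g ` {w. reduced_word w}"
  show sub: "?N \<subseteq> carrier G" using word_value_closed[OF g] by auto
  have mult: "word_value G g w \<otimes> x \<in> ?N" if "x \<in> ?N" for w x
  proof (induction w)
    case Nil
    then show ?case using that sub by auto
  next
    case (Cons l w)
    obtain i s where l: "l = (i, s)" by (cases l)
    from Cons obtain v where v: "word_value G g w \<otimes> x = word_value G g v" "reduced_word v" by auto
    have "x \<in> carrier G" "g i \<in> carrier G" "word_value G g w \<in> carrier G"
      using that sub g word_value_closed[OF g] by auto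
    then have "word_value G g (l # w) \<otimes> x = word_value G g (push_letter (i, s) v)"
      by (auto simp: l word_value_Cons word_value_push_letter[OF g] m_assoc v(1)[symmetric])
    then show ?case using push_letter_reduced[OF v(2)] by auto
  qed
  have one: "\<one> \<in> ?N" by (rule image_eqI[where x = "[]"]) auto
  have all: "word_value G g w \<in> ?N" for w
    using mult[OF one, of w] word_value_closed[OF g, of w] by simp
  \<comment> \<open>A left inverse is sought among all words, reduced or not, since
    \<open>all\<close> shows that any value is also the value of a reduced word.\<close>
  have invw: "\<exists>v. word_value G g v \<otimes> word_value G g w = \<one>" for w
  proof (induction w)
    case Nil
    show ?case by (rule exI[of _ "[]"]) simp
  next
    case (Cons l w)
    obtain i s where l: "l = (i, s)" by (cases l)
    from Cons obtain v where v: "word_value G g v \<otimes> word_value G g w = \<one>" by auto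
    have app: "word_value G g (v @ [(i, \<not> s)]) = word_value G g v \<otimes> word_value G g [(i, \<not> s)]"
    proof (induction v)
      case (Cons m v)
      then show ?case
        using g word_value_closed[OF g] by (cases m) (auto simp: word_value_Cons m_assoc image_subset_iff)
    qed (use word_value_closed[OF g] in auto)
    have c: "g i \<in> carrier G" "word_value G g w \<in> carrier G" "word_value G g v \<in> carrier G"
      using g word_value_closed[OF g] by auto
    have "word_value G g [(i, \<not> s)] \<otimes> word_value G g (l # w) = word_value G g w"
      using c by (auto simp: l word_value_Cons m_assoc[symmetric])
    then have "word_value G g (v @ [(i, \<not> s)]) \<otimes> word_value G g (l # w) = \<one>"
      using v c word_value_closed[OF g] unfolding app by (simp add: m_assoc)
    then show ?case by blast
  qed
  have "subgroup ?N G"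
  proof (rule subgroupI[OF sub])
    show "?N \<noteq> {}" using one by auto
    fix x assume "x \<in> ?N"
    then obtain w where w: "x = word_value G g w" by auto
    obtain v where "word_value G g v \<otimes> x = \<one>" using invw w by auto
    then have "inv x = word_value G g v"
      using word_value_closed[OF g] w by (intro inv_equality) auto
    then show "inv x \<in> ?N" using all by simp
    fix y assume "y \<in> ?N"
    then show "x \<otimes> y \<in> ?N" using mult w by blast
  qed
  moreover have "range g \<subseteq> ?N"
  proof
    fix x assume "x \<in> range g"
    then obtain i where "x = word_value G g [(i, True)]"
      using g by (auto simp: word_value_Cons image_subset_iff)
    then show "x \<in> ?N" using all by simp
  qed
  ultimately show "carrier G \<subseteq> ?N" by (rule gen)
qed

section \<open>Paths between arbitrary points and their classes at the base point\<close>

definition path_in :: "'a::topological_space set \<Rightarrow> (real \<Rightarrow> 'a) \<Rightarrow> 'a \<Rightarrow> 'a \<Rightarrow> bool" where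
  "path_in S g x y \<longleftrightarrow> path g \<and> path_image g \<subseteq> S \<and> pathstart g = x \<and> pathfinish g = y"

lemma path_in_join: "path_in S g x y \<Longrightarrow> path_in S h y z \<Longrightarrow> path_in S (g +++ h) x z"
  by (simp add: path_in_def path_image_join)

lemma path_in_reversepath: "path_in S g x y \<Longrightarrow> path_in S (reversepath g) y x"
  by (auto simp: path_in_def)

lemma path_in_mono: "path_in S g x y \<Longrightarrow> S \<subseteq> T \<Longrightarrow> path_in T g x y"
  by (auto simp: path_in_def)

lemma path_in_subset: "path_in S g x y \<Longrightarrow> x \<in> S \<and> y \<in> S"
  unfolding path_in_def using pathstart_in_path_image pathfinish_in_path_image by blast

lemma path_in_loops_at: "path_in S g p p \<longleftrightarrow> g \<in> loops_at S p"
  by (auto simp: path_in_def loops_at_def)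

lemma simply_connected_homotopic_paths:
  fixes S :: "'a::real_normed_vector set"
  assumes "simply_connected S" "path_in S g x y" "path_in S h x y"
  shows "homotopic_paths S g h"
  using assms unfolding simply_connected_eq_homotopic_paths path_in_def by metis

lemma homotopic_paths_cancel_middle:
  fixes g :: "real \<Rightarrow> 'a::real_normed_vector"
  assumes g: "path_in S g x y" and c: "path_in S c y z" and h: "path_in S h y w"
  shows "homotopic_paths S ((g +++ c) +++ (reversepath c +++ h)) (g +++ h)"
proof -
  note D = g[unfolded path_in_def] c[unfolded path_in_def] h[unfolded path_in_def]
  have "homotopic_paths S ((g +++ c) +++ (reversepath c +++ h)) (g +++ (c +++ (reversepath c +++ h)))"
    using D by (intro homotopic_paths_sym[OF homotopic_paths_assoc]) (auto simp: path_image_join)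
  also have "homotopic_paths S \<dots> (g +++ ((c +++ reversepath c) +++ h))"
    using D by (intro homotopic_paths_join homotopic_paths_assoc) (auto simp: path_image_join)
  also have "homotopic_paths S \<dots> (g +++ (linepath y y +++ h))"
    using D homotopic_paths_rinv[of c S] by (intro homotopic_paths_join) auto
  also have "homotopic_paths S \<dots> (g +++ h)"
    using D by (intro homotopic_paths_join homotopic_paths_lid') auto
  finally show ?thesis .
qed

text \<open>A choice of paths from the base point turns paths with arbitrary endpoints into elements of
  the fundamental group, functorially.\<close>

definition based_class :: "'a::topological_space set \<Rightarrow> ('a \<Rightarrow> real \<Rightarrow> 'a) \<Rightarrow> (real \<Rightarrow> 'a) \<Rightarrow> (real \<Rightarrow> 'a) set" where
  "based_class S conn g = loop_class S (conn (pathstart g) +++ g +++ reversepath (conn (pathfinish g)))"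

locale based_paths =
  fixes S :: "'a::real_normed_vector set" and p :: 'a and conn :: "'a \<Rightarrow> real \<Rightarrow> 'a"
  assumes conn: "\<And>x. x \<in> S \<Longrightarrow> path_in S (conn x) p x"
    and base_point: "p \<in> S"
begin

lemma based_loop:
  assumes "path_in S g x y"
  shows "conn x +++ g +++ reversepath (conn y) \<in> loops_at S p"
proof -
  have "path_in S (conn x) p x" "path_in S (conn y) p y"
    using path_in_subset[OF assms] conn by auto
  then show ?thesis
    using assms path_in_join path_in_reversepath path_in_loops_at by metis
qed

lemma based_class_eq: "path_in S g x y \<Longrightarrow> based_class S conn g = loop_class S (conn x +++ g +++ reversepath (conn y))"
  by (auto simp: based_class_def path_in_def)

lemma based_class_closed: "path_in S g x y \<Longrightarrow> based_class S conn g \<in> carrier (fundamental_group S p)"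
  using based_loop by (auto simp: based_class_eq carrier_fundamental_group)

lemma based_class_homotopic:
  assumes g: "path_in S g x y" and hom: "homotopic_paths S g h"
  shows "based_class S conn g = based_class S conn h"
proof -
  have h: "path_in S h x y"
    using g hom homotopic_paths_imp_path[OF hom] homotopic_paths_imp_subset[OF hom]
      homotopic_paths_imp_pathstart[OF hom] homotopic_paths_imp_pathfinish[OF hom]
    by (simp add: path_in_def)
  have c: "path_in S (conn x) p x" "path_in S (conn y) p y"
    using path_in_subset[OF g] conn by auto
  have "homotopic_paths S (conn x +++ g +++ reversepath (conn y)) (conn x +++ h +++ reversepath (conn y))"
    using c g h hom by (intro homotopic_paths_join) (auto simp: path_in_def)
  then show ?thesis
    unfolding based_class_eq[OF g] based_class_eq[OF h] by (rule loop_class_eqI[OF based_loop[OF g]])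
qed

text \<open>The excursion back to \<open>p\<close> along \<open>conn y\<close> and out again cancels
  up to homotopy.\<close>

lemma based_class_join:
  assumes g: "path_in S g x y" and h: "path_in S h y z"
  shows "based_class S conn (g +++ h) = based_class S conn g \<otimes>\<^bsub>fundamental_group S p\<^esub> based_class S conn h"
proof -
  have c: "path_in S (conn x) p x" "path_in S (conn y) p y" "path_in S (conn z) p z"
    using path_in_subset[OF g] path_in_subset[OF h] conn by auto
  note r = path_in_reversepath[OF c(2)] path_in_reversepath[OF c(3)]
  note D = g[unfolded path_in_def] h[unfolded path_in_def] c[unfolded path_in_def]
  have "homotopic_paths S ((conn x +++ g +++ reversepath (conn y)) +++ (conn y +++ h +++ reversepath (conn z)))
     (((conn x +++ g) +++ reversepath (conn y)) +++ (conn y +++ h +++ reversepath (conn z)))"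
    using D by (intro homotopic_paths_join homotopic_paths_assoc) (auto simp: path_image_join)
  also have "homotopic_paths S \<dots> ((conn x +++ g) +++ (h +++ reversepath (conn z)))"
    using homotopic_paths_cancel_middle[OF path_in_join[OF c(1) g] r(1) path_in_join[OF h r(2)]] by simp
  also have "homotopic_paths S \<dots> (conn x +++ (g +++ (h +++ reversepath (conn z))))"
    using D by (intro homotopic_paths_sym[OF homotopic_paths_assoc]) (auto simp: path_image_join)
  also have "homotopic_paths S \<dots> (conn x +++ ((g +++ h) +++ reversepath (conn z)))"
    using D by (intro homotopic_paths_join homotopic_paths_assoc) (auto simp: path_image_join)
  finally have "loop_class S ((conn x +++ g +++ reversepath (conn y)) +++ (conn y +++ h +++ reversepath (conn z)))
     = loop_class S (conn x +++ ((g +++ h) +++ reversepath (conn z)))"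
    by (rule loop_class_eqI[OF loops_at_join[OF based_loop[OF g] based_loop[OF h]]])
  then show ?thesis
    unfolding based_class_eq[OF g] based_class_eq[OF h] based_class_eq[OF path_in_join[OF g h]]
      fundamental_group_mult[OF based_loop[OF g] based_loop[OF h]] by simp
qed

lemma based_class_const:
  assumes "x \<in> S"
  shows "based_class S conn (linepath x x) = \<one>\<^bsub>fundamental_group S p\<^esub>"
proof -
  interpret Group.group "fundamental_group S p" by (rule group_fundamental_group[OF base_point])
  have l: "path_in S (linepath x x) x x" using assms by (simp add: path_in_def)
  have "homotopic_paths S (linepath x x +++ linepath x x) (linepath x x)"
    using l homotopic_paths_lid'[of "linepath x x" S x] by (simp add: path_in_def)
  from based_class_homotopic[OF path_in_join[OF l l] this]
  have "based_class S conn (linepath x x) \<otimes>\<^bsub>fundamental_group S p\<^esub> based_class S conn (linepath x x) =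
     based_class S conn (linepath x x)"
    by (simp add: based_class_join[OF l l])
  then show ?thesis
    using based_class_closed[OF l] l_cancel_one by metis
qed

lemma based_class_reversepath:
  assumes g: "path_in S g x y"
  shows "based_class S conn (reversepath g) = inv\<^bsub>fundamental_group S p\<^esub> based_class S conn g"
proof -
  interpret Group.group "fundamental_group S p" by (rule group_fundamental_group[OF base_point])
  note r = path_in_reversepath[OF g]
  have "homotopic_paths S (reversepath g +++ g) (linepath y y)"
    using homotopic_paths_linv[of g S] g by (simp add: path_in_def)
  from based_class_homotopic[OF path_in_join[OF r g] this]
  have "based_class S conn (reversepath g) \<otimes>\<^bsub>fundamental_group S p\<^esub> based_class S conn g = \<one>\<^bsub>fundamental_group S p\<^esub>"
    using based_class_const path_in_subset[OF g] by (simp add: based_class_join[OF r g])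
  then show ?thesis
    using inv_equality based_class_closed[OF g] based_class_closed[OF r] by metis
qed

lemma subpath_path_in:
  assumes "path g" "path_image g \<subseteq> S" "u \<in> {0..1}" "v \<in> {0..1}"
  shows "path_in S (subpath u v g) (g u) (g v)"
  using assms path_image_subpath_subset[of u v g] unfolding path_in_def
  by (auto simp: path_subpath)

text \<open>Call two parameters equivalent when the piece of the path between them has its class in \<open>N\<close>;
  the equivalence classes are open in the interval, so there is only one.\<close>

lemma based_class_in_subgroup:
  assumes N: "subgroup N (fundamental_group S p)"
    and cover: "\<And>x. x \<in> S \<Longrightarrow> \<exists>T. openin (top_of_set S) T \<and> x \<in> T \<and>
        (\<forall>g y z. path_in T g y z \<longrightarrow> based_class S conn g \<in> N)"
    and g: "path_in S g x y"
  shows "based_class S conn g \<in> N"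
proof -
  interpret Group.group "fundamental_group S p" by (rule group_fundamental_group[OF base_point])
  have gp: "path g" "path_image g \<subseteq> S" using g by (auto simp: path_in_def)
  define R where "R u v \<longleftrightarrow> based_class S conn (subpath u v g) \<in> N" for u v
  have sp: "path_in S (subpath u v g) (g u) (g v)" if "u \<in> {0..1}" "v \<in> {0..1}" for u v
    by (rule subpath_path_in[OF gp that])
  have "R 0 1"
  proof (rule connected_equivalence_relation[of "{0..1}" 0 1 R])
    fix u v assume "R u v" "u \<in> {0..1}" "v \<in> {0..1::real}"
    then show "R v u"
      using based_class_reversepath[OF sp] subgroup.m_inv_closed[OF N] unfolding R_def
      by (metis reversepath_subpath)
  next
    fix u v w assume uv: "R u v" "R v w" "u \<in> {0..1}" "v \<in> {0..1::real}" "w \<in> {0..1::real}"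
    have "homotopic_paths S (subpath u v g +++ subpath v w g) (subpath u w g)"
      using uv by (intro homotopic_join_subpaths gp) auto
    from based_class_homotopic[OF path_in_join[OF sp sp] this] uv
    show "R u w"
      using based_class_join[OF sp sp, of u v w] subgroup.m_closed[OF N] unfolding R_def by metis
  next
    fix u assume u: "u \<in> {0..1::real}"
    then have "g u \<in> S" using gp(2) by (auto simp: path_image_def)
    then obtain T where T: "openin (top_of_set S) T" "g u \<in> T"
      and TN: "\<And>h y z. path_in T h y z \<Longrightarrow> based_class S conn h \<in> N"
      using cover by metis
    have "openin (top_of_set {0..1}) ({0..1} \<inter> g -` T)"
      using gp T(1) by (intro continuous_openin_preimage[of _ _ S]) (auto simp: path_def path_image_def)
    moreover have "u \<in> {0..1} \<inter> g -` T" using u T(2) by simp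
    ultimately obtain e where e: "e > 0" "\<forall>v\<in>{0..1}. dist v u < e \<longrightarrow> v \<in> {0..1} \<inter> g -` T"
      unfolding openin_euclidean_subtopology_iff by blast
    show "\<exists>W. openin (top_of_set {0..1}) W \<and> u \<in> W \<and> (\<forall>v\<in>W. R u v)"
    proof (intro exI conjI ballI)
      show "openin (top_of_set {0..1}) ({0..1} \<inter> ball u e)" by (simp add: openin_open_Int)
      show "u \<in> {0..1} \<inter> ball u e" using u e(1) by simp
      fix v assume v: "v \<in> {0..1} \<inter> ball u e"
      \<comment> \<open>Convexity keeps the whole segment near \<open>u\<close>, so that all of the
        subpath lies in \<open>T\<close> and not only its endpoints.\<close>
      have seg: "closed_segment u v \<subseteq> {0..1} \<inter> ball u e"
        by (rule closed_segment_subset) (use u v e(1) in \<open>auto intro: convex_Int\<close>)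
      have "g w \<in> T" if "w \<in> closed_segment u v" for w
        using e(2) seg that by (auto simp: dist_commute subset_iff)
      then have "path_image (subpath u v g) \<subseteq> T"
        by (auto simp: path_image_subpath_gen)
      then have "path_in T (subpath u v g) (g u) (g v)"
        using sp[of u v] u v by (auto simp: path_in_def)
      then show "R u v" using TN unfolding R_def by blast
    qed
  qed auto
  then show ?thesis by (simp add: R_def)
qed

end

section \<open>Coverings glued from two charts\<close>

text \<open>A criterion for coverings that are locally unions of graphs. The function
  \<open>l r\<close> is positive on the sheet \<open>r\<close> and on no other, which makes the
  sheets open in \<open>E\<close> and pairwise disjoint.\<close>

lemma covering_space_graphs:
  fixes E :: "('a::topological_space \<times> 'b::topological_space) set"
  assumes onto: "fst ` E = U"
    and local: "\<And>x. x \<in> U \<Longrightarrow> \<exists>T R s l. x \<in> T \<and> openin (top_of_set U) T \<and>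
        E \<inter> fst -` T = (\<Union>r\<in>R. (\<lambda>y. (y, s r y)) ` T) \<and>
        (\<forall>r\<in>R. continuous_on T (s r) \<and> continuous_on UNIV (l r) \<and> (\<forall>y\<in>T. 0 < (l r (s r y) :: real)) \<and>
          (\<forall>r'\<in>R. r' \<noteq> (r::'r) \<longrightarrow> (\<forall>y\<in>T. l r (s r' y) \<le> 0)))"
  shows "covering_space E fst U"
  unfolding covering_space_def
proof (intro conjI ballI)
  show "continuous_on E fst" by (intro continuous_intros)
  fix x assume "x \<in> U"
  from local[OF this] obtain T R s l where T: "x \<in> T" "openin (top_of_set U) T"
    and E: "E \<inter> fst -` T = (\<Union>r\<in>R. (\<lambda>y. (y, s r y)) ` T)"
    and *: "\<forall>r\<in>R. continuous_on T (s r) \<and> continuous_on UNIV (l r) \<and> (\<forall>y\<in>T. 0 < (l r (s r y) :: real)) \<and>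
          (\<forall>r'\<in>R. r' \<noteq> (r::'r) \<longrightarrow> (\<forall>y\<in>T. l r (s r' y) \<le> 0))"
    by (elim exE conjE)
  have s: "continuous_on T (s r)" and l: "continuous_on UNIV (l r)" if "r \<in> R" for r
    using * that by simp_all
  have pos: "0 < l r (s r y)" if "r \<in> R" "y \<in> T" for r y
    using * that by simp
  have npos: "l r (s r' y) \<le> 0" if "r \<in> R" "r' \<in> R" "r' \<noteq> r" "y \<in> T" for r r' y
    using * that by simp
  let ?G = "\<lambda>r. (\<lambda>y. (y, s r y)) ` T"
  have G: "?G r = (E \<inter> fst -` T) \<inter> (E \<inter> (\<lambda>z. l r (snd z)) -` {0<..})" if r: "r \<in> R" for r
  proof (rule Set.set_eqI, rule iffI)
    fix z assume "z \<in> ?G r"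
    then show "z \<in> (E \<inter> fst -` T) \<inter> (E \<inter> (\<lambda>z. l r (snd z)) -` {0<..})"
      using E r pos[OF r] by auto
  next
    fix z assume z: "z \<in> (E \<inter> fst -` T) \<inter> (E \<inter> (\<lambda>z. l r (snd z)) -` {0<..})"
    then obtain r' y where "r' \<in> R" "y \<in> T" "z = (y, s r' y)" using E by blast
    then show "z \<in> ?G r" using z npos[OF r, of r' y] by force
  qed
  show "\<exists>T. x \<in> T \<and> openin (top_of_set U) T \<and>
     (\<exists>v. \<Union>v = E \<inter> fst -` T \<and> (\<forall>u\<in>v. openin (top_of_set E) u) \<and> pairwise disjnt v \<and>
       (\<forall>u\<in>v. \<exists>q. homeomorphism u T fst q))"
  proof (intro exI[of _ T] conjI T exI[of _ "?G ` R"] ballI)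
    show "\<Union>(?G ` R) = E \<inter> fst -` T" using E by simp
    show "pairwise disjnt (?G ` R)"
    proof (rule pairwise_imageI)
      fix r r' assume "r \<in> R" "r' \<in> R" "r \<noteq> r'"
      then show "disjnt (?G r) (?G r')"
        using pos[of r] npos[of r r'] by (force simp: disjnt_iff)
    qed
    fix u assume "u \<in> ?G ` R"
    then obtain r where r: "r \<in> R" "u = ?G r" by blast
    have "openin (top_of_set E) (E \<inter> fst -` T)"
      using T(2) onto by (intro continuous_openin_preimage[of _ _ U]) (auto intro: continuous_intros)
    moreover have "openin (top_of_set E) (E \<inter> (\<lambda>z. l r (snd z)) -` {0<..})"
      by (intro continuous_openin_preimage_gen continuous_on_compose2[OF l[OF r(1)]] continuous_intros) auto
    ultimately show "openin (top_of_set E) u"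
      unfolding r(2) G[OF r(1)] by (rule openin_Int)
    have "homeomorphism u T fst (\<lambda>y. (y, s r y))"
      unfolding r(2) homeomorphism_def
      using s[OF r(1)] by (auto intro!: continuous_intros simp: image_image)
    then show "\<exists>q. homeomorphism u T fst q" by blast
  qed
qed (rule onto)

text \<open>Coordinate vectors in the space of bounded sequences. They become sheet labels after
  countable labels are coded by \<open>to_nat\<close>.\<close>

definition unit_seq :: "nat \<Rightarrow> nat \<Rightarrow>\<^sub>C real" where
  "unit_seq n = Bcontfun (\<lambda>m. if m = n then 1 else 0)"

lemma unit_seq_apply: "apply_bcontfun (unit_seq n) m = (if m = n then 1 else 0)"
proof -
  have "(\<lambda>m::nat. if m = n then 1 else (0::real)) \<in> bcontfun"
  proof (rule bcontfun_normI)
    show "norm (if m = n then 1 else (0::real)) \<le> 1" for m by simp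
  qed (simp add: continuous_on_discrete)
  then show ?thesis
    by (simp add: unit_seq_def Bcontfun_inverse)
qed

lemma norm_unit_seq_le: "norm (unit_seq n) \<le> 1"
  by (rule norm_bound) (simp add: unit_seq_apply)

lemma continuous_on_apply_bcontfun: "continuous_on S (\<lambda>f. apply_bcontfun (f :: nat \<Rightarrow>\<^sub>C real) m)"
  unfolding continuous_on_iff
proof (intro ballI allI impI)
  fix f :: "nat \<Rightarrow>\<^sub>C real" and e :: real assume "0 < e"
  then show "\<exists>d>0. \<forall>g\<in>S. dist g f < d \<longrightarrow> dist (apply_bcontfun g m) (apply_bcontfun f m) < e"
    using dist_bounded[of _ m f] by (intro exI[of _ e]) (force intro: le_less_trans)
qed

text \<open>The label may jump where the weight vanishes: the norm of the product is at most the
  modulus of the weight, which tends to 0 there.\<close>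

lemma continuous_on_locally_constant_unit_seq:
  fixes \<phi> :: "'a::real_normed_vector \<Rightarrow> real"
  assumes \<phi>: "continuous_on T \<phi>"
    and const: "\<And>x. x \<in> T \<Longrightarrow> \<phi> x \<noteq> 0 \<Longrightarrow> \<exists>W. openin (top_of_set T) W \<and> x \<in> W \<and> (\<forall>y\<in>W. n y = n x)"
  shows "continuous_on T (\<lambda>x. \<phi> x *\<^sub>R unit_seq (n x))"
  unfolding continuous_on
proof
  fix x assume x: "x \<in> T"
  have \<phi>x: "(\<phi> \<longlongrightarrow> \<phi> x) (at x within T)" using \<phi> x by (simp add: continuous_on)
  show "((\<lambda>x. \<phi> x *\<^sub>R unit_seq (n x)) \<longlongrightarrow> \<phi> x *\<^sub>R unit_seq (n x)) (at x within T)"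
  proof (cases "\<phi> x = 0")
    case True
    have "((\<lambda>y. \<phi> y *\<^sub>R unit_seq (n y)) \<longlongrightarrow> 0) (at x within T)"
    proof (rule Lim_null_comparison)
      show "((\<lambda>y. \<bar>\<phi> y\<bar>) \<longlongrightarrow> 0) (at x within T)" using tendsto_rabs[OF \<phi>x] True by simp
      have "norm (\<phi> y *\<^sub>R unit_seq (n y)) \<le> \<bar>\<phi> y\<bar>" for y
        using mult_left_mono[OF norm_unit_seq_le[of "n y"], of "\<bar>\<phi> y\<bar>"] by simp
      then show "\<forall>\<^sub>F y in at x within T. norm (\<phi> y *\<^sub>R unit_seq (n y)) \<le> \<bar>\<phi> y\<bar>" by simp
    qed
    then show ?thesis using True by simp
  next
    case False
    obtain W where W: "openin (top_of_set T) W" "x \<in> W" "\<And>y. y \<in> W \<Longrightarrow> n y = n x"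
      using const[OF x False] by blast
    then obtain V where V: "open V" "W = T \<inter> V" by (auto simp: openin_open)
    have "\<forall>\<^sub>F y in at x within T. n y = n x"
      unfolding eventually_at_topological
    proof (intro exI[of _ V] conjI ballI impI)
      show "x \<in> V" using W(2) V by blast
      show "n y = n x" if "y \<in> V" "y \<in> T" for y using W(3)[of y] V that by blast
    qed (rule V)
    then have "\<forall>\<^sub>F y in at x within T. \<phi> y *\<^sub>R unit_seq (n x) = \<phi> y *\<^sub>R unit_seq (n y)"
      by eventually_elim simp
    moreover have "((\<lambda>y. \<phi> y *\<^sub>R unit_seq (n x)) \<longlongrightarrow> \<phi> x *\<^sub>R unit_seq (n x)) (at x within T)"
      by (intro tendsto_intros \<phi>x)
    ultimately show ?thesis by (rule Lim_transform_eventually[rotated])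
  qed
qed

text \<open>Two charts \<open>{fA > 0}\<close> and \<open>{fB > 0}\<close> overlapping in disjoint doors \<open>C k\<close>.  Gluing copies of
  the charts labelled by \<open>R\<close> along the permutations \<open>\<kappa> k\<close> gives a covering space.  It is realised
  inside \<open>'a \<times> \<ell>\<^sup>\<infinity>\<close>, because the lifting theorems of the library need a normed space: over a chart
  the label is a coordinate vector, and the vectors of the two charts are mixed with the weights
  \<open>fA\<close> and \<open>fB\<close>.\<close>

locale glued_charts =
  fixes U :: "'a::real_normed_vector set" and fA fB :: "'a \<Rightarrow> real" and C :: "'k \<Rightarrow> 'a set"
    and R :: "'w::countable set" and \<kappa> :: "'k \<Rightarrow> 'w \<Rightarrow> 'w"
  assumes fA: "continuous_on U fA" "\<And>x. x \<in> U \<Longrightarrow> 0 \<le> fA x"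
    and fB: "continuous_on U fB" "\<And>x. x \<in> U \<Longrightarrow> 0 \<le> fB x"
    and cover: "\<And>x. x \<in> U \<Longrightarrow> 0 < fA x \<or> 0 < fB x"
    and doors: "{x \<in> U. 0 < fA x \<and> 0 < fB x} = (\<Union>k. C k)"
    and open_door: "\<And>k. openin (top_of_set U) (C k)"
    and disjoint: "\<And>k l. k \<noteq> l \<Longrightarrow> C k \<inter> C l = {}"
    and bij: "\<And>k. bij_betw (\<kappa> k) R R"
begin

definition A where "A = {x \<in> U. 0 < fA x}"
definition B where "B = {x \<in> U. 0 < fB x}"
definition door where "door x = (THE k. x \<in> C k)"

text \<open>On \<open>A\<close> outside the doors \<open>door x\<close> is an arbitrary value, but
  there \<open>fB x\<close> is 0, so the vector depending on it drops out. Likewise for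
  \<open>sheetB\<close> on \<open>B\<close>.\<close>

definition sheetA :: "'w \<Rightarrow> 'a \<Rightarrow> nat \<Rightarrow>\<^sub>C real" where
  "sheetA r x = fA x *\<^sub>R unit_seq (to_nat (True, r)) + fB x *\<^sub>R unit_seq (to_nat (False, \<kappa> (door x) r))"

definition sheetB :: "'w \<Rightarrow> 'a \<Rightarrow> nat \<Rightarrow>\<^sub>C real" where
  "sheetB r x = fA x *\<^sub>R unit_seq (to_nat (True, inv_into R (\<kappa> (door x)) r)) + fB x *\<^sub>R unit_seq (to_nat (False, r))"

definition total :: "('a \<times> (nat \<Rightarrow>\<^sub>C real)) set" where
  "total = (\<Union>r\<in>R. (\<lambda>x. (x, sheetA r x)) ` A) \<union> (\<Union>r\<in>R. (\<lambda>x. (x, sheetB r x)) ` B)"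

lemma AB: "A \<inter> B = (\<Union>k. C k)" "A \<union> B = U"
  using doors cover by (auto simp: A_def B_def)

lemma AB_door: "x \<in> A \<Longrightarrow> x \<in> B \<Longrightarrow> \<exists>k. x \<in> C k"
  using AB(1) by blast

lemma door: "x \<in> C k \<Longrightarrow> door x = k"
  unfolding door_def using disjoint by (intro the_equality) auto

lemma sheetA_eq_sheetB: "x \<in> C k \<Longrightarrow> r \<in> R \<Longrightarrow> sheetA r x = sheetB (\<kappa> k r) x"
  using bij[of k] by (simp add: sheetA_def sheetB_def door bij_betw_inv_into_left)

lemma open_A: "openin (top_of_set U) A" and open_B: "openin (top_of_set U) B"
proof -
  have "A = U \<inter> fA -` {0<..}" "B = U \<inter> fB -` {0<..}" by (auto simp: A_def B_def)
  then show "openin (top_of_set U) A" "openin (top_of_set U) B"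
    using continuous_openin_preimage_gen[OF fA(1), of "{0<..}"] continuous_openin_preimage_gen[OF fB(1), of "{0<..}"]
    by auto
qed

lemma door_locally_constant:
  assumes "x \<in> A" "x \<in> B" "T \<subseteq> U" "x \<in> T"
  shows "\<exists>W. openin (top_of_set T) W \<and> x \<in> W \<and> (\<forall>y\<in>W. door y = door x)"
proof -
  obtain k where k: "x \<in> C k" using AB_door[OF assms(1,2)] by blast
  have "openin (top_of_set T) (T \<inter> C k)"
    using open_door[of k] assms(3) by (metis openin_open inf_assoc inf_absorb1 inf_commute)
  then show ?thesis using k door assms(4) by (intro exI[of _ "T \<inter> C k"]) auto
qed

lemma continuous_on_sheetA: "continuous_on A (sheetA r)"
proof -
  have U: "A \<subseteq> U" by (auto simp: A_def)
  have "continuous_on A (\<lambda>x. fB x *\<^sub>R unit_seq (to_nat (False, \<kappa> (door x) r)))"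
  proof (rule continuous_on_locally_constant_unit_seq)
    show "continuous_on A fB" using fB(1) U by (rule continuous_on_subset)
    fix x assume x: "x \<in> A" "fB x \<noteq> 0"
    then have "x \<in> B" using fB(2)[of x] U by (auto simp: B_def)
    from door_locally_constant[OF x(1) this U x(1)]
    show "\<exists>W. openin (top_of_set A) W \<and> x \<in> W \<and>
       (\<forall>y\<in>W. to_nat (False, \<kappa> (door y) r) = to_nat (False, \<kappa> (door x) r))"
      by metis
  qed
  moreover have "continuous_on A fA" using fA(1) U by (rule continuous_on_subset)
  ultimately show ?thesis
    unfolding sheetA_def by (auto intro: continuous_on_add[OF continuous_on_scaleR[OF _ continuous_on_const]])
qed

lemma continuous_on_sheetB: "continuous_on B (sheetB r)"
proof -
  have U: "B \<subseteq> U" by (auto simp: B_def)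
  have "continuous_on B (\<lambda>x. fA x *\<^sub>R unit_seq (to_nat (True, inv_into R (\<kappa> (door x)) r)))"
  proof (rule continuous_on_locally_constant_unit_seq)
    show "continuous_on B fA" using fA(1) U by (rule continuous_on_subset)
    fix x assume x: "x \<in> B" "fA x \<noteq> 0"
    then have "x \<in> A" using fA(2)[of x] U by (auto simp: A_def)
    from door_locally_constant[OF this x(1) U x(1)]
    show "\<exists>W. openin (top_of_set B) W \<and> x \<in> W \<and>
       (\<forall>y\<in>W. to_nat (True, inv_into R (\<kappa> (door y)) r) = to_nat (True, inv_into R (\<kappa> (door x)) r))"
      by metis
  qed
  moreover have "continuous_on B fB" using fB(1) U by (rule continuous_on_subset)
  ultimately show ?thesis
    unfolding sheetB_def by (auto intro: continuous_on_add[OF _ continuous_on_scaleR[OF _ continuous_on_const]])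
qed

text \<open>The coordinate belonging to a label is the separating function that
  \<open>covering_space_graphs\<close> asks for.\<close>

lemma sheetA_label: "apply_bcontfun (sheetA r x) (to_nat (True, r')) = (if r' = r then fA x else 0)"
  by (simp add: sheetA_def plus_bcontfun.rep_eq scaleR_bcontfun.rep_eq unit_seq_apply)

lemma sheetB_label: "apply_bcontfun (sheetB r x) (to_nat (False, r')) = (if r' = r then fB x else 0)"
  by (simp add: sheetB_def plus_bcontfun.rep_eq scaleR_bcontfun.rep_eq unit_seq_apply)

lemma total_over_A: "total \<inter> fst -` A = (\<Union>r\<in>R. (\<lambda>x. (x, sheetA r x)) ` A)"
proof -
  have "(x, sheetB r x) \<in> (\<Union>r\<in>R. (\<lambda>x. (x, sheetA r x)) ` A)" if x: "x \<in> A" "x \<in> B" and r: "r \<in> R" for x r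
  proof -
    obtain k where k: "x \<in> C k" using AB_door[OF x] by blast
    obtain r' where "r' \<in> R" "r = \<kappa> k r'" using bij[of k] r by (auto simp: bij_betw_def)
    then show ?thesis
      using sheetA_eq_sheetB[OF k, of r'] x by (intro UN_I[of r'] image_eqI[of _ _ x]) auto
  qed
  then show ?thesis unfolding total_def by fastforce
qed

lemma total_over_B: "total \<inter> fst -` B = (\<Union>r\<in>R. (\<lambda>x. (x, sheetB r x)) ` B)"
proof -
  have "(x, sheetA r x) \<in> (\<Union>r\<in>R. (\<lambda>x. (x, sheetB r x)) ` B)" if x: "x \<in> A" "x \<in> B" and r: "r \<in> R" for x r
  proof -
    obtain k where k: "x \<in> C k" using AB_door[OF x] by blast
    have "\<kappa> k r \<in> R" using bij[of k] r by (auto simp: bij_betw_def)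
    then show ?thesis
      using sheetA_eq_sheetB[OF k r] x by (intro UN_I[of "\<kappa> k r"] image_eqI[of _ _ x]) auto
  qed
  then show ?thesis unfolding total_def by fastforce
qed

lemma covering_space_total:
  assumes "R \<noteq> {}"
  shows "covering_space total fst U"
proof (rule covering_space_graphs)
  show "fst ` total = U"
  proof
    show "fst ` total \<subseteq> U" unfolding total_def by (auto simp: A_def B_def)
    show "U \<subseteq> fst ` total"
    proof
      fix x assume "x \<in> U"
      obtain r where "r \<in> R" using assms by blast
      consider "x \<in> A" | "x \<in> B" using \<open>x \<in> U\<close> AB(2) by blast
      then show "x \<in> fst ` total"
      proof cases
        case 1
        then have "(x, sheetA r x) \<in> total" using \<open>r \<in> R\<close> unfolding total_def by blast
        then show ?thesis by force
      next
        case 2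
        then have "(x, sheetB r x) \<in> total" using \<open>r \<in> R\<close> unfolding total_def by blast
        then show ?thesis by force
      qed
    qed
  qed
  fix x assume "x \<in> U"
  then consider "x \<in> A" | "x \<in> B" using AB by auto
  then show "\<exists>T R s l. x \<in> T \<and> openin (top_of_set U) T \<and>
        total \<inter> fst -` T = (\<Union>r\<in>R. (\<lambda>y. (y, s r y)) ` T) \<and>
        (\<forall>r\<in>R. continuous_on T (s r) \<and> continuous_on UNIV (l r) \<and> (\<forall>y\<in>T. 0 < (l r (s r y) :: real)) \<and>
          (\<forall>r'\<in>R. r' \<noteq> (r::'w) \<longrightarrow> (\<forall>y\<in>T. l r (s r' y) \<le> 0)))"
  proof cases
    case 1
    show ?thesis
    proof (intro exI conjI)
      show "x \<in> A" "openin (top_of_set U) A" by (fact 1 open_A)+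
      show "total \<inter> fst -` A = (\<Union>r\<in>R. (\<lambda>y. (y, sheetA r y)) ` A)" by (rule total_over_A)
      show "\<forall>r\<in>R. continuous_on A (sheetA r) \<and>
          continuous_on UNIV (\<lambda>f :: nat \<Rightarrow>\<^sub>C real. apply_bcontfun f (to_nat (True, r))) \<and>
          (\<forall>y\<in>A. 0 < apply_bcontfun (sheetA r y) (to_nat (True, r))) \<and>
          (\<forall>r'\<in>R. r' \<noteq> r \<longrightarrow> (\<forall>y\<in>A. apply_bcontfun (sheetA r' y) (to_nat (True, r)) \<le> 0))"
      proof (intro ballI conjI impI)
        fix r :: 'w
        show "continuous_on A (sheetA r)" by (rule continuous_on_sheetA)
        show "continuous_on UNIV (\<lambda>f :: nat \<Rightarrow>\<^sub>C real. apply_bcontfun f (to_nat (True, r)))" by (rule continuous_on_apply_bcontfun)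
      qed (auto simp: sheetA_label A_def)
    qed
  next
    case 2
    show ?thesis
    proof (intro exI conjI)
      show "x \<in> B" "openin (top_of_set U) B" by (fact 2 open_B)+
      show "total \<inter> fst -` B = (\<Union>r\<in>R. (\<lambda>y. (y, sheetB r y)) ` B)" by (rule total_over_B)
      show "\<forall>r\<in>R. continuous_on B (sheetB r) \<and>
          continuous_on UNIV (\<lambda>f :: nat \<Rightarrow>\<^sub>C real. apply_bcontfun f (to_nat (False, r))) \<and>
          (\<forall>y\<in>B. 0 < apply_bcontfun (sheetB r y) (to_nat (False, r))) \<and>
          (\<forall>r'\<in>R. r' \<noteq> r \<longrightarrow> (\<forall>y\<in>B. apply_bcontfun (sheetB r' y) (to_nat (False, r)) \<le> 0))"
      proof (intro ballI conjI impI)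
        fix r :: 'w
        show "continuous_on B (sheetB r)" by (rule continuous_on_sheetB)
        show "continuous_on UNIV (\<lambda>f :: nat \<Rightarrow>\<^sub>C real. apply_bcontfun f (to_nat (False, r)))" by (rule continuous_on_apply_bcontfun)
      qed (auto simp: sheetB_label B_def)
    qed
  qed
qed

section \<open>Lifting paths to the glued covering\<close>

definition lifts :: "(real \<Rightarrow> 'a) \<Rightarrow> 'a \<times> (nat \<Rightarrow>\<^sub>C real) \<Rightarrow> 'a \<times> (nat \<Rightarrow>\<^sub>C real) \<Rightarrow> bool" where
  "lifts g e e' \<longleftrightarrow> (\<exists>h. path_in total h e e' \<and> (\<forall>t\<in>{0..1}. fst (h t) = g t))"

lemma lifts_join:
  assumes "lifts g e e'" "lifts g' e' e''" shows "lifts (g +++ g') e e''"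
proof -
  obtain h h' where h: "path_in total h e e'" "\<And>t. t \<in> {0..1} \<Longrightarrow> fst (h t) = g t"
    and h': "path_in total h' e' e''" "\<And>t. t \<in> {0..1} \<Longrightarrow> fst (h' t) = g' t"
    using assms unfolding lifts_def by blast
  have "fst ((h +++ h') t) = (g +++ g') t" if "t \<in> {0..1}" for t
    using that by (auto simp: joinpaths_def h(2) h'(2))
  then show ?thesis using path_in_join[OF h(1) h'(1)] unfolding lifts_def by blast
qed

lemma lifts_reversepath:
  assumes "lifts g e e'" shows "lifts (reversepath g) e' e"
proof -
  obtain h where h: "path_in total h e e'" "\<And>t. t \<in> {0..1} \<Longrightarrow> fst (h t) = g t"
    using assms unfolding lifts_def by blast
  have "fst (reversepath h t) = reversepath g t" if "t \<in> {0..1}" for t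
    using that by (auto simp: reversepath_def h(2))
  then show ?thesis using path_in_reversepath[OF h(1)] unfolding lifts_def by blast
qed

lemma lifts_A:
  assumes g: "path_in A g x y" and r: "r \<in> R"
  shows "lifts g (x, sheetA r x) (y, sheetA r y)"
  unfolding lifts_def
proof (intro exI[of _ "\<lambda>t. (g t, sheetA r (g t))"] conjI ballI)
  have "continuous_on {0..1} (\<lambda>t. sheetA r (g t))"
    using g by (intro continuous_on_compose2[OF continuous_on_sheetA]) (auto simp: path_in_def path_def path_image_def)
  moreover have "(g t, sheetA r (g t)) \<in> total" if "t \<in> {0..1}" for t
    using g r that unfolding total_def path_in_def path_image_def by (intro UnI1 UN_I[of r] imageI) auto
  ultimately show "path_in total (\<lambda>t. (g t, sheetA r (g t))) (x, sheetA r x) (y, sheetA r y)"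
    using g unfolding path_in_def path_def path_image_def pathstart_def pathfinish_def
    by (auto intro!: continuous_intros)
qed simp

lemma lifts_B:
  assumes g: "path_in B g x y" and r: "r \<in> R"
  shows "lifts g (x, sheetB r x) (y, sheetB r y)"
  unfolding lifts_def
proof (intro exI[of _ "\<lambda>t. (g t, sheetB r (g t))"] conjI ballI)
  have "continuous_on {0..1} (\<lambda>t. sheetB r (g t))"
    using g by (intro continuous_on_compose2[OF continuous_on_sheetB]) (auto simp: path_in_def path_def path_image_def)
  moreover have "(g t, sheetB r (g t)) \<in> total" if "t \<in> {0..1}" for t
    using g r that unfolding total_def path_in_def path_image_def by (intro UnI2 UN_I[of r] imageI) auto
  ultimately show "path_in total (\<lambda>t. (g t, sheetB r (g t))) (x, sheetB r x) (y, sheetB r y)"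
    using g unfolding path_in_def path_def path_image_def pathstart_def pathfinish_def
    by (auto intro!: continuous_intros)
qed simp

lemma lifts_homotopic:
  assumes "R \<noteq> {}" "homotopic_paths U g g'" "lifts g e e1" "lifts g' e e2"
  shows "e1 = e2"
proof -
  obtain h h' where h: "path_in total h e e1" "\<And>t. t \<in> {0..1} \<Longrightarrow> fst (h t) = g t"
    and h': "path_in total h' e e2" "\<And>t. t \<in> {0..1} \<Longrightarrow> fst (h' t) = g' t"
    using assms unfolding lifts_def by blast
  have g: "path g" "path_image g \<subseteq> U" "path g'" "path_image g' \<subseteq> U"
    using assms(2) homotopic_paths_imp_path homotopic_paths_imp_subset by blast+
  have "pathfinish h = pathfinish h'"
    by (rule covering_space_monodromy[OF covering_space_total[OF assms(1)] g assms(2)])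
       (use h h' in \<open>auto simp: path_in_def\<close>)
  then show ?thesis using h h' by (simp add: path_in_def)
qed

end

text \<open>Each generator goes from the base chart through the door \<open>s i\<close> into the other chart and back
  through the door \<open>t i\<close>.  They form a basis when the doors, with an edge from \<open>s i\<close> to \<open>t i\<close> for
  every \<open>i\<close>, form a tree: \<open>step\<close> is acyclicity, \<open>connected\<close> is connectedness.\<close>

locale door_tree = glued_charts U fA fB C "{r. reduced_word r}" \<kappa>
  for U :: "'a::real_normed_vector set" and fA fB C and \<kappa> :: "'k \<Rightarrow> ('i::countable \<times> bool) list \<Rightarrow> ('i \<times> bool) list" +
  fixes p :: 'a and c :: "'k \<Rightarrow> 'a" and s t :: "'i \<Rightarrow> 'k" and a b a' :: "'i \<Rightarrow> real \<Rightarrow> 'a" and k0 :: 'k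
  assumes sc: "simply_connected A" "simply_connected B"
    and door_connected: "\<And>k. path_connected (C k)"
    and c: "\<And>k. c k \<in> C k"
    and p: "p \<in> A"
    and a: "\<And>i. path_in A (a i) p (c (s i))"
    and b: "\<And>i. path_in B (b i) (c (s i)) (c (t i))"
    and a': "\<And>i. path_in A (a' i) (c (t i)) p"
    and step: "\<And>i r. reduced_word r \<Longrightarrow> \<kappa> (s i) r = \<kappa> (t i) (push_letter (i, True) r)"
    and connected: "\<And>k. (k0, k) \<in> (range (\<lambda>i. (s i, t i)) \<union> (range (\<lambda>i. (s i, t i)))\<inverse>)\<^sup>*"
begin

definition \<gamma> where "\<gamma> i = a i +++ (b i +++ a' i)"

lemma subsets: "A \<subseteq> U" "B \<subseteq> U" "C k \<subseteq> A" "C k \<subseteq> B"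
  using AB by auto

lemma pU: "p \<in> U" using p subsets by blast

lemma \<gamma>: "path_in U (\<gamma> i) p p"
  unfolding \<gamma>_def using path_in_mono[OF a] path_in_mono[OF b] path_in_mono[OF a'] subsets path_in_join by metis

lemma \<gamma>_loop: "\<gamma> i \<in> loops_at U p"
  using \<gamma> path_in_loops_at by blast

text \<open>Sheet \<open>r\<close> is left through the door \<open>s i\<close> into the sheet
  \<open>\<kappa> (s i) r\<close> of the other chart. By \<open>step\<close> this sheet meets the
  sheet \<open>push_letter (i, True) r\<close> of the base chart at the door \<open>t i\<close>, so
  the generator acts on sheets as its letter acts on words.\<close>

lemma lifts_\<gamma>:
  assumes r: "reduced_word r"
  shows "lifts (\<gamma> i) (p, sheetA r p) (p, sheetA (push_letter (i, True) r) p)"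
proof -
  let ?r = "push_letter (i, True) r"
  have r': "reduced_word ?r" by (rule push_letter_reduced[OF r])
  have \<kappa>r: "\<kappa> (s i) r \<in> {r. reduced_word r}" using bij[of "s i"] r by (auto simp: bij_betw_def)
  have "sheetA r (c (s i)) = sheetB (\<kappa> (s i) r) (c (s i))"
    using sheetA_eq_sheetB[OF c] r by simp
  moreover have "sheetB (\<kappa> (s i) r) (c (t i)) = sheetA ?r (c (t i))"
    using sheetA_eq_sheetB[OF c] r' step[OF r] by simp
  ultimately show ?thesis
    unfolding \<gamma>_def
    using lifts_A[OF a, of r i] lifts_B[OF b \<kappa>r, of i] lifts_A[OF a', of ?r i] r r' lifts_join
    by (metis mem_Collect_eq)
qed

section \<open>Loops that spell words\<close>

definition letter_loop where "letter_loop l = (if snd l then \<gamma> (fst l) else reversepath (\<gamma> (fst l)))"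

fun word_loop where
  "word_loop [] = linepath p p"
| "word_loop (l # w) = letter_loop l +++ word_loop w"

lemma letter_loop: "letter_loop l \<in> loops_at U p"
  using \<gamma>_loop loops_at_reversepath by (auto simp: letter_loop_def)

lemma word_loop: "word_loop w \<in> loops_at U p"
proof (induction w)
  case Nil
  show ?case unfolding word_loop.simps by (rule loops_at_const[OF pU])
next
  case (Cons l w)
  then show ?case unfolding word_loop.simps by (rule loops_at_join[OF letter_loop])
qed

lemma lifts_letter_loop:
  assumes r: "reduced_word r"
  shows "lifts (letter_loop l) (p, sheetA r p) (p, sheetA (push_letter l r) p)"
proof (cases "snd l")
  case True
  then have "l = (fst l, True)" by (cases l) simp
  then show ?thesis using lifts_\<gamma>[OF r, of "fst l"] True by (simp add: letter_loop_def)
next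
  case False
  then have l: "l = (fst l, False)" by (cases l) simp
  have "push_letter (fst l, True) (push_letter l r) = r"
    using push_letter_inverse[OF r, of True False "fst l"] l by simp
  then show ?thesis
    using lifts_reversepath[OF lifts_\<gamma>[OF push_letter_reduced[OF r], of "fst l" l]] False
    by (simp add: letter_loop_def)
qed

lemma lifts_word_loop:
  "reduced_word r \<Longrightarrow> lifts (word_loop w) (p, sheetA r p) (p, sheetA (fold push_letter w r) p)"
proof (induction w arbitrary: r)
  case Nil
  have "path_in A (linepath p p) p p" using p by (simp add: path_in_def)
  from lifts_A[OF this, of r] show ?case using Nil unfolding word_loop.simps fold_Nil id_apply mem_Collect_eq by blast
next
  case (Cons l w)
  then show ?case
    using lifts_join[OF lifts_letter_loop[OF Cons.prems] Cons.IH[OF push_letter_reduced[OF Cons.prems]]] by simp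
qed

abbreviation G where "G \<equiv> fundamental_group U p"

lemma word_value_loops: "word_value G (\<lambda>i. loop_class U (\<gamma> i)) w = loop_class U (word_loop w)"
proof (induction w)
  case Nil
  then show ?case unfolding word_loop.simps word_value_Nil by (rule fundamental_group_one)
next
  case (Cons l w)
  obtain i s where l: "l = (i, s)" by (cases l)
  have "(if s then loop_class U (\<gamma> i) else inv\<^bsub>G\<^esub> loop_class U (\<gamma> i)) = loop_class U (letter_loop l)"
    using fundamental_group_inv[OF pU \<gamma>_loop] by (simp add: l letter_loop_def)
  then show ?case
    using Cons fundamental_group_mult[OF letter_loop word_loop, of l w]
    unfolding l word_value_Cons word_loop.simps by simp
qed

text \<open>Lifted from the sheet of the empty word, the loop of a reduced word ends in the sheet of
  the reversed word. Homotopic loops have lifts with equal ends, so the words agree.\<close>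

lemma inj_word_value: "inj_on (word_value G (\<lambda>i. loop_class U (\<gamma> i))) {w. reduced_word w}"
proof (rule inj_onI)
  fix w w' :: "('i \<times> bool) list"
  assume w: "w \<in> {w. reduced_word w}" "w' \<in> {w. reduced_word w}"
    and eq: "word_value G (\<lambda>i. loop_class U (\<gamma> i)) w = word_value G (\<lambda>i. loop_class U (\<gamma> i)) w'"
  have "homotopic_paths U (word_loop w) (word_loop w')"
    using eq loop_class_eq_iff[OF word_loop] by (simp add: word_value_loops)
  then have "(p, sheetA (fold push_letter w []) p) = (p, sheetA (fold push_letter w' []) p)"
    by (rule lifts_homotopic[rotated]) (use lifts_word_loop[of "[]"] reduced_word_Nil in blast)+
  moreover have "fold push_letter v [] = rev v" if "v \<in> {w. reduced_word w}" for v :: "('i \<times> bool) list"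
    using fold_push_letter[of v "[]"] that by (simp add: reduced_word_rev)
  ultimately have "sheetA (rev w) p = sheetA (rev w') p" using w by simp
  then have "(if rev w = rev w then fA p else 0) = (if rev w = rev w' then fA p else 0)"
    using sheetA_label by metis
  then have "rev w = rev w'" using p by (auto simp: A_def split: if_splits)
  then show "w = w'" by simp
qed

definition connA where "connA x = (SOME g. path_in A g p x)"
definition pathB where "pathB x = (SOME g. path_in B g (c k0) x)"
text \<open>Outside \<open>A\<close> the connecting path passes through \<open>c k0\<close> and
  continues along \<open>pathB\<close>. This choice makes the class of \<open>pathB x\<close>
  trivial there.\<close>

definition conn where "conn x = (if x \<in> A then connA x else connA (c k0) +++ pathB x)"

lemma cA: "c k \<in> A" and cB: "c k \<in> B"
  using c subsets by blast+

lemma connA: "x \<in> A \<Longrightarrow> path_in A (connA x) p x"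
proof -
  assume "x \<in> A"
  then have "\<exists>g. path_in A g p x"
    using simply_connected_imp_path_connected[OF sc(1)] p unfolding path_connected_def path_in_def by blast
  then show ?thesis unfolding connA_def by (rule someI_ex)
qed

lemma pathB: "x \<in> B \<Longrightarrow> path_in B (pathB x) (c k0) x"
proof -
  assume "x \<in> B"
  then have "\<exists>g. path_in B g (c k0) x"
    using simply_connected_imp_path_connected[OF sc(2)] cB unfolding path_connected_def path_in_def by blast
  then show ?thesis unfolding pathB_def by (rule someI_ex)
qed

lemma conn:
  assumes "x \<in> U" shows "path_in U (conn x) p x"
proof (cases "x \<in> A")
  case True
  then show ?thesis using path_in_mono[OF connA[OF True] subsets(1)] by (simp add: conn_def)
next
  case False
  then have x: "x \<in> B" using assms AB(2) by blast
  show ?thesis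
    using path_in_join[OF path_in_mono[OF connA[OF cA] subsets(1)] path_in_mono[OF pathB[OF x] subsets(2)]] False
    by (simp add: conn_def)
qed

sublocale based_paths U p conn
  by unfold_locales (use conn pU in auto)

interpretation Group.group G
  by (rule group_fundamental_group[OF pU])

abbreviation \<Phi> where "\<Phi> g \<equiv> based_class U conn g"

text \<open>Connecting paths to points of \<open>A\<close> stay in \<open>A\<close>, so the whole
  loop lies in a simply connected set.\<close>

lemma \<Phi>_A:
  assumes g: "path_in A g x y" shows "\<Phi> g = \<one>\<^bsub>G\<^esub>"
proof -
  have xy: "x \<in> A" "y \<in> A" using path_in_subset[OF g] by auto
  note gU = path_in_mono[OF g subsets(1)]
  have "path_in A (conn x +++ g +++ reversepath (conn y)) p p"
    using path_in_join[OF connA[OF xy(1)] path_in_join[OF g path_in_reversepath[OF connA[OF xy(2)]]]] xy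
    by (simp add: conn_def)
  moreover have "path_in A (linepath p p) p p" using p by (simp add: path_in_def)
  ultimately have "homotopic_paths A (conn x +++ g +++ reversepath (conn y)) (linepath p p)"
    by (rule simply_connected_homotopic_paths[OF sc(1)])
  then have "homotopic_paths U (conn x +++ g +++ reversepath (conn y)) (linepath p p)"
    using homotopic_paths_subset subsets(1) by blast
  then show ?thesis
    unfolding based_class_eq[OF gU] fundamental_group_one by (rule loop_class_eqI[OF based_loop[OF gU]])
qed

lemma \<Phi>_B:
  assumes g: "path_in B g x y" shows "\<Phi> (pathB y) = \<Phi> (pathB x) \<otimes>\<^bsub>G\<^esub> \<Phi> g"
proof -
  have xy: "x \<in> B" "y \<in> B" using path_in_subset[OF g] by auto
  note U = path_in_mono[OF pathB[OF xy(1)] subsets(2)] path_in_mono[OF g subsets(2)]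
  have "homotopic_paths B (pathB x +++ g) (pathB y)"
    using simply_connected_homotopic_paths[OF sc(2) path_in_join[OF pathB[OF xy(1)] g] pathB[OF xy(2)]] .
  then have "homotopic_paths U (pathB x +++ g) (pathB y)"
    using homotopic_paths_subset subsets(2) by blast
  then show ?thesis
    using based_class_homotopic[OF path_in_join[OF U]] based_class_join[OF U] by simp
qed

lemma \<Phi>_loop:
  assumes g: "path_in U g p p" shows "\<Phi> g = loop_class U g"
proof -
  have cp: "path_in A (conn p) p p" using connA[OF p] p by (simp add: conn_def)
  have lp: "path_in A (linepath p p) p p" using p by (simp add: path_in_def)
  have null: "homotopic_paths U (conn p) (linepath p p)"
    using simply_connected_homotopic_paths[OF sc(1) cp lp] homotopic_paths_subset subsets(1) by blast
  have null': "homotopic_paths U (reversepath (conn p)) (linepath p p)"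
    using homotopic_paths_reversepath[of U "conn p" "linepath p p"] null by (simp only: reversepath_linepath)
  have D: "path g" "path_image g \<subseteq> U" "pathstart g = p" "pathfinish g = p"
    using g by (auto simp: path_in_def)
  have E: "pathfinish (conn p) = p" "pathstart (reversepath (conn p)) = p"
    using cp by (auto simp: path_in_def)
  have "homotopic_paths U (g +++ reversepath (conn p)) (g +++ linepath p p)"
    using null' D E by (intro homotopic_paths_join) auto
  also have "homotopic_paths U \<dots> g"
    using D by (intro homotopic_paths_rid') auto
  finally have 1: "homotopic_paths U (g +++ reversepath (conn p)) g" .
  have "homotopic_paths U (conn p +++ (g +++ reversepath (conn p))) (linepath p p +++ g)"
    using null 1 D E by (intro homotopic_paths_join) auto
  also have "homotopic_paths U \<dots> g"
    using D by (intro homotopic_paths_lid') auto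
  finally show ?thesis
    unfolding based_class_eq[OF g] by (rule loop_class_eqI[OF based_loop[OF g]])
qed

text \<open>The outer two pieces of the generator lie in \<open>A\<close> and have trivial class;
  only the crossing of the second chart counts.\<close>

lemma \<Phi>_\<gamma>: "\<Phi> (b i) = loop_class U (\<gamma> i)"
proof -
  note aU = path_in_mono[OF a[of i] subsets(1)] and bU = path_in_mono[OF b[of i] subsets(2)]
    and a'U = path_in_mono[OF a'[of i] subsets(1)]
  have "\<Phi> (\<gamma> i) = \<Phi> (a i) \<otimes>\<^bsub>G\<^esub> (\<Phi> (b i) \<otimes>\<^bsub>G\<^esub> \<Phi> (a' i))"
    unfolding \<gamma>_def using based_class_join[OF aU path_in_join[OF bU a'U]] based_class_join[OF bU a'U] by simp
  then have "\<Phi> (\<gamma> i) = \<Phi> (b i)"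
    using \<Phi>_A[OF a] \<Phi>_A[OF a'] based_class_closed[OF bU] by simp
  then show ?thesis using \<Phi>_loop[OF \<gamma>] by simp
qed

lemma \<Phi>_pathB_outside:
  assumes x: "x \<in> B" "x \<notin> A" shows "\<Phi> (pathB x) = \<one>\<^bsub>G\<^esub>"
proof -
  note bU = path_in_mono[OF pathB[OF x(1)] subsets(2)]
  have cx: "conn x = conn (c k0) +++ pathB x" using x cA by (simp add: conn_def)
  have c0: "path_in U (conn (c k0)) p (c k0)" using conn cA subsets by blast
  have j: "path_in U (conn x) p x" using conn x subsets by blast
  have "homotopic_paths U (conn (c k0) +++ (pathB x +++ reversepath (conn x))) ((conn (c k0) +++ pathB x) +++ reversepath (conn x))"
    using c0 bU j by (intro homotopic_paths_assoc) (auto simp: path_in_def)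
  also have "homotopic_paths U \<dots> (linepath p p)"
    using j homotopic_paths_rinv[of "conn x" U] by (simp add: path_in_def cx[symmetric])
  finally show ?thesis
    unfolding based_class_eq[OF bU] fundamental_group_one by (rule loop_class_eqI[OF based_loop[OF bU]])
qed

text \<open>In \<open>B\<close> the class of a path is a quotient of the classes of
  \<open>pathB\<close> at its ends, so it suffices to place the latter in \<open>N\<close>. At the
  door points membership spreads from \<open>k0\<close> along the edges between \<open>s i\<close>
  and \<open>t i\<close>. Within a door it is carried by a path that also lies in \<open>A\<close>,
  and off \<open>A\<close> the class is trivial by the choice of \<open>conn\<close>.\<close>

lemma generates:
  assumes N: "subgroup N G" and gN: "range (\<lambda>i. loop_class U (\<gamma> i)) \<subseteq> N"
  shows "carrier G \<subseteq> N"
proof -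
  have cl: "\<Phi> g \<in> carrier G" if "path_in B g x y" for g x y
    using based_class_closed[OF path_in_mono[OF that subsets(2)]] .
  have one: "\<one>\<^bsub>G\<^esub> \<in> N" using subgroup.one_closed[OF N] .
  have quot: "\<Phi> (pathB x) \<in> N \<longleftrightarrow> \<Phi> (pathB y) \<in> N" if g: "path_in B g x y" "\<Phi> g \<in> N" for g x y
  proof -
    have xy: "x \<in> B" "y \<in> B" using path_in_subset[OF g(1)] by auto
    note e = \<Phi>_B[OF g(1)] and cx = cl[OF pathB[OF xy(1)]] and cg = cl[OF g(1)]
    have "\<Phi> (pathB x) = \<Phi> (pathB y) \<otimes>\<^bsub>G\<^esub> inv\<^bsub>G\<^esub> \<Phi> g"
      using cx cg by (simp add: e m_assoc)
    then show ?thesis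
      using e g(2) subgroup.m_closed[OF N] subgroup.m_inv_closed[OF N] by metis
  qed
  have base: "\<Phi> (pathB (c k)) \<in> N" for k
    using connected[of k]
  proof (induction rule: rtrancl_induct)
    case base
    have l: "path_in B (linepath (c k0) (c k0)) (c k0) (c k0)" using cB by (simp add: path_in_def)
    have "homotopic_paths B (pathB (c k0)) (linepath (c k0) (c k0))"
      by (rule simply_connected_homotopic_paths[OF sc(2) pathB[OF cB] l])
    then have "homotopic_paths U (pathB (c k0)) (linepath (c k0) (c k0))"
      using homotopic_paths_subset subsets(2) by blast
    then have "\<Phi> (pathB (c k0)) = \<one>\<^bsub>G\<^esub>"
      using based_class_homotopic[OF path_in_mono[OF pathB[OF cB] subsets(2)]] based_class_const cA subsets(1)
      by (metis subsetD)
    then show ?case using one by simp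
  next
    case (step k k')
    then obtain i where "(k = s i \<and> k' = t i) \<or> (k = t i \<and> k' = s i)" by auto
    moreover have "\<Phi> (b i) \<in> N" using \<Phi>_\<gamma> gN by auto
    ultimately show ?case using quot[OF b] step.IH by metis
  qed
  have \<theta>: "\<Phi> (pathB x) \<in> N" if x: "x \<in> B" for x
  proof (cases "x \<in> A")
    case True
    then obtain k where "x \<in> C k" using AB_door x by blast
    then obtain d where d: "path_in (C k) d (c k) x"
      using door_connected[of k] c[of k] unfolding path_connected_def path_in_def by blast
    have "\<Phi> d \<in> N" using \<Phi>_A[OF path_in_mono[OF d subsets(3)]] one by simp
    then show ?thesis using quot[OF path_in_mono[OF d subsets(4)]] base by blast
  next
    case False
    then show ?thesis using \<Phi>_pathB_outside[OF x] one by simp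
  qed
  have B: "\<Phi> g \<in> N" if g: "path_in B g x y" for g x y
  proof -
    have xy: "x \<in> B" "y \<in> B" using path_in_subset[OF g] by auto
    have "\<Phi> g = inv\<^bsub>G\<^esub> \<Phi> (pathB x) \<otimes>\<^bsub>G\<^esub> \<Phi> (pathB y)"
      using cl[OF pathB[OF xy(1)]] cl[OF g] by (simp add: \<Phi>_B[OF g] m_assoc[symmetric])
    then show ?thesis
      using \<theta> xy subgroup.m_closed[OF N] subgroup.m_inv_closed[OF N] by metis
  qed
  have "\<Phi> g \<in> N" if g: "path_in U g x y" for g x y
  proof (rule based_class_in_subgroup[OF N _ g])
    fix z assume "z \<in> U"
    then consider "z \<in> A" | "z \<in> B" using AB by blast
    then show "\<exists>T. openin (top_of_set U) T \<and> z \<in> T \<and> (\<forall>g y z. path_in T g y z \<longrightarrow> \<Phi> g \<in> N)"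
    proof cases
      case 1
      then show ?thesis using open_A \<Phi>_A one by metis
    next
      case 2
      then show ?thesis using open_B B by metis
    qed
  qed
  note all = this
  show ?thesis
  proof
    fix x assume "x \<in> carrier G"
    then obtain g where g: "g \<in> loops_at U p" "x = loop_class U g"
      by (auto simp: carrier_fundamental_group)
    note gU = g(1)[folded path_in_loops_at]
    have "\<Phi> g = x" using \<Phi>_loop[OF gU] g(2) by simp
    then show "x \<in> N" using all[OF gU] by simp
  qed
qed

theorem free_basis_door_tree: "free_basis G (\<lambda>i. loop_class U (\<gamma> i))"
proof -
  have r: "range (\<lambda>i. loop_class U (\<gamma> i)) \<subseteq> carrier G"
    using \<gamma>_loop by (auto simp: carrier_fundamental_group)
  show ?thesis
    unfolding free_basis_def bij_betw_def
    using is_group r inj_word_value word_value_surj[OF r generates] by blast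
qed

end

section \<open>Parametrisation of the fibres\<close>

lemma powi_eq_minus_one_iff:
  fixes t :: complex
  shows "t powi a = -1 \<longleftrightarrow> t ^ nat \<bar>a\<bar> = -1"
proof (cases "a \<ge> 0")
  case False
  then have "t powi a = inverse (t ^ nat \<bar>a\<bar>)"
    by (simp add: power_int_def power_inverse)
  moreover have "inverse x = -1 \<longleftrightarrow> x = -1" for x :: complex
    by (metis inverse_inverse_eq inverse_minus_eq inverse_1)
  ultimately show ?thesis by simp
qed (simp add: power_int_def)

lemma circle_roots:
  assumes "a \<noteq> 0"
  shows "{t \<in> unit_circle. t powi a = -1} = {t. t ^ nat \<bar>a\<bar> = -1}"
    and "finite {t \<in> unit_circle. t powi a = -1}"
    and "card {t \<in> unit_circle. t powi a = -1} = nat \<bar>a\<bar>"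
proof -
  have n: "nat \<bar>a\<bar> > 0" using assms by simp
  have "cmod t = 1" if "t ^ nat \<bar>a\<bar> = -1" for t
  proof -
    have "cmod t ^ nat \<bar>a\<bar> = 1" using that by (metis norm_minus_cancel norm_one norm_power)
    then show ?thesis using n power_eq_1_iff[of "cmod t" "nat \<bar>a\<bar>"] by (simp add: power_eq_1_iff)
  qed
  then show eq: "{t \<in> unit_circle. t powi a = -1} = {t. t ^ nat \<bar>a\<bar> = -1}"
    by (auto simp: powi_eq_minus_one_iff)
  show "finite {t \<in> unit_circle. t powi a = -1}"
    unfolding eq using finite_nth_roots[OF n, of "-1"] by simp
  show "card {t \<in> unit_circle. t powi a = -1} = nat \<bar>a\<bar>"
    unfolding eq using card_nth_roots[of "-1" "nat \<bar>a\<bar>"] n by simp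
qed

text \<open>By Bezout the power with exponent \<open>gcd a b\<close> is a product of powers of
  -1.\<close>

lemma common_root_gcd:
  fixes t :: complex
  assumes "t powi a = -1" "t powi b = -1"
  shows "t powi gcd a b = 1 \<or> t powi gcd a b = -1"
proof -
  obtain x y where xy: "x * a + y * b = gcd a b"
    using bezout_int by blast
  have "t powi (x * a + y * b) = (t powi a) powi x * (t powi b) powi y"
  proof (cases "t = 0")
    case True
    then have "a = 0" using assms(1) by (auto simp: power_int_0_left_if split: if_splits)
    then show ?thesis using assms(1) by simp
  next
    case False
    then show ?thesis by (simp add: power_int_add power_int_mult mult.commute)
  qed
  also have "\<dots> = 1 \<or> \<dots> = -1"
    unfolding assms by (auto simp: power_int_minus_left)
  finally show ?thesis using xy by simp
qed

text \<open>After division by the gcd the cofactors are coprime, so at most one is even; the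
  valuations agree exactly when neither is.\<close>

lemma multiplicity_two_eq_iff:
  fixes a b :: int
  assumes "a \<noteq> 0" "b \<noteq> 0"
  shows "multiplicity 2 a = multiplicity 2 b \<longleftrightarrow> odd (a div gcd a b) \<and> odd (b div gcd a b)"
proof -
  let ?d = "gcd a b"
  have d: "?d \<noteq> 0" using assms by simp
  have p: "prime_elem (2::int)" by simp
  have nz: "a div ?d \<noteq> 0" "b div ?d \<noteq> 0" using assms by (auto simp: dvd_div_eq_0_iff)
  have a: "multiplicity 2 a = multiplicity 2 ?d + multiplicity 2 (a div ?d)"
    using prime_elem_multiplicity_mult_distrib[OF p d nz(1)] by simp
  have b: "multiplicity 2 b = multiplicity 2 ?d + multiplicity 2 (b div ?d)"
    using prime_elem_multiplicity_mult_distrib[OF p d nz(2)] by simp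
  have "coprime (a div ?d) (b div ?d)" using assms by (intro div_gcd_coprime) auto
  then have "odd (a div ?d) \<or> odd (b div ?d)"
    using coprime_common_divisor[of "a div ?d" "b div ?d" 2] by auto
  moreover have "multiplicity 2 (a div ?d) = 0 \<longleftrightarrow> odd (a div ?d)" "multiplicity 2 (b div ?d) = 0 \<longleftrightarrow> odd (b div ?d)"
    using nz by (simp_all add: multiplicity_eq_zero_iff)
  ultimately show ?thesis
    unfolding a b by auto
qed

text \<open>At a common root the power with exponent \<open>gcd a b\<close> is 1 or -1. The value 1
  is excluded, and -1 raised to both cofactors gives -1 only if both are odd.\<close>

lemma common_roots:
  assumes ab: "a \<noteq> 0" "b \<noteq> 0"
  shows "{t \<in> unit_circle. t powi a = -1} \<inter> {t \<in> unit_circle. t powi b = -1} =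
    (if multiplicity 2 a = multiplicity 2 b then {t \<in> unit_circle. t powi gcd a b = -1} else {})"
proof -
  let ?d = "gcd a b"
  have pa: "t powi a = (t powi ?d) powi (a div ?d)" and pb: "t powi b = (t powi ?d) powi (b div ?d)" for t :: complex
    by (simp_all flip: power_int_mult)
  have sgn: "(-1 :: complex) powi k = (if even k then 1 else -1)" for k
    by (simp add: power_int_minus_left)
  have "t powi ?d = -1 \<and> odd (a div ?d) \<and> odd (b div ?d)"
    if t: "t powi a = -1" "t powi b = -1" for t :: complex
  proof -
    have "t powi ?d = -1"
      using common_root_gcd[OF t] t(1) unfolding pa by auto
    then show ?thesis using t unfolding pa pb by (auto simp: sgn split: if_splits)
  qed
  moreover have "t powi a = -1 \<and> t powi b = -1"
    if t: "t powi ?d = -1" "odd (a div ?d)" "odd (b div ?d)" for t :: complex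
    unfolding pa pb using t by (simp add: sgn)
  ultimately show ?thesis
    unfolding multiplicity_two_eq_iff[OF ab] by auto
qed

text \<open>The modulus of \<open>x\<close> forced by |x|^2 - |x'|^2 = u and |x| |x'| = |c|:
  eliminating |x'| makes |x|^2 the nonnegative root of s^2 - u s - |c|^2. The modulus of
  \<open>x'\<close> is the same expression with \<open>- u\<close>.\<close>

definition section_radius :: "real \<Rightarrow> complex \<Rightarrow> real" where
  "section_radius u c = sqrt ((u + sqrt (u\<^sup>2 + 4 * (cmod c)\<^sup>2)) / 2)"

text \<open>The branch keeps the denominator away from \<open>0\<close> except at \<open>u = 0\<close>, \<open>c = 0\<close>, where the quotient
  has the junk value \<open>0\<close>, which is also its limit.\<close>

definition circle_section :: "real \<Rightarrow> complex \<Rightarrow> complex \<times> complex" where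
  "circle_section u c =
     (if 0 \<le> u then (of_real (section_radius u c), c / of_real (section_radius u c))
      else (c / of_real (section_radius (- u) c), of_real (section_radius (- u) c)))"

lemma section_radius:
  shows "0 \<le> section_radius u c" "(section_radius u c)\<^sup>2 - (section_radius (- u) c)\<^sup>2 = u"
    "section_radius u c * section_radius (- u) c = cmod c"
    "0 \<le> u \<Longrightarrow> section_radius u c = 0 \<longleftrightarrow> u = 0 \<and> c = 0"
proof -
  define D where "D = sqrt (u\<^sup>2 + 4 * (cmod c)\<^sup>2)"
  have D: "\<bar>u\<bar> \<le> D" unfolding D_def by (rule real_le_rsqrt) simp
  have D2: "D\<^sup>2 = u\<^sup>2 + 4 * (cmod c)\<^sup>2" unfolding D_def by simp
  have R: "section_radius u c = sqrt ((u + D) / 2)" "section_radius (- u) c = sqrt ((- u + D) / 2)"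
    by (simp_all add: section_radius_def D_def)
  show p: "0 \<le> section_radius u c" using D unfolding R by auto
  have p': "0 \<le> section_radius (- u) c" using D unfolding R by auto
  have R2: "(section_radius u c)\<^sup>2 = (u + D) / 2" "(section_radius (- u) c)\<^sup>2 = (- u + D) / 2"
    using D unfolding R by auto
  show "(section_radius u c)\<^sup>2 - (section_radius (- u) c)\<^sup>2 = u" unfolding R2 by (simp add: field_simps)
  have "(section_radius u c * section_radius (- u) c)\<^sup>2 = (D\<^sup>2 - u\<^sup>2) / 4"
    unfolding power_mult_distrib R2 by (simp add: field_simps power2_eq_square)
  also have "\<dots> = (cmod c)\<^sup>2" unfolding D2 by simp
  finally show "section_radius u c * section_radius (- u) c = cmod c"
    by (rule power2_eq_imp_eq) (use p p' in auto)
  show "section_radius u c = 0 \<longleftrightarrow> u = 0 \<and> c = 0" if "0 \<le> u"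
  proof
    assume "section_radius u c = 0"
    then have "u + D = 0" using R2 by simp
    then have "u = 0" "D = 0" using D that by auto
    then show "u = 0 \<and> c = 0" using D2 by simp
  qed (simp add: section_radius_def)
qed

lemma circle_section:
  assumes "circle_section u c = (x, x')"
  shows "x * x' = c" "(cmod x)\<^sup>2 - (cmod x')\<^sup>2 = u" "x = 0 \<and> x' = 0 \<longleftrightarrow> u = 0 \<and> c = 0"
proof -
  define R where "R = section_radius u c"
  define R' where "R' = section_radius (- u) c"
  have r: "0 \<le> R" "0 \<le> R'" "R\<^sup>2 - R'\<^sup>2 = u" "R * R' = cmod c"
      "0 \<le> u \<Longrightarrow> R = 0 \<longleftrightarrow> u = 0 \<and> c = 0" "0 \<le> - u \<Longrightarrow> R' = 0 \<longleftrightarrow> u = 0 \<and> c = 0"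
    using section_radius[of u c] section_radius[of "- u" c] by (simp_all add: R_def R'_def)
  have e: "(x, x') = (if 0 \<le> u then (of_real R, c / of_real R) else (c / of_real R', of_real R'))"
    using assms unfolding circle_section_def R_def R'_def by simp
  have "x * x' = c \<and> cmod x = R \<and> cmod x' = R'"
  proof (cases "0 \<le> u")
    case True
    show ?thesis
    proof (cases "R = 0")
      case True
      then have "u = 0" "c = 0" using r(5) \<open>0 \<le> u\<close> by auto
      then show ?thesis using e True r(3) by simp
    next
      case False
      have "R' = cmod c / R" using False r(4) by (simp add: field_simps)
      then show ?thesis using e True False r(1) by (simp add: norm_divide)
    qed
  next
    case False
    then have "R' \<noteq> 0" using r(6) by auto
    moreover have "R = cmod c / R'" using \<open>R' \<noteq> 0\<close> r(4) by (simp add: field_simps)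
    ultimately show ?thesis using e False r(2) by (simp add: norm_divide)
  qed
  note m = this
  then show "x * x' = c" "(cmod x)\<^sup>2 - (cmod x')\<^sup>2 = u" using r by auto
  show "x = 0 \<and> x' = 0 \<longleftrightarrow> u = 0 \<and> c = 0"
  proof
    assume "x = 0 \<and> x' = 0"
    then show "u = 0 \<and> c = 0" using m r(3) by auto
  next
    assume "u = 0 \<and> c = 0"
    then show "x = 0 \<and> x' = 0" using e r(5) by auto
  qed
qed

lemma continuous_on_section_radius: "continuous_on UNIV (section_radius u)"
  unfolding section_radius_def by (auto intro!: continuous_intros)

lemma continuous_on_circle_section: "continuous_on UNIV (circle_section u)"
proof (cases "0 \<le> u")
  case True
  let ?R = "section_radius u" and ?R' = "section_radius (- u)"
  have "continuous_on UNIV (\<lambda>c. c / of_real (?R c))"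
    unfolding continuous_on
  proof
    fix c :: complex
    have Rc: "(?R \<longlongrightarrow> ?R c) (at c)" "(?R' \<longlongrightarrow> ?R' c) (at c)"
      using continuous_on_section_radius by (auto simp: continuous_on)
    show "((\<lambda>c. c / of_real (?R c)) \<longlongrightarrow> c / of_real (?R c)) (at c)"
    proof (cases "?R c = 0")
      case False
      then show ?thesis using Rc by (intro tendsto_intros) auto
    next
      case True
      then have uc: "u = 0" "c = 0" using section_radius(4)[of u c] \<open>0 \<le> u\<close> by auto
      \<comment> \<open>The quotient is bounded by the radius for \<open>- u\<close>, which tends to
        0 at this degenerate point.\<close>
      have "cmod (d / of_real (?R d)) \<le> ?R' d" for d
      proof (cases "?R d = 0")
        case False
        have "cmod (d / of_real (?R d)) = cmod d / ?R d"
          using section_radius(1)[of u d] by (simp add: norm_divide)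
        also have "\<dots> = ?R' d"
          unfolding section_radius(3)[of u d, symmetric] using False by simp
        finally show ?thesis by simp
      next
        case True
        then show ?thesis using section_radius(1)[of "- u" d] by simp
      qed
      then have "\<forall>\<^sub>F d in at c. cmod (d / of_real (?R d)) \<le> ?R' d"
        by (intro always_eventually allI)
      moreover have "?R' c = 0" by (simp add: uc section_radius_def)
      then have "(?R' \<longlongrightarrow> 0) (at c)" using Rc(2) by (simp only:)
      ultimately have "((\<lambda>c. c / of_real (?R c)) \<longlongrightarrow> 0) (at c)"
        by (rule Lim_null_comparison)
      moreover have "c / of_real (?R c) = 0" by (simp add: uc(2))
      ultimately show ?thesis by (simp only:)
    qed
  qed
  then have "continuous_on UNIV (\<lambda>c. (complex_of_real (?R c), c / of_real (?R c)))"
    by (rule continuous_on_Pair[OF continuous_on_of_real[OF continuous_on_section_radius]])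
  then show ?thesis
    using True by (simp add: circle_section_def[abs_def])
next
  case False
  then have "section_radius (- u) c \<noteq> 0" for c
    using section_radius(4)[of "- u" c] by auto
  then have "continuous_on UNIV (\<lambda>c. (c / of_real (section_radius (- u) c), complex_of_real (section_radius (- u) c)))"
    by (intro continuous_intros continuous_on_section_radius) auto
  then show ?thesis
    using False by (simp add: circle_section_def[abs_def])
qed

text \<open>The product of the moduli and the difference of their squares determine the sum of the
  squares, hence both moduli. The rotation is then \<open>x / y\<close>, or the conjugate of
  \<open>x' / y'\<close> if \<open>y\<close> is 0; if both vanish, 1 will do.\<close>

lemma circle_orbit_transitive:
  fixes x x' y y' :: complex
  assumes "x * x' = y * y'" "(cmod x)\<^sup>2 - (cmod x')\<^sup>2 = (cmod y)\<^sup>2 - (cmod y')\<^sup>2"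
  shows "\<exists>r\<in>unit_circle. x = r * y \<and> x' = cnj r * y'"
proof -
  have m: "cmod x * cmod x' = cmod y * cmod y'" using arg_cong[OF assms(1), of cmod] by (simp add: norm_mult)
  have "((cmod x)\<^sup>2 + (cmod x')\<^sup>2)\<^sup>2 = ((cmod x)\<^sup>2 - (cmod x')\<^sup>2)\<^sup>2 + 4 * (cmod x * cmod x')\<^sup>2"
    by (simp add: power2_eq_square algebra_simps)
  also have "\<dots> = ((cmod y)\<^sup>2 + (cmod y')\<^sup>2)\<^sup>2"
    unfolding assms(2) m by (simp add: power2_eq_square algebra_simps)
  finally have "(cmod x)\<^sup>2 + (cmod x')\<^sup>2 = (cmod y)\<^sup>2 + (cmod y')\<^sup>2"
    by (rule power2_eq_imp_eq) auto
  then have "(cmod x)\<^sup>2 = (cmod y)\<^sup>2" "(cmod x')\<^sup>2 = (cmod y')\<^sup>2"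
    using assms(2) by linarith+
  then have n: "cmod x = cmod y" "cmod x' = cmod y'"
    by (auto intro: power2_eq_imp_eq)
  have inv: "cnj r = inverse r" if "cmod r = 1" for r
    using complex_norm_square[of r] that by (metis inverse_unique of_real_1 one_power2)
  show ?thesis
  proof (cases "y = 0")
    case False
    let ?r = "x / y"
    have r: "cmod ?r = 1" using False n by (simp add: norm_divide)
    have "x \<noteq> 0" using False n by auto
    then have "x' = inverse ?r * y'" using assms(1) False by (simp add: field_simps)
    then show ?thesis using r False inv[OF r] by (intro bexI[of _ ?r]) auto
  next
    case True
    show ?thesis
    proof (cases "y' = 0")
      case False
      then show ?thesis using True n by (intro bexI[of _ "cnj (x' / y')"]) (auto simp: norm_divide)
    qed (use True n in \<open>auto intro!: bexI[of _ 1] exI[of _ 1]\<close>)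
  qed
qed

definition fibre_param :: "int \<Rightarrow> int \<Rightarrow> real3 \<Rightarrow> complex \<times> complex \<times> complex \<Rightarrow> complex5" where
  "fibre_param a b = (\<lambda>(u, v, w) (r, s, t).
     let z = of_real (exp w) * t; (x, x') = circle_section u (z powi a + 1); (y, y') = circle_section v (z powi b + 1)
     in (r * x, cnj r * x', s * y, cnj s * y', z))"

lemma h_fibre_iff:
  "(x, x', y, y', z) \<in> h_fibre a b (u, v, w) \<longleftrightarrow>
     x * x' = z powi a + 1 \<and> y * y' = z powi b + 1 \<and>
     (cmod x)\<^sup>2 - (cmod x')\<^sup>2 = u \<and> (cmod y)\<^sup>2 - (cmod y')\<^sup>2 = v \<and> cmod z = exp w"
  by (auto simp: fibre_over_def X_ab_def h_map_def)

lemma fibre_param_eq: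
  assumes "circle_section u ((of_real (exp w) * t) powi a + 1) = (x, x')"
    and "circle_section v ((of_real (exp w) * t) powi b + 1) = (y, y')"
  shows "fibre_param a b (u, v, w) (r, s, t) = (r * x, cnj r * x', s * y, cnj s * y', of_real (exp w) * t)"
  using assms by (simp add: fibre_param_def Let_def)

lemma unit_circle_mult_cnj: "r \<in> unit_circle \<Longrightarrow> r * cnj r = 1"
  using complex_norm_square[of r] by simp

lemma fibre_param_image: "fibre_param a b (u, v, w) ` torus3 = h_fibre a b (u, v, w)"
proof (intro equalityI subsetI)
  fix q assume "q \<in> fibre_param a b (u, v, w) ` torus3"
  then obtain r s t where rst: "r \<in> unit_circle" "s \<in> unit_circle" "t \<in> unit_circle"
    and q: "q = fibre_param a b (u, v, w) (r, s, t)"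
    by (auto simp: torus3_def)
  obtain x x' where x: "circle_section u ((of_real (exp w) * t) powi a + 1) = (x, x')" by fastforce
  obtain y y' where y: "circle_section v ((of_real (exp w) * t) powi b + 1) = (y, y')" by fastforce
  have "(r * x) * (cnj r * x') = (r * cnj r) * (x * x')" "(s * y) * (cnj s * y') = (s * cnj s) * (y * y')"
    by (simp_all only: mult_ac)
  then have "(r * x) * (cnj r * x') = x * x'" "(s * y) * (cnj s * y') = y * y'"
    using unit_circle_mult_cnj[OF rst(1)] unit_circle_mult_cnj[OF rst(2)] by simp_all
  then show "q \<in> h_fibre a b (u, v, w)"
    unfolding q fibre_param_eq[OF x y] h_fibre_iff
    using rst circle_section[OF x] circle_section[OF y]
    by (simp add: norm_mult)
next
  fix q assume q: "q \<in> h_fibre a b (u, v, w)"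
  obtain x x' y y' z where qe: "q = (x, x', y, y', z)" by (metis prod_cases5)
  note f = q[unfolded qe h_fibre_iff]
  define t where "t = z / of_real (exp w)"
  have z: "z = of_real (exp w) * t" by (simp add: t_def)
  have t: "t \<in> unit_circle" using f by (simp add: t_def norm_divide)
  obtain X X' where X: "circle_section u ((of_real (exp w) * t) powi a + 1) = (X, X')" by fastforce
  obtain Y Y' where Y: "circle_section v ((of_real (exp w) * t) powi b + 1) = (Y, Y')" by fastforce
  obtain r where r: "r \<in> unit_circle" "x = r * X" "x' = cnj r * X'"
    using circle_orbit_transitive[of x x' X X'] circle_section[OF X] f unfolding z by metis
  obtain s where s: "s \<in> unit_circle" "y = s * Y" "y' = cnj s * Y'"
    using circle_orbit_transitive[of y y' Y Y'] circle_section[OF Y] f unfolding z by metis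
  have "q = fibre_param a b (u, v, w) (r, s, t)"
    unfolding fibre_param_eq[OF X Y] qe using r s z by simp
  moreover have "(r, s, t) \<in> torus3" using r s t by (simp add: torus3_def)
  ultimately show "q \<in> fibre_param a b (u, v, w) ` torus3" by blast
qed

lemma continuous_on_fibre_param: "continuous_on torus3 (fibre_param a b (u, v, w))"
proof -
  have sec: "continuous_on torus3 (\<lambda>p. circle_section u ((of_real (exp w) * snd (snd p)) powi k + 1))" for u k
    by (intro continuous_on_compose2[OF continuous_on_circle_section] continuous_intros) (auto simp: torus3_def)
  have "fibre_param a b (u, v, w) = (\<lambda>p.
     (fst p * fst (circle_section u ((of_real (exp w) * snd (snd p)) powi a + 1)),
      cnj (fst p) * snd (circle_section u ((of_real (exp w) * snd (snd p)) powi a + 1)),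
      fst (snd p) * fst (circle_section v ((of_real (exp w) * snd (snd p)) powi b + 1)),
      cnj (fst (snd p)) * snd (circle_section v ((of_real (exp w) * snd (snd p)) powi b + 1)),
      of_real (exp w) * snd (snd p)))"
    by (auto simp: fibre_param_def Let_def case_prod_unfold fun_eq_iff)
  moreover have "continuous_on torus3 \<dots>"
    by (intro continuous_intros continuous_on_fst[OF sec] continuous_on_snd[OF sec])
  ultimately show ?thesis by simp
qed

lemma compact_torus3: "compact torus3"
  unfolding torus3_def by (intro compact_Times compact_sphere)

lemma unit_circle_cancel:
  assumes "r * x = r' * x" "cnj r * x' = cnj r' * x'" "\<not> (x = 0 \<and> x' = 0)"
  shows "r = r'"
  using assms by (metis complex_cnj_cancel_iff mult_right_cancel)

text \<open>By the last part of \<open>circle_section\<close>, the parameters \<open>t\<close> at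
  which the orbit circle shrinks to the point (0, 0).\<close>

definition collapse_set :: "int \<Rightarrow> real \<Rightarrow> real \<Rightarrow> complex set" where
  "collapse_set a u w = {t \<in> unit_circle. u = 0 \<and> (of_real (exp w) * t) powi a = -1}"

lemma fibre_param_eq_iff:
  assumes "(r, s, t) \<in> torus3" "(r', s', t') \<in> torus3"
  shows "fibre_param a b (u, v, w) (r, s, t) = fibre_param a b (u, v, w) (r', s', t') \<longleftrightarrow>
    t = t' \<and> (r = r' \<or> t \<in> collapse_set a u w) \<and> (s = s' \<or> t \<in> collapse_set b v w)"
proof -
  obtain x x' where x: "circle_section u ((of_real (exp w) * t) powi a + 1) = (x, x')" by fastforce
  obtain y y' where y: "circle_section v ((of_real (exp w) * t) powi b + 1) = (y, y')" by fastforce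
  have A: "t \<in> collapse_set a u w \<longleftrightarrow> x = 0 \<and> x' = 0"
    using circle_section(3)[OF x] assms(1) by (auto simp: collapse_set_def torus3_def eq_neg_iff_add_eq_0)
  have B: "t \<in> collapse_set b v w \<longleftrightarrow> y = 0 \<and> y' = 0"
    using circle_section(3)[OF y] assms(1) by (auto simp: collapse_set_def torus3_def eq_neg_iff_add_eq_0)
  show ?thesis
  proof (cases "t = t'")
    case True
    show ?thesis
      unfolding True[symmetric] fibre_param_eq[OF x y] A B prod.inject
      using unit_circle_cancel[of r x r' x'] unit_circle_cancel[of s y s' y'] by auto
  next
    case False
    then show ?thesis
      by (auto simp: fibre_param_def Let_def case_prod_unfold)
  qed
qed

text \<open>A continuous surjection from a compact space onto a Hausdorff space is a quotient map,
  so only the identifications made by \<open>fibre_param\<close> have to be known.\<close>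

lemma torus3_contracted_h_fibre:
  "torus3_contracted (collapse_set a u w) (collapse_set b v w) (h_fibre a b (u, v, w))"
  unfolding torus3_contracted_def
proof (intro exI conjI allI impI)
  have "continuous_map (top_of_set torus3) (top_of_set (h_fibre a b (u, v, w))) (fibre_param a b (u, v, w))"
    using continuous_on_fibre_param fibre_param_image
    by (simp add: continuous_map_in_subtopology flip: image_subset_iff_funcset)
  then show "quotient_map (top_of_set torus3) (top_of_set (h_fibre a b (u, v, w))) (fibre_param a b (u, v, w))"
    by (rule continuous_imp_quotient_map)
       (simp_all add: compact_space_subtopology compact_torus3 Hausdorff_space_subtopology fibre_param_image)
qed (rule fibre_param_eq_iff)

text \<open>The modulus of \<open>z powi a\<close> is \<open>exp (a * w)\<close>, which is 1 only
  for \<open>w = 0\<close>.\<close>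

lemma collapse_set_empty: "a \<noteq> 0 \<Longrightarrow> u \<noteq> 0 \<or> w \<noteq> 0 \<Longrightarrow> collapse_set a u w = {}"
proof (rule ccontr)
  assume a: "a \<noteq> 0" "u \<noteq> 0 \<or> w \<noteq> 0" and "collapse_set a u w \<noteq> {}"
  then obtain t where t: "cmod t = 1" "u = 0" "(of_real (exp w) * t) powi a = -1"
    by (auto simp: collapse_set_def)
  have "exp w powi a = 1"
    using arg_cong[OF t(3), of cmod] t(1) by (simp add: norm_power_int norm_mult)
  then have "exp (of_int a * w) = 1" by (simp add: exp_power_int)
  then show False using a t(2) by simp
qed

lemma collapse_set_zero: "collapse_set a 0 0 = {t \<in> unit_circle. t powi a = -1}"
  by (simp add: collapse_set_def)

lemma h_fibre_homeomorphic_torus3: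
  assumes "a \<noteq> 0" "b \<noteq> 0" "p \<in> U_base"
  shows "h_fibre a b p homeomorphic torus3"
proof -
  obtain u v w where p: "p = (u, v, w)" by (cases p)
  have e: "collapse_set a u w = {}" "collapse_set b v w = {}"
    using assms p by (auto simp: U_base_def intro!: collapse_set_empty)
  have "inj_on (fibre_param a b (u, v, w)) torus3"
  proof (rule inj_onI)
    fix x y assume "x \<in> torus3" "y \<in> torus3" "fibre_param a b (u, v, w) x = fibre_param a b (u, v, w) y"
    then show "x = y"
      using fibre_param_eq_iff[of "fst x" "fst (snd x)" "snd (snd x)" "fst y" "fst (snd y)" "snd (snd y)"] e
      by (auto simp: prod_eq_iff)
  qed
  then show ?thesis
    using homeomorphic_compact[OF compact_torus3 continuous_on_fibre_param fibre_param_image] homeomorphic_sym p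
    by blast
qed

lemma collapsed_torus3_h_fibres:
  assumes ab: "a \<noteq> 0" "b \<noteq> 0"
  shows "u \<noteq> 0 \<Longrightarrow> collapsed_torus3 (nat \<bar>b\<bar>) 0 (h_fibre a b (u, 0, 0))"
    and "v \<noteq> 0 \<Longrightarrow> collapsed_torus3 (nat \<bar>a\<bar>) 0 (h_fibre a b (0, v, 0))"
    and "multiplicity 2 a \<noteq> multiplicity 2 b \<Longrightarrow>
      collapsed_torus3 (nat \<bar>a\<bar> + nat \<bar>b\<bar>) 0 (h_fibre a b (0, 0, 0))"
    and "multiplicity 2 a = multiplicity 2 b \<Longrightarrow>
      collapsed_torus3 (nat \<bar>a\<bar> + nat \<bar>b\<bar> - nat (gcd a b)) (nat (gcd a b)) (h_fibre a b (0, 0, 0))"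
proof -
  note fa = circle_roots(2,3)[OF ab(1)] and fb = circle_roots(2,3)[OF ab(2)]
  let ?A = "collapse_set a 0 0" and ?B = "collapse_set b 0 0"
  have sub: "collapse_set k u w \<subseteq> unit_circle" for k u w by (auto simp: collapse_set_def)
  show "collapsed_torus3 (nat \<bar>b\<bar>) 0 (h_fibre a b (u, 0, 0))" if u: "u \<noteq> 0"
    unfolding collapsed_torus3_def
  proof (rule exI[of _ "{}"], rule exI[of _ ?B], intro conjI)
    show "finite ?B" "card ({} \<union> ?B) = nat \<bar>b\<bar>" using fb by (simp_all add: collapse_set_zero)
    show "torus3_contracted {} ?B (h_fibre a b (u, 0, 0))"
      using torus3_contracted_h_fibre[of a u 0 b 0] collapse_set_empty[OF ab(1), of u 0] u by simp
  qed (use sub in auto)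
  show "collapsed_torus3 (nat \<bar>a\<bar>) 0 (h_fibre a b (0, v, 0))" if v: "v \<noteq> 0"
    unfolding collapsed_torus3_def
  proof (rule exI[of _ ?A], rule exI[of _ "{}"], intro conjI)
    show "finite ?A" "card (?A \<union> {}) = nat \<bar>a\<bar>" using fa by (simp_all add: collapse_set_zero)
    show "torus3_contracted ?A {} (h_fibre a b (0, v, 0))"
      using torus3_contracted_h_fibre[of a 0 0 b v] collapse_set_empty[OF ab(2), of v 0] v by simp
  qed (use sub in auto)
  \<comment> \<open>Inclusion and exclusion: the common roots lie in both sets, whereas
    \<open>collapsed_torus3\<close> counts each two-torus once in \<open>m\<close>.\<close>
  have un: "card (?A \<union> ?B) + card (?A \<inter> ?B) = nat \<bar>a\<bar> + nat \<bar>b\<bar>"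
    using card_Un_Int[OF fa(1) fb(1)] fa(2) fb(2) by (simp add: collapse_set_zero)
  have gen: "collapsed_torus3 (nat \<bar>a\<bar> + nat \<bar>b\<bar> - n) n (h_fibre a b (0, 0, 0))" if "card (?A \<inter> ?B) = n" for n
    unfolding collapsed_torus3_def
  proof (rule exI[of _ ?A], rule exI[of _ ?B], intro conjI)
    show "finite ?A" "finite ?B" unfolding collapse_set_zero by (fact fa(1) fb(1))+
    show "card (?A \<union> ?B) = nat \<bar>a\<bar> + nat \<bar>b\<bar> - n" using un that by linarith
  qed (fact sub that torus3_contracted_h_fibre)+
  show "collapsed_torus3 (nat \<bar>a\<bar> + nat \<bar>b\<bar>) 0 (h_fibre a b (0, 0, 0))"
    if "multiplicity 2 a \<noteq> multiplicity 2 b"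
    using gen[of 0] common_roots[OF ab] that by (simp add: collapse_set_zero)
  show "collapsed_torus3 (nat \<bar>a\<bar> + nat \<bar>b\<bar> - nat (gcd a b)) (nat (gcd a b)) (h_fibre a b (0, 0, 0))"
    if m: "multiplicity 2 a = multiplicity 2 b"
  proof (rule gen)
    have "gcd a b \<noteq> 0" using ab by simp
    from circle_roots(3)[OF this] show "card (?A \<inter> ?B) = nat (gcd a b)"
      unfolding collapse_set_zero common_roots[OF ab] using m by simp
  qed
qed

section \<open>The phase coordinate\<close>

text \<open>The floor jumps only where the weight vanishes. Near a zero of the weight it takes at
  most three values, so the factor stays bounded and the product tends to 0.\<close>

lemma continuous_on_floor_switch:
  fixes \<phi> \<tau> :: "'a::topological_space \<Rightarrow> real" and h :: "int \<Rightarrow> 'a \<Rightarrow> 'b::real_normed_vector"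
  assumes \<phi>: "continuous_on S \<phi>" and \<tau>: "continuous_on S \<tau>" and h: "\<And>k. continuous_on S (h k)"
    and zero: "\<And>y. y \<in> S \<Longrightarrow> \<tau> y \<in> \<int> \<Longrightarrow> \<phi> y = 0"
  shows "continuous_on S (\<lambda>y. \<phi> y *\<^sub>R h \<lfloor>\<tau> y\<rfloor> y)"
  unfolding continuous_on
proof
  fix y assume y: "y \<in> S"
  define k where "k = \<lfloor>\<tau> y\<rfloor>"
  have \<phi>y: "(\<phi> \<longlongrightarrow> \<phi> y) (at y within S)" and \<tau>y: "(\<tau> \<longlongrightarrow> \<tau> y) (at y within S)"
    and hy: "\<And>k. (h k \<longlongrightarrow> h k y) (at y within S)"
    using \<phi> \<tau> h y by (auto simp: continuous_on)
  show "((\<lambda>y. \<phi> y *\<^sub>R h \<lfloor>\<tau> y\<rfloor> y) \<longlongrightarrow> \<phi> y *\<^sub>R h \<lfloor>\<tau> y\<rfloor> y) (at y within S)"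
  proof (cases "\<phi> y = 0")
    case True
    have "\<forall>\<^sub>F x in at y within S. of_int k - 1 < \<tau> x" "\<forall>\<^sub>F x in at y within S. \<tau> x < of_int k + 2"
      by (rule order_tendstoD[OF \<tau>y]; simp add: k_def; linarith)+
    then have "\<forall>\<^sub>F x in at y within S. \<lfloor>\<tau> x\<rfloor> \<in> {k - 1, k, k + 1}"
    proof eventually_elim
      case (elim x)
      then have "k - 1 \<le> \<lfloor>\<tau> x\<rfloor>" "\<lfloor>\<tau> x\<rfloor> < k + 2" by linarith+
      then show ?case by auto
    qed
    then have "\<forall>\<^sub>F x in at y within S. norm (\<phi> x *\<^sub>R h \<lfloor>\<tau> x\<rfloor> x) \<le>
       \<bar>\<phi> x\<bar> * (norm (h (k - 1) x) + norm (h k x) + norm (h (k + 1) x))"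
      by eventually_elim (auto intro!: mult_left_mono)
    moreover have "((\<lambda>x. \<bar>\<phi> x\<bar> * (norm (h (k - 1) x) + norm (h k x) + norm (h (k + 1) x))) \<longlongrightarrow>
       \<bar>\<phi> y\<bar> * (norm (h (k - 1) y) + norm (h k y) + norm (h (k + 1) y))) (at y within S)"
      by (intro tendsto_intros \<phi>y hy)
    then have "((\<lambda>x. \<bar>\<phi> x\<bar> * (norm (h (k - 1) x) + norm (h k x) + norm (h (k + 1) x))) \<longlongrightarrow> 0) (at y within S)"
      using True by simp
    ultimately have "((\<lambda>y. \<phi> y *\<^sub>R h \<lfloor>\<tau> y\<rfloor> y) \<longlongrightarrow> 0) (at y within S)"
      by (rule Lim_null_comparison)
    then show ?thesis using True by simp
  next
    case False
    then have "\<tau> y \<notin> \<int>" using zero[OF y] by blast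
    then have "\<tau> y \<noteq> of_int k" by auto
    moreover have "of_int k \<le> \<tau> y" "\<tau> y < of_int k + 1"
      unfolding k_def by linarith+
    ultimately have "of_int k < \<tau> y" "\<tau> y < of_int k + 1" by auto
    then have "\<forall>\<^sub>F x in at y within S. of_int k < \<tau> x" "\<forall>\<^sub>F x in at y within S. \<tau> x < of_int k + 1"
      using order_tendstoD[OF \<tau>y] by auto
    then have "\<forall>\<^sub>F x in at y within S. \<phi> x *\<^sub>R h k x = \<phi> x *\<^sub>R h \<lfloor>\<tau> x\<rfloor> x"
    proof eventually_elim
      case (elim x)
      then have "\<lfloor>\<tau> x\<rfloor> = k" by linarith
      then show ?case by simp
    qed
    moreover have "((\<lambda>x. \<phi> x *\<^sub>R h k x) \<longlongrightarrow> \<phi> y *\<^sub>R h k y) (at y within S)"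
      by (intro tendsto_intros \<phi>y hy)
    ultimately show ?thesis
      unfolding k_def[symmetric] by (rule Lim_transform_eventually[rotated])
  qed
qed

text \<open>A coordinate on the circle \<open>x x' = z\<^sup>a + 1\<close>, \<open>|x|\<^sup>2 - |x'|\<^sup>2 = u\<close>, \<open>|z| = e\<^sup>w\<close> that depends
  continuously on the angle \<open>\<theta>\<close> of \<open>(u, \<plusminus>w)\<close> on the universal cover of the punctured plane.  For
  \<open>w \<le> 0 < a\<close> the number \<open>z\<^sup>a + 1\<close> has nonnegative real part, so \<open>x\<close> and \<open>cnj x'\<close> are never opposite;
  for \<open>w \<ge> 0\<close> the same holds for \<open>x\<close> and \<open>z\<^sup>a cnj x'\<close>.  The exponents jump only where the
  corresponding coefficient vanishes, and the coordinate picks up \<open>z\<^sup>a\<close> when \<open>\<theta>\<close> grows by \<open>2\<pi>\<close>.\<close>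

definition phase :: "int \<Rightarrow> real \<Rightarrow> complex \<Rightarrow> complex \<Rightarrow> complex \<Rightarrow> complex" where
  "phase a \<theta> x x' z =
     (1 + cos \<theta>) *\<^sub>R (z powi (a * \<lfloor>(\<theta> + pi) / (2 * pi)\<rfloor>) * x) +
     (1 - cos \<theta>) *\<^sub>R (z powi (a * (\<lfloor>\<theta> / (2 * pi)\<rfloor> + 1)) * cnj x')"

lemma phase_equivariant: "phase a \<theta> (r * x) (cnj r * x') z = r * phase a \<theta> x x' z"
  by (simp add: phase_def algebra_simps)

lemma floor_turns: "\<lfloor>(\<theta> + 2 * pi * of_int n) / (2 * pi)\<rfloor> = \<lfloor>\<theta> / (2 * pi)\<rfloor> + n"
proof -
  have "(\<theta> + 2 * pi * of_int n) / (2 * pi) = \<theta> / (2 * pi) + of_int n"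
    by (simp add: field_simps)
  then show ?thesis by simp
qed

lemma phase_turns:
  assumes "z \<noteq> 0"
  shows "phase a (\<theta> + 2 * pi * of_int n) x x' z = z powi (a * n) * phase a \<theta> x x' z"
proof -
  have c: "cos (\<theta> + 2 * pi * of_int n) = cos \<theta>"
    using cos_int_2pin[of n] sin_int_2pin[of n] by (simp add: cos_add)
  have f: "\<lfloor>(\<theta> + 2 * pi * of_int n + pi) / (2 * pi)\<rfloor> = \<lfloor>(\<theta> + pi) / (2 * pi)\<rfloor> + n"
    using floor_turns[of "\<theta> + pi" n] by (simp add: add_ac)
  show ?thesis
    unfolding phase_def c f floor_turns
    using assms by (simp add: distrib_left power_int_add algebra_simps)
qed

lemma continuous_on_phase:
  fixes \<theta> :: "'a::t2_space \<Rightarrow> real"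
  assumes \<theta>: "continuous_on S \<theta>" and x: "continuous_on S x" "continuous_on S x'"
    and z: "continuous_on S z" "\<And>y. y \<in> S \<Longrightarrow> z y \<noteq> 0"
  shows "continuous_on S (\<lambda>y. phase a (\<theta> y) (x y) (x' y) (z y))"
proof -
  have "1 + cos t = 0" if t: "(t + pi) / (2 * pi) \<in> \<int>" for t
  proof -
    obtain k where "(t + pi) / (2 * pi) = of_int k" using t by (auto elim: Ints_cases)
    then have "t = 2 * pi * of_int k - pi" by (simp add: field_simps)
    then show ?thesis using cos_int_2pin[of k] by (simp add: cos_diff)
  qed
  then have 1: "continuous_on S (\<lambda>y. (1 + cos (\<theta> y)) *\<^sub>R
      (\<lambda>k y. z y powi (a * k) * x y) \<lfloor>(\<theta> y + pi) / (2 * pi)\<rfloor> y)"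
    by (intro continuous_on_floor_switch) (use z in \<open>auto intro!: continuous_intros \<theta> x z(1)\<close>)
  have "1 - cos t = 0" if t: "t / (2 * pi) \<in> \<int>" for t
  proof -
    obtain k where "t / (2 * pi) = of_int k" using t by (auto elim: Ints_cases)
    then have "t = 2 * pi * of_int k" by (simp add: field_simps)
    then show ?thesis using cos_int_2pin[of k] by simp
  qed
  then have 2: "continuous_on S (\<lambda>y. (1 - cos (\<theta> y)) *\<^sub>R
      (\<lambda>k y. z y powi (a * (k + 1)) * cnj (x' y)) \<lfloor>\<theta> y / (2 * pi)\<rfloor> y)"
    by (intro continuous_on_floor_switch) (use z in \<open>auto intro!: continuous_intros \<theta> x z(1)\<close>)
  show ?thesis
    unfolding phase_def using continuous_on_add[OF 1 2] by simp
qed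

text \<open>The sign of \<open>sin \<theta>\<close> fixes the relative exponent of the two terms of
  \<open>phase\<close>: where it is nonnegative the second term carries an additional
  \<open>z powi a\<close>, where it is nonpositive the exponents agree, with either description
  allowed on the boundary.\<close>

lemma floor_angle_cases:
  obtains k :: int where "0 \<le> sin \<theta>" "\<lfloor>(\<theta> + pi) / (2 * pi)\<rfloor> = k" "\<lfloor>\<theta> / (2 * pi)\<rfloor> = k"
  | k :: int where "sin \<theta> \<le> 0" "\<lfloor>(\<theta> + pi) / (2 * pi)\<rfloor> = k" "\<lfloor>\<theta> / (2 * pi)\<rfloor> = k - 1"
proof -
  define k where "k = \<lfloor>\<theta> / (2 * pi)\<rfloor>"
  define t where "t = \<theta> - 2 * pi * of_int k"
  have "of_int k \<le> \<theta> / (2 * pi)" "\<theta> / (2 * pi) < of_int k + 1"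
    unfolding k_def by linarith+
  then have t: "0 \<le> t" "t < 2 * pi" by (simp_all add: t_def field_simps)
  have s: "sin \<theta> = sin t"
    using cos_int_2pin[of k] sin_int_2pin[of k] by (simp add: t_def sin_diff)
  have q: "(\<theta> + pi) / (2 * pi) = (t + pi) / (2 * pi) + of_int k" by (simp add: t_def field_simps)
  show thesis
  proof (cases "t < pi")
    case True
    have "\<lfloor>(t + pi) / (2 * pi)\<rfloor> = 0" using t True by (simp add: floor_eq_iff field_simps)
    then have "\<lfloor>(\<theta> + pi) / (2 * pi)\<rfloor> = k" unfolding q by simp
    moreover have "0 \<le> sin \<theta>" unfolding s using sin_ge_zero[of t] t True by simp
    ultimately show thesis by (rule that(1)[OF _ _ k_def[symmetric], rotated])
  next
    case False
    have "\<lfloor>(t + pi) / (2 * pi)\<rfloor> = 1" using t False by (simp add: floor_eq_iff field_simps)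
    then have "\<lfloor>(\<theta> + pi) / (2 * pi)\<rfloor> = k + 1" unfolding q by simp
    moreover have "sin \<theta> \<le> 0" unfolding s using sin_le_zero[of t] t False by simp
    moreover have "\<lfloor>\<theta> / (2 * pi)\<rfloor> = k + 1 - 1" by (simp add: k_def)
    ultimately show thesis by (intro that(2)[of "k + 1"])
  qed
qed

text \<open>Vanishing leaves two cases. If \<open>cos \<theta>\<close> is -1, then \<open>x'\<close>
  is 0 and \<open>u\<close> is negative, against u = |x|^2. Otherwise \<open>x\<close> and
  \<open>x'\<close> are both 0, so \<open>u\<close> is 0 and \<open>z powi a\<close> is -1; then
  \<open>w\<close> is 0 as well, and the point (u, w) has no angle.\<close>

lemma phase_nonzero:
  assumes a: "a \<noteq> 0" and \<rho>: "0 < \<rho>" and u: "u = \<rho> * cos \<theta>" and w: "sgn (of_int a) * w = \<rho> * sin \<theta>"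
    and x: "x * x' = z powi a + 1" "(cmod x)\<^sup>2 - (cmod x')\<^sup>2 = u" "cmod z = exp w"
  shows "phase a \<theta> x x' z \<noteq> 0"
proof
  assume zero: "phase a \<theta> x x' z = 0"
  have z: "z \<noteq> 0" using x(3) by auto
  have za: "cmod (z powi a) = exp (of_int a * w)"
    using x(3) by (simp add: norm_power_int exp_power_int)
  have aw: "of_int a * w = \<bar>of_int a\<bar> * (\<rho> * sin \<theta>)"
    unfolding w[symmetric] by (simp add: sgn_if abs_if)
  let ?\<alpha> = "1 + cos \<theta>" and ?\<beta> = "1 - cos \<theta>"
  have \<alpha>\<beta>: "0 \<le> ?\<alpha>" "0 \<le> ?\<beta>"
    using cos_ge_minus_one[of \<theta>] cos_le_one[of \<theta>] by linarith+
  \<comment> \<open>Multiplying by \<open>x'\<close> turns the sum into one of two terms with nonnegative real part.\<close>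
  have key: "?\<alpha> * (1 + Re c) = 0 \<and> x' * ?\<beta> = 0 \<and> cmod c \<le> 1 \<and> (c = z powi a \<or> c = inverse (z powi a)) \<and> ?\<alpha> *\<^sub>R x = 0"
    if c: "cmod c \<le> 1" "c = z powi a \<or> c = inverse (z powi a)" and d: "d \<noteq> 0"
      and sum: "?\<alpha> *\<^sub>R x + ?\<beta> *\<^sub>R (d * cnj x') = 0" and xc: "x * x' = d * (1 + c)" for c d
  proof -
    have "0 = x' * (?\<alpha> *\<^sub>R x + ?\<beta> *\<^sub>R (d * cnj x'))" using sum by simp
    also have "\<dots> = ?\<alpha> *\<^sub>R (x * x') + ?\<beta> *\<^sub>R (d * (x' * cnj x'))"
      by (simp add: algebra_simps)
    also have "\<dots> = ?\<alpha> *\<^sub>R (d * (1 + c)) + ?\<beta> *\<^sub>R (d * of_real ((cmod x')\<^sup>2))"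
      unfolding xc complex_norm_square[symmetric] by (simp only: of_real_power)
    also have "\<dots> = d * (?\<alpha> *\<^sub>R (1 + c) + ?\<beta> *\<^sub>R of_real ((cmod x')\<^sup>2))"
      by (simp add: distrib_left)
    finally have "?\<alpha> *\<^sub>R (1 + c) + ?\<beta> *\<^sub>R complex_of_real ((cmod x')\<^sup>2) = 0" using d by simp
    from arg_cong[OF this, of Re] have re: "?\<alpha> * (1 + Re c) + ?\<beta> * (cmod x')\<^sup>2 = 0" by simp
    have "0 \<le> 1 + Re c" using c(1) abs_Re_le_cmod[of c] by linarith
    then have "0 \<le> ?\<alpha> * (1 + Re c)" "0 \<le> ?\<beta> * (cmod x')\<^sup>2" using \<alpha>\<beta> by simp_all
    then have "?\<alpha> * (1 + Re c) = 0" "?\<beta> * (cmod x')\<^sup>2 = 0" using re by linarith+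
    then have "?\<alpha> * (1 + Re c) = 0" "?\<beta> = 0 \<or> x' = 0" by auto
    moreover from this(2) have "?\<beta> *\<^sub>R (d * cnj x') = 0" by auto
    ultimately show ?thesis using sum c by auto
  qed
  obtain c where c: "?\<alpha> * (1 + Re c) = 0" "x' * ?\<beta> = 0" "cmod c \<le> 1" "c = z powi a \<or> c = inverse (z powi a)" "?\<alpha> *\<^sub>R x = 0"
  proof (cases \<theta> rule: floor_angle_cases)
    case (1 k)
    have "phase a \<theta> x x' z = z powi (a * k) * (?\<alpha> *\<^sub>R x + ?\<beta> *\<^sub>R (z powi a * cnj x'))"
      unfolding phase_def 1(2) 1(3) using z by (simp add: distrib_left power_int_add algebra_simps)
    then have sum: "?\<alpha> *\<^sub>R x + ?\<beta> *\<^sub>R (z powi a * cnj x') = 0" using zero z by simp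
    have c: "cmod (inverse (z powi a)) \<le> 1"
      using 1(1) \<rho> by (simp add: norm_inverse za aw inverse_le_1_iff)
    have xc: "x * x' = z powi a * (1 + inverse (z powi a))"
      using z x(1) by (simp add: distrib_left)
    have "z powi a \<noteq> 0" using z by simp
    from key[OF c disjI2[OF refl] this sum xc] show thesis
      by (intro that[of "inverse (z powi a)"]) blast+
  next
    case (2 k)
    have "phase a \<theta> x x' z = z powi (a * k) * (?\<alpha> *\<^sub>R x + ?\<beta> *\<^sub>R (1 * cnj x'))"
      unfolding phase_def 2(2) 2(3) by (simp add: algebra_simps)
    then have sum: "?\<alpha> *\<^sub>R x + ?\<beta> *\<^sub>R (1 * cnj x') = 0" using zero z by simp
    have c: "cmod (z powi a) \<le> 1"
      using 2(1) \<rho> by (simp add: za aw mult_nonneg_nonpos)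
    have xc: "x * x' = 1 * (1 + z powi a)" using x(1) by simp
    from key[OF c disjI1[OF refl] _ sum xc] show thesis
      by (intro that[of "z powi a"]) auto
  qed
  show False
  proof (cases "?\<alpha> = 0")
    case True
    then have "cos \<theta> = -1" by simp
    then have "x' = 0" "u < 0" using c(2) u \<rho> by auto
    then show False using x(2) by (smt (verit) norm_zero power_zero_numeral zero_le_power2)
  next
    case False
    then have "x = 0" "Re c = -1" using c by auto
    then have "0 \<ge> u" using x(2) by (smt (verit) norm_zero power_zero_numeral zero_le_power2)
    then have "?\<beta> \<noteq> 0" using u \<rho> by (auto simp: mult_le_0_iff)
    then have "x' = 0" using c(2) by auto
    then have "u = 0" using x(2) \<open>x = 0\<close> by simp
    then have "cos \<theta> = 0" using u \<rho> by simp
    then have s: "sin \<theta> \<noteq> 0" using sin_cos_squared_add[of \<theta>] by auto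
    have "z powi a = -1" using x(1) \<open>x = 0\<close> by (simp add: add_eq_0_iff2)
    then have "of_int a * w = 0" using za by simp
    then show False using aw a \<rho> s by simp
  qed
qed

text \<open>The reflection for negative \<open>a\<close> gives \<open>sin \<theta>\<close> the sign
  of \<open>a * w\<close>, and this sign decides on which side of 1 the modulus of
  \<open>z powi a\<close> lies.\<close>

definition is_angle :: "int \<Rightarrow> real \<Rightarrow> real \<Rightarrow> real \<Rightarrow> bool" where
  "is_angle a u w \<theta> \<longleftrightarrow> (\<exists>\<rho>>0. u = \<rho> * cos \<theta> \<and> sgn (of_int a) * w = \<rho> * sin \<theta>)"

section \<open>Phases as coordinates on a fibre\<close>

definition phase_map :: "int \<Rightarrow> int \<Rightarrow> real \<Rightarrow> real \<Rightarrow> complex5 \<Rightarrow> complex \<times> complex \<times> complex" where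
  "phase_map a b \<theta> \<theta>' = (\<lambda>(x, x', y, y', z). (sgn (phase a \<theta> x x' z), sgn (phase b \<theta>' y y' z), sgn z))"

lemma is_angle_phase_nonzero:
  assumes "a \<noteq> 0" "is_angle a u w \<theta>" "x * x' = z powi a + 1" "(cmod x)\<^sup>2 - (cmod x')\<^sup>2 = u" "cmod z = exp w"
  shows "phase a \<theta> x x' z \<noteq> 0"
  using assms phase_nonzero unfolding is_angle_def by blast

lemma sgn_unit: "cmod r = 1 \<Longrightarrow> sgn r = r"
  by (simp add: sgn_eq)

text \<open>By equivariance the phase on an orbit is \<open>r\<close> times its value on the
  section. In the parameters (r, s, t) the phase map thus rotates the first two circles by amounts
  depending on \<open>t\<close> alone, which makes it bijective.\<close>

lemma phase_map_fibre_param: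
  assumes ab: "a \<noteq> 0" "b \<noteq> 0" and \<theta>: "is_angle a u w \<theta>" "is_angle b v w \<theta>'"
  shows "\<exists>g g'. (\<forall>t\<in>unit_circle. g t \<in> unit_circle \<and> g' t \<in> unit_circle) \<and>
    (\<forall>r s t. (r, s, t) \<in> torus3 \<longrightarrow> phase_map a b \<theta> \<theta>' (fibre_param a b (u, v, w) (r, s, t)) = (r * g t, s * g' t, t))"
proof -
  define z where "z t = complex_of_real (exp w) * t" for t
  define g where "g t = sgn (phase a \<theta> (fst (circle_section u (z t powi a + 1))) (snd (circle_section u (z t powi a + 1))) (z t))" for t
  define g' where "g' t = sgn (phase b \<theta>' (fst (circle_section v (z t powi b + 1))) (snd (circle_section v (z t powi b + 1))) (z t))" for t
  show ?thesis
  proof (rule exI[of _ g], rule exI[of _ g'], intro conjI ballI allI impI)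
    fix t assume t: "t \<in> unit_circle"
    then have z: "cmod (z t) = exp w" by (simp add: z_def norm_mult)
    obtain x x' where x: "circle_section u (z t powi a + 1) = (x, x')" by fastforce
    obtain y y' where y: "circle_section v (z t powi b + 1) = (y, y')" by fastforce
    show "g t \<in> unit_circle"
      using is_angle_phase_nonzero[OF ab(1) \<theta>(1) circle_section(1,2)[OF x] z] by (simp add: g_def x norm_sgn)
    show "g' t \<in> unit_circle"
      using is_angle_phase_nonzero[OF ab(2) \<theta>(2) circle_section(1,2)[OF y] z] by (simp add: g'_def y norm_sgn)
  next
    fix r s t assume rst: "(r, s, t) \<in> torus3"
    obtain x x' where x: "circle_section u (z t powi a + 1) = (x, x')" by fastforce
    obtain y y' where y: "circle_section v (z t powi b + 1) = (y, y')" by fastforce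
    have "sgn (z t) = t" using rst by (simp add: z_def sgn_mult sgn_unit torus3_def sgn_of_real)
    then show "phase_map a b \<theta> \<theta>' (fibre_param a b (u, v, w) (r, s, t)) = (r * g t, s * g' t, t)"
      using rst unfolding fibre_param_eq[OF x[unfolded z_def] y[unfolded z_def]]
      by (simp add: phase_map_def phase_equivariant g_def g'_def x y sgn_mult sgn_unit torus3_def flip: z_def)
  qed
qed

lemma bij_betw_phase_map:
  assumes ab: "a \<noteq> 0" "b \<noteq> 0" and \<theta>: "is_angle a u w \<theta>" "is_angle b v w \<theta>'"
  shows "bij_betw (phase_map a b \<theta> \<theta>') (h_fibre a b (u, v, w)) torus3"
proof -
  obtain g g' where g: "\<And>t. t \<in> unit_circle \<Longrightarrow> g t \<in> unit_circle \<and> g' t \<in> unit_circle"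
    and ph: "\<And>r s t. (r, s, t) \<in> torus3 \<Longrightarrow> phase_map a b \<theta> \<theta>' (fibre_param a b (u, v, w) (r, s, t)) = (r * g t, s * g' t, t)"
    using phase_map_fibre_param[OF assms] by blast
  show ?thesis
    unfolding bij_betw_def fibre_param_image[symmetric]
  proof
    show "inj_on (phase_map a b \<theta> \<theta>') (fibre_param a b (u, v, w) ` torus3)"
    proof (rule inj_onI)
      fix p q assume "p \<in> fibre_param a b (u, v, w) ` torus3" "q \<in> fibre_param a b (u, v, w) ` torus3"
        and eq: "phase_map a b \<theta> \<theta>' p = phase_map a b \<theta> \<theta>' q"
      then obtain r s t r' s' t' where pq: "p = fibre_param a b (u, v, w) (r, s, t)" "q = fibre_param a b (u, v, w) (r', s', t')"
        and T: "(r, s, t) \<in> torus3" "(r', s', t') \<in> torus3" by fastforce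
      have "t = t'" "r * g t = r' * g t" "s * g' t = s' * g' t"
        using eq unfolding pq ph[OF T(1)] ph[OF T(2)] by auto
      moreover have "g t \<noteq> 0" "g' t \<noteq> 0" using g[of t] T by (auto simp: torus3_def)
      ultimately show "p = q" unfolding pq by simp
    qed
    show "phase_map a b \<theta> \<theta>' ` fibre_param a b (u, v, w) ` torus3 = torus3"
    proof (intro equalityI subsetI)
      fix p assume "p \<in> phase_map a b \<theta> \<theta>' ` fibre_param a b (u, v, w) ` torus3"
      then obtain r s t where T: "(r, s, t) \<in> torus3" "p = (r * g t, s * g' t, t)" using ph by fastforce
      then show "p \<in> torus3" using g[of t] by (simp add: torus3_def norm_mult)
    next
      fix p assume p: "p \<in> torus3"
      obtain r s t where rst: "p = (r, s, t)" by (cases p)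
      have c: "cmod (g t) = 1" "cmod (g' t) = 1" using g[of t] p by (auto simp: rst torus3_def)
      then have nz: "g t \<noteq> 0" "g' t \<noteq> 0" by auto
      have T: "(r / g t, s / g' t, t) \<in> torus3" using p c by (simp add: rst torus3_def norm_divide)
      have "p = phase_map a b \<theta> \<theta>' (fibre_param a b (u, v, w) (r / g t, s / g' t, t))"
        unfolding ph[OF T] rst using nz by simp
      then show "p \<in> phase_map a b \<theta> \<theta>' ` fibre_param a b (u, v, w) ` torus3" using T by blast
    qed
  qed
qed

lemma continuous_on_phase_map:
  fixes \<theta> \<theta>' :: "'a::t2_space \<Rightarrow> real" and f :: "'a \<Rightarrow> complex5"
  assumes ab: "a \<noteq> 0" "b \<noteq> 0" and \<theta>: "continuous_on S \<theta>" "continuous_on S \<theta>'" and f: "continuous_on S f"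
    and fib: "\<And>s. s \<in> S \<Longrightarrow> \<exists>u v w. f s \<in> h_fibre a b (u, v, w) \<and> is_angle a u w (\<theta> s) \<and> is_angle b v w (\<theta>' s)"
  shows "continuous_on S (\<lambda>s. phase_map a b (\<theta> s) (\<theta>' s) (f s))"
proof -
  let ?x = "\<lambda>s. fst (f s)" and ?x' = "\<lambda>s. fst (snd (f s))" and ?y = "\<lambda>s. fst (snd (snd (f s)))"
    and ?y' = "\<lambda>s. fst (snd (snd (snd (f s))))" and ?z = "\<lambda>s. snd (snd (snd (snd (f s))))"
  have nz: "phase a (\<theta> s) (?x s) (?x' s) (?z s) \<noteq> 0 \<and> phase b (\<theta>' s) (?y s) (?y' s) (?z s) \<noteq> 0 \<and> ?z s \<noteq> 0"
    if "s \<in> S" for s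
  proof -
    obtain u v w where *: "f s \<in> h_fibre a b (u, v, w)" "is_angle a u w (\<theta> s)" "is_angle b v w (\<theta>' s)"
      using fib[OF \<open>s \<in> S\<close>] by blast
    then have "(?x s, ?x' s, ?y s, ?y' s, ?z s) \<in> h_fibre a b (u, v, w)" by simp
    then show ?thesis
      unfolding h_fibre_iff using is_angle_phase_nonzero[OF ab(1) *(2)] is_angle_phase_nonzero[OF ab(2) *(3)]
      by fastforce
  qed
  have "continuous_on S (\<lambda>s. (sgn (phase a (\<theta> s) (?x s) (?x' s) (?z s)), sgn (phase b (\<theta>' s) (?y s) (?y' s) (?z s)), sgn (?z s)))"
    by (intro continuous_on_Pair continuous_on_sgn continuous_on_phase \<theta> continuous_intros f) (use nz in auto)
  then show ?thesis
    by (simp add: phase_map_def case_prod_unfold)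
qed

text \<open>|x|^2 + |x'|^2 is the square root of u^2 + 4 |c|^2, hence at most |u| + 2 |c|. The
  summand 1 comes from \<open>r \<le> 1 + r\<^sup>2\<close>, which turns bounds on squares into
  bounds on moduli.\<close>

lemma norm_bound_from_product:
  fixes x x' c :: complex
  assumes "x * x' = c" "(cmod x)\<^sup>2 - (cmod x')\<^sup>2 = u"
  shows "cmod x \<le> 1 + \<bar>u\<bar> + 2 * cmod c" "cmod x' \<le> 1 + \<bar>u\<bar> + 2 * cmod c"
proof -
  have "((cmod x)\<^sup>2 + (cmod x')\<^sup>2)\<^sup>2 = ((cmod x)\<^sup>2 - (cmod x')\<^sup>2)\<^sup>2 + 4 * (cmod x * cmod x')\<^sup>2"
    by (simp add: power2_eq_square algebra_simps)
  also have "\<dots> = u\<^sup>2 + 4 * (cmod c)\<^sup>2"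
    unfolding assms(2) norm_mult[symmetric] assms(1) by simp
  also have "\<dots> \<le> (\<bar>u\<bar> + 2 * cmod c)\<^sup>2"
    by (simp add: power2_sum power_mult_distrib)
  finally have s: "(cmod x)\<^sup>2 + (cmod x')\<^sup>2 \<le> \<bar>u\<bar> + 2 * cmod c"
    by (rule power2_le_imp_le) simp
  have "r \<le> 1 + r\<^sup>2" for r :: real
  proof -
    have "2 * r \<le> 1 + r\<^sup>2" using zero_le_power2[of "r - 1"] by (simp add: power2_diff)
    then show ?thesis using zero_le_power2[of r] by linarith
  qed
  from this[of "cmod x"] this[of "cmod x'"] s zero_le_power2[of "cmod x"] zero_le_power2[of "cmod x'"]
  show "cmod x \<le> 1 + \<bar>u\<bar> + 2 * cmod c" "cmod x' \<le> 1 + \<bar>u\<bar> + 2 * cmod c" by linarith+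
qed

text \<open>Compactness of all fibres over the path together is what makes the inverse of the
  trivialisation in \<open>fibre_transport_exists\<close> continuous.\<close>

lemma compact_fibres_over_path:
  assumes \<gamma>: "continuous_on {0..1::real} \<gamma>"
  shows "compact {(t, q). t \<in> {0..1} \<and> q \<in> h_fibre a b (\<gamma> t)}" (is "compact ?P")
proof -
  define u v w where "u t = fst (\<gamma> t)" and "v t = fst (snd (\<gamma> t))" and "w t = snd (snd (\<gamma> t))" for t
  have cont: "continuous_on {0..1} u" "continuous_on {0..1} v" "continuous_on {0..1} w"
    unfolding u_def v_def w_def by (auto intro!: continuous_intros \<gamma>)
  have \<gamma>e: "\<gamma> t = (u t, v t, w t)" for t by (simp add: u_def v_def w_def)
  let ?K = "{(t, q :: complex5). t \<in> {0..1} \<and> cmod (snd (snd (snd (snd q)))) = exp (w t)}"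
  have "?K = {p \<in> {0..1} \<times> UNIV. cmod (snd (snd (snd (snd (snd p))))) - exp (w (fst p)) = 0}"
    by auto
  moreover have "closed \<dots>"
    by (intro continuous_closed_preimage_constant continuous_intros continuous_on_compose2[OF cont(3)] closed_Times) auto
  ultimately have K: "closed ?K" by simp
  let ?f = "\<lambda>p :: real \<times> complex5. case p of (t, x, x', y, y', z) \<Rightarrow>
      (x * x' - (z powi a + 1), y * y' - (z powi b + 1),
        (cmod x)\<^sup>2 - (cmod x')\<^sup>2 - u t, (cmod y)\<^sup>2 - (cmod y')\<^sup>2 - v t)"
  have "continuous_on ?K ?f"
    unfolding case_prod_unfold
    by (intro continuous_intros continuous_on_compose2[OF cont(1)] continuous_on_compose2[OF cont(2)]) auto
  then have "closed {p \<in> ?K. ?f p = (0, 0, 0, 0)}"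
    using K by (rule continuous_closed_preimage_constant)
  moreover have "?P = {p \<in> ?K. ?f p = (0, 0, 0, 0)}"
    by (auto simp: \<gamma>e h_fibre_iff)
  ultimately have closed: "closed ?P" by simp
  define M where "M t = 1 + \<bar>u t\<bar> + \<bar>v t\<bar> + 2 * (exp (of_int a * w t) + 1) + 2 * (exp (of_int b * w t) + 1) + exp (w t)" for t
  have "continuous_on {0..1} M"
    unfolding M_def by (intro continuous_intros cont)
  then have "bounded (M ` {0..1})"
    by (intro compact_imp_bounded compact_continuous_image) auto
  then obtain m where "\<forall>x\<in>M ` {0..1}. \<bar>x\<bar> \<le> m"
    unfolding bounded_iff by auto
  then have m: "M t \<le> m" if "t \<in> {0..1}" for t
    using that by (auto dest: abs_le_D1)
  have "?P \<subseteq> {0..1} \<times> cball 0 m \<times> cball 0 m \<times> cball 0 m \<times> cball 0 m \<times> cball 0 m"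
  proof
    fix p assume p: "p \<in> ?P"
    obtain t x x' y y' z where pe: "p = (t, x, x', y, y', z)" by (metis prod_cases6)
    have t: "t \<in> {0..1}" and f: "x * x' = z powi a + 1" "y * y' = z powi b + 1" "(cmod x)\<^sup>2 - (cmod x')\<^sup>2 = u t"
      "(cmod y)\<^sup>2 - (cmod y')\<^sup>2 = v t" "cmod z = exp (w t)"
      using p by (auto simp: pe \<gamma>e h_fibre_iff)
    have c: "cmod (z powi k + 1) \<le> exp (of_int k * w t) + 1" for k
      using norm_triangle_ineq[of "z powi k" 1] f(5) by (simp add: norm_power_int exp_power_int)
    have 1: "r \<le> 1 + U + V + 2 * (A + 1) + 2 * (B + 1) + W"
      if "r \<le> 1 + U + 2 * ca" "ca \<le> A + 1" "0 \<le> V" "0 \<le> B" "0 \<le> W" for r U V A B W ca :: real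
      using that by (simp add: algebra_simps)
    have 2: "r \<le> 1 + U + V + 2 * (A + 1) + 2 * (B + 1) + W"
      if "r \<le> 1 + V + 2 * cb" "cb \<le> B + 1" "0 \<le> U" "0 \<le> A" "0 \<le> W" for r U V A B W cb :: real
      using that by (simp add: algebra_simps)
    have "cmod x \<le> M t"
      unfolding M_def by (rule 1[OF norm_bound_from_product(1)[OF f(1,3)] c]) simp_all
    moreover have "cmod x' \<le> M t"
      unfolding M_def by (rule 1[OF norm_bound_from_product(2)[OF f(1,3)] c]) simp_all
    moreover have "cmod y \<le> M t"
      unfolding M_def by (rule 2[OF norm_bound_from_product(1)[OF f(2,4)] c]) simp_all
    moreover have "cmod y' \<le> M t"
      unfolding M_def by (rule 2[OF norm_bound_from_product(2)[OF f(2,4)] c]) simp_all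
    moreover have "cmod z \<le> M t"
      unfolding M_def f(5) by (simp add: add_nonneg_nonneg)
    ultimately have "cmod x \<le> M t" "cmod x' \<le> M t" "cmod y \<le> M t" "cmod y' \<le> M t" "cmod z \<le> M t"
      by blast+
    then show "p \<in> {0..1} \<times> cball 0 m \<times> cball 0 m \<times> cball 0 m \<times> cball 0 m \<times> cball 0 m"
      using m[OF t] t by (simp add: pe)
  qed
  then have "bounded ?P"
    by (rule bounded_subset[rotated]) (intro bounded_Times bounded_cball bounded_closed_interval)
  then show ?thesis
    using closed by (simp add: compact_eq_bounded_closed)
qed

section \<open>Transport along loops\<close>

text \<open>The imaginary part of a continuous logarithm, shifted so as to start at the principal
  argument. Both are arguments of \<open>g 0\<close>, so the shift is a multiple of 2 pi.\<close>

lemma angle_lift: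
  assumes g: "path g" "0 \<notin> path_image g"
  obtains \<theta> where "continuous_on {0..1} \<theta>" "\<theta> 0 = Im (Ln (g 0))"
    "\<And>t. t \<in> {0..1} \<Longrightarrow> g t = of_real (cmod (g t)) * cis (\<theta> t)"
    "\<theta> 1 - \<theta> 0 = 2 * pi * Re (winding_number g 0)"
proof -
  obtain q where q: "path q" "pathfinish q - pathstart q = 2 * of_real pi * \<i> * winding_number g 0"
    "\<And>t. t \<in> {0..1} \<Longrightarrow> g t = 0 + exp (q t)"
    using winding_number_as_continuous_log[OF g] by blast
  define \<theta> where "\<theta> t = Im (q t) - Im (q 0) + Im (Ln (g 0))" for t
  have g0: "g 0 \<noteq> 0" using g(2) by (auto simp: path_image_def)
  have e0: "exp (\<i> * of_real (Im (q 0))) = exp (\<i> * of_real (Im (Ln (g 0))))"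
  proof -
    have "exp (q 0) = exp (Ln (g 0))" using q(3)[of 0] g0 by simp
    then have "exp (Re (q 0)) = exp (Re (Ln (g 0)))" by (metis norm_exp_eq_Re)
    then have "Re (q 0) = Re (Ln (g 0))" by simp
    with \<open>exp (q 0) = exp (Ln (g 0))\<close> show ?thesis
      by (simp add: exp_eq_polar[of "q 0"] exp_eq_polar[of "Ln (g 0)"] cis_conv_exp)
  qed
  show thesis
  proof
    show "continuous_on {0..1} \<theta>"
      unfolding \<theta>_def using q(1) by (auto simp: path_def intro!: continuous_intros)
    show "\<theta> 0 = Im (Ln (g 0))" by (simp add: \<theta>_def)
    show "\<theta> 1 - \<theta> 0 = 2 * pi * Re (winding_number g 0)"
      using arg_cong[OF q(2), of Im] by (simp add: \<theta>_def pathstart_def pathfinish_def)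
    fix t :: real assume t: "t \<in> {0..1}"
    have "cis (\<theta> t) = cis (Im (q t))"
      using e0 by (simp add: \<theta>_def flip: cis_conv_exp) (simp add: cis_divide[symmetric] flip: cis_mult)
    moreover have "cmod (g t) = exp (Re (q t))" using q(3)[OF t] by simp
    moreover have "g t = of_real (exp (Re (q t))) * cis (Im (q t))"
      using q(3)[OF t] by (simp add: exp_eq_polar[of "q t"])
    ultimately show "g t = of_real (cmod (g t)) * cis (\<theta> t)" by simp
  qed
qed

text \<open>In general conjugation yields minus the conjugate of the winding number; for a loop the
  number is an integer.\<close>

lemma winding_number_loop_cnj:
  assumes g: "path g" "0 \<notin> path_image g" "pathfinish g = pathstart g"
  shows "winding_number (cnj \<circ> g) 0 = - winding_number g 0"
  using winding_number_cnj[OF g(1,2)] integer_winding_number[OF g(1,3,2)] by (auto elim: Ints_cases)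

definition plane_u :: "real3 \<Rightarrow> complex" where "plane_u = (\<lambda>(u, v, w). Complex u w)"
definition plane_v :: "real3 \<Rightarrow> complex" where "plane_v = (\<lambda>(u, v, w). Complex v w)"

text \<open>A fixed branch at the base point, so that the cohomology basis built from it does not
  depend on the loop.\<close>

definition base_angle :: "int \<Rightarrow> real \<Rightarrow> real \<Rightarrow> real" where
  "base_angle a u w = Im (Ln (Complex u (sgn (of_int a) * w)))"

text \<open>For negative \<open>a\<close> the angle is that of the conjugate loop, which accounts
  for \<open>sgn a\<close> in the total turn.\<close>

lemma signed_angle_lift:
  fixes f :: "real \<Rightarrow> complex"
  assumes a: "a \<noteq> 0" and f: "path f" "0 \<notin> path_image f" "pathfinish f = pathstart f"
    and n: "winding_number f 0 = of_int n"
  obtains \<theta> where "continuous_on {0..1} \<theta>" "\<theta> 0 = base_angle a (Re (f 0)) (Im (f 0))"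
    "\<And>t. t \<in> {0..1} \<Longrightarrow> is_angle a (Re (f t)) (Im (f t)) (\<theta> t)"
    "\<theta> 1 = \<theta> 0 + 2 * pi * of_int (sgn a * n)"
proof -
  define g where "g t = Complex (Re (f t)) (sgn (of_int a) * Im (f t))" for t
  have gf: "g = f \<and> sgn a = 1 \<or> g = cnj \<circ> f \<and> sgn a = -1"
    using a by (auto simp: g_def fun_eq_iff sgn_if complex_eq_iff)
  have g: "path g" "0 \<notin> path_image g"
    using gf f by (auto simp: path_def path_image_def intro!: continuous_intros)
  have wn: "winding_number g 0 = of_int (sgn a * n)"
    using gf winding_number_loop_cnj[OF f] n by auto
  obtain \<theta> where \<theta>: "continuous_on {0..1} \<theta>" "\<theta> 0 = Im (Ln (g 0))"
    "\<And>t. t \<in> {0..1} \<Longrightarrow> g t = of_real (cmod (g t)) * cis (\<theta> t)"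
    "\<theta> 1 - \<theta> 0 = 2 * pi * Re (winding_number g 0)"
    using angle_lift[OF g] by blast
  show thesis
  proof
    show "continuous_on {0..1} \<theta>" by (rule \<theta>)
    show "\<theta> 0 = base_angle a (Re (f 0)) (Im (f 0))" using \<theta>(2) by (simp add: g_def base_angle_def)
    show "\<theta> 1 = \<theta> 0 + 2 * pi * of_int (sgn a * n)" using \<theta>(4) by (simp add: wn)
    fix t :: real assume t: "t \<in> {0..1}"
    have nz: "g t \<noteq> 0" using g(2) t by (auto simp: path_image_def)
    have "Re (g t) = cmod (g t) * cos (\<theta> t)" "Im (g t) = cmod (g t) * sin (\<theta> t)"
      using arg_cong[OF \<theta>(3)[OF t], of Re] arg_cong[OF \<theta>(3)[OF t], of Im] by simp_all
    then show "is_angle a (Re (f t)) (Im (f t)) (\<theta> t)"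
      unfolding is_angle_def using nz by (intro exI[of _ "cmod (g t)"]) (simp add: g_def)
  qed
qed

lemma plane_nonzero: "plane_u \<in> U_base \<rightarrow> - {0}" "plane_v \<in> U_base \<rightarrow> - {0}"
  by (auto simp: plane_u_def plane_v_def U_base_def complex_eq_iff)

lemma continuous_on_plane: "continuous_on S plane_u" "continuous_on S plane_v"
  unfolding plane_u_def plane_v_def case_prod_unfold by (auto intro!: continuous_intros simp: Complex_eq)

lemma plane_loops:
  assumes "\<gamma> \<in> loops_at U_base p"
  shows "path (plane_u \<circ> \<gamma>)" "0 \<notin> path_image (plane_u \<circ> \<gamma>)" "pathfinish (plane_u \<circ> \<gamma>) = pathstart (plane_u \<circ> \<gamma>)"
    "path (plane_v \<circ> \<gamma>)" "0 \<notin> path_image (plane_v \<circ> \<gamma>)" "pathfinish (plane_v \<circ> \<gamma>) = pathstart (plane_v \<circ> \<gamma>)"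
proof -
  note D = loops_atD[OF assms]
  show "path (plane_u \<circ> \<gamma>)" "path (plane_v \<circ> \<gamma>)"
    using D continuous_on_plane by (auto intro!: path_continuous_image)
  show "0 \<notin> path_image (plane_u \<circ> \<gamma>)" "0 \<notin> path_image (plane_v \<circ> \<gamma>)"
    using D(2) plane_nonzero by (fastforce simp: path_image_compose)+
  show "pathfinish (plane_u \<circ> \<gamma>) = pathstart (plane_u \<circ> \<gamma>)" "pathfinish (plane_v \<circ> \<gamma>) = pathstart (plane_v \<circ> \<gamma>)"
    using D by (simp_all add: pathfinish_compose pathstart_compose)
qed

definition u_turns :: "(real \<Rightarrow> real3) \<Rightarrow> int" where "u_turns \<gamma> = \<lfloor>Re (winding_number (plane_u \<circ> \<gamma>) 0)\<rfloor>"
definition v_turns :: "(real \<Rightarrow> real3) \<Rightarrow> int" where "v_turns \<gamma> = \<lfloor>Re (winding_number (plane_v \<circ> \<gamma>) 0)\<rfloor>"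

lemma of_int_turns:
  assumes "\<gamma> \<in> loops_at U_base p"
  shows "winding_number (plane_u \<circ> \<gamma>) 0 = of_int (u_turns \<gamma>)" "winding_number (plane_v \<circ> \<gamma>) 0 = of_int (v_turns \<gamma>)"
  using integer_winding_number[OF plane_loops(1,3,2)[OF assms]] integer_winding_number[OF plane_loops(4,6,5)[OF assms]]
  by (auto simp: u_turns_def v_turns_def elim!: Ints_cases)

lemma turns_homotopic:
  assumes "\<gamma> \<in> loops_at U_base p" "homotopic_paths U_base \<gamma> \<delta>"
  shows "u_turns \<gamma> = u_turns \<delta>" "v_turns \<gamma> = v_turns \<delta>"
proof -
  have "homotopic_paths (- {0}) (plane_u \<circ> \<gamma>) (plane_u \<circ> \<delta>)" "homotopic_paths (- {0}) (plane_v \<circ> \<gamma>) (plane_v \<circ> \<delta>)"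
    using homotopic_paths_continuous_image[OF assms(2) continuous_on_plane(1) plane_nonzero(1)] homotopic_paths_continuous_image[OF assms(2) continuous_on_plane(2) plane_nonzero(2)] by auto
  then show "u_turns \<gamma> = u_turns \<delta>" "v_turns \<gamma> = v_turns \<delta>"
    by (simp_all add: u_turns_def v_turns_def winding_number_homotopic_paths)
qed

lemma loop_angles:
  assumes ab: "a \<noteq> 0" "b \<noteq> 0" and \<gamma>: "\<gamma> \<in> loops_at U_base (u, v, w)"
  obtains \<theta> \<theta>' where "continuous_on {0..1} \<theta>" "continuous_on {0..1} \<theta>'"
    "\<theta> 0 = base_angle a u w" "\<theta>' 0 = base_angle b v w"
    "\<And>t u v w. t \<in> {0..1} \<Longrightarrow> \<gamma> t = (u, v, w) \<Longrightarrow> is_angle a u w (\<theta> t) \<and> is_angle b v w (\<theta>' t)"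
    "\<theta> 1 = base_angle a u w + 2 * pi * of_int (sgn a * u_turns \<gamma>)"
    "\<theta>' 1 = base_angle b v w + 2 * pi * of_int (sgn b * v_turns \<gamma>)"
proof -
  have \<gamma>0: "\<gamma> 0 = (u, v, w)" using loops_atD(3)[OF \<gamma>] by (simp add: pathstart_def)
  obtain \<theta> where \<theta>: "continuous_on {0..1} \<theta>" "\<theta> 0 = base_angle a (Re ((plane_u \<circ> \<gamma>) 0)) (Im ((plane_u \<circ> \<gamma>) 0))"
    "\<And>t. t \<in> {0..1} \<Longrightarrow> is_angle a (Re ((plane_u \<circ> \<gamma>) t)) (Im ((plane_u \<circ> \<gamma>) t)) (\<theta> t)"
    "\<theta> 1 = \<theta> 0 + 2 * pi * of_int (sgn a * u_turns \<gamma>)"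
    using signed_angle_lift[OF ab(1) plane_loops(1-3)[OF \<gamma>] of_int_turns(1)[OF \<gamma>]] by blast
  obtain \<theta>' where \<theta>': "continuous_on {0..1} \<theta>'" "\<theta>' 0 = base_angle b (Re ((plane_v \<circ> \<gamma>) 0)) (Im ((plane_v \<circ> \<gamma>) 0))"
    "\<And>t. t \<in> {0..1} \<Longrightarrow> is_angle b (Re ((plane_v \<circ> \<gamma>) t)) (Im ((plane_v \<circ> \<gamma>) t)) (\<theta>' t)"
    "\<theta>' 1 = \<theta>' 0 + 2 * pi * of_int (sgn b * v_turns \<gamma>)"
    using signed_angle_lift[OF ab(2) plane_loops(4-6)[OF \<gamma>] of_int_turns(2)[OF \<gamma>]] by blast
  show thesis
  proof (rule that[OF \<theta>(1) \<theta>'(1)])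
    show 0: "\<theta> 0 = base_angle a u w" "\<theta>' 0 = base_angle b v w"
      using \<theta>(2) \<theta>'(2) \<gamma>0 by (simp_all add: plane_u_def plane_v_def)
    show "\<theta> 1 = base_angle a u w + 2 * pi * of_int (sgn a * u_turns \<gamma>)"
      "\<theta>' 1 = base_angle b v w + 2 * pi * of_int (sgn b * v_turns \<gamma>)"
      using \<theta>(4) \<theta>'(4) 0 by simp_all
    fix t u v w assume "t \<in> {0..1::real}" "\<gamma> t = (u, v, w)"
    then show "is_angle a u w (\<theta> t) \<and> is_angle b v w (\<theta>' t)"
      using \<theta>(3)[of t] \<theta>'(3)[of t] by (simp add: plane_u_def plane_v_def)
  qed
qed

text \<open>The phases at the lifted angles identify the union of the fibres over the loop with
  {0..1} times \<open>torus3\<close>. The transport keeps the phases constant.\<close>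

lemma fibre_transport_exists:
  assumes ab: "a \<noteq> 0" "b \<noteq> 0" and \<gamma>: "\<gamma> \<in> loops_at U_base p"
  shows "\<exists>T. fibre_transport (X_ab a b) h_map \<gamma> T"
proof -
  obtain u v w where p: "p = (u, v, w)" by (cases p)
  obtain \<theta> \<theta>' where \<theta>: "continuous_on {0..1} \<theta>" "continuous_on {0..1} \<theta>'"
    and ang: "\<And>t u v w. t \<in> {0..1} \<Longrightarrow> \<gamma> t = (u, v, w) \<Longrightarrow> is_angle a u w (\<theta> t) \<and> is_angle b v w (\<theta>' t)"
    using loop_angles[OF ab \<gamma>[unfolded p]] by metis
  have \<gamma>c: "continuous_on {0..1} \<gamma>" using loops_atD(1)[OF \<gamma>] by (simp add: path_def)
  define P where "P = {(t :: real, q). t \<in> {0..1} \<and> q \<in> h_fibre a b (\<gamma> t)}"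
  define f where "f = (\<lambda>(t :: real, q). (t, phase_map a b (\<theta> t) (\<theta>' t) q))"
  have P: "compact P" unfolding P_def by (rule compact_fibres_over_path[OF \<gamma>c])
  have bij: "bij_betw (phase_map a b (\<theta> t) (\<theta>' t)) (h_fibre a b (\<gamma> t)) torus3" if "t \<in> {0..1}" for t
  proof -
    obtain u v w where e: "\<gamma> t = (u, v, w)" by (cases "\<gamma> t")
    show ?thesis unfolding e using ang[OF that e] by (intro bij_betw_phase_map ab) auto
  qed
  have "continuous_on P (\<lambda>s. phase_map a b (\<theta> (fst s)) (\<theta>' (fst s)) (snd s))"
  proof (rule continuous_on_phase_map[OF ab])
    show "continuous_on P (\<lambda>s. \<theta> (fst s))" "continuous_on P (\<lambda>s. \<theta>' (fst s))"
      by (auto intro!: continuous_on_compose2[OF \<theta>(1)] continuous_on_compose2[OF \<theta>(2)] continuous_intros simp: P_def)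
    fix s assume s: "s \<in> P"
    obtain u v w where e: "\<gamma> (fst s) = (u, v, w)" by (cases "\<gamma> (fst s)")
    have "fst s \<in> {0..1}" "snd s \<in> h_fibre a b (u, v, w)" using s e by (auto simp: P_def)
    then show "\<exists>u v w. snd s \<in> h_fibre a b (u, v, w) \<and> is_angle a u w (\<theta> (fst s)) \<and> is_angle b v w (\<theta>' (fst s))"
      using ang[OF _ e] by blast
  qed (intro continuous_intros)
  then have fc: "continuous_on P f"
    unfolding f_def case_prod_unfold by (intro continuous_intros)
  have inj: "inj_on f P"
    using bij by (auto simp: f_def P_def inj_on_def bij_betw_def)
  have im: "f ` P = {0..1} \<times> torus3"
  proof (intro equalityI subsetI)
    fix y assume "y \<in> f ` P"
    then show "y \<in> {0..1} \<times> torus3" using bij by (auto simp: f_def P_def bij_betw_def)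
  next
    fix y :: "real \<times> complex \<times> complex \<times> complex" assume "y \<in> {0..1} \<times> torus3"
    then obtain t r where y: "y = (t, r)" "t \<in> {0..1}" "r \<in> torus3" by auto
    then have "r \<in> phase_map a b (\<theta> t) (\<theta>' t) ` h_fibre a b (\<gamma> t)"
      using bij_betw_imp_surj_on[OF bij[OF y(2)]] by blast
    then obtain q where q: "q \<in> h_fibre a b (\<gamma> t)" "r = phase_map a b (\<theta> t) (\<theta>' t) q"
      by blast
    then have "(t, q) \<in> P" "y = f (t, q)" using y by (simp_all add: f_def P_def)
    then show "y \<in> f ` P" by blast
  qed
  define J where "J = the_inv_into P f"
  have J: "continuous_on ({0..1} \<times> torus3) J"
    using continuous_on_inv_into[OF fc P inj] unfolding J_def im .
  have JP: "J y \<in> P" "f (J y) = y" if "y \<in> {0..1} \<times> torus3" for y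
    unfolding J_def using that im the_inv_into_into[OF inj, of y P] f_the_inv_into_f[OF inj, of y] by auto
  let ?F = "h_fibre a b (\<gamma> 0)"
  have F: "fibre_over (X_ab a b) h_map (pathstart \<gamma>) = ?F" by (simp add: pathstart_def)
  define \<Phi> where "\<Phi> = phase_map a b (\<theta> 0) (\<theta>' 0)"
  have \<Phi>T: "\<Phi> x \<in> torus3" if "x \<in> ?F" for x
    using bij[of 0] that by (auto simp: \<Phi>_def bij_betw_def)
  have "continuous_on ?F \<Phi>"
  proof -
    have "continuous_on ?F (\<lambda>x. f (0, x))"
      by (rule continuous_on_compose2[OF fc]) (auto simp: P_def intro!: continuous_intros)
    then have "continuous_on ?F (\<lambda>x. snd (f (0, x)))" by (rule continuous_on_snd)
    then show ?thesis by (simp add: f_def \<Phi>_def)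
  qed
  then have H: "continuous_on ({0..1} \<times> ?F) (\<lambda>y. snd (J (fst y, \<Phi> (snd y))))"
    by (intro continuous_on_snd continuous_on_compose2[OF J] continuous_intros
          continuous_on_compose2[of ?F \<Phi> _ snd]) (use \<Phi>T in auto)
  have HJ: "snd (J (t, \<Phi> x)) \<in> h_fibre a b (\<gamma> t)" if "t \<in> {0..1}" "x \<in> ?F" for t x
  proof -
    have m: "(t, \<Phi> x) \<in> {0..1} \<times> torus3" using that \<Phi>T by auto
    obtain t' q where tq: "J (t, \<Phi> x) = (t', q)" by (rule prod.exhaust)
    then have "t' = t" "q \<in> h_fibre a b (\<gamma> t')" using JP[OF m] by (auto simp: f_def P_def)
    then show ?thesis using tq by simp
  qed
  have H0: "snd (J (0, \<Phi> x)) = x" if "x \<in> ?F" for x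
  proof -
    have "(0, x) \<in> P" "f (0, x) = (0, \<Phi> x)" using that by (auto simp: P_def f_def \<Phi>_def)
    then have "J (0, \<Phi> x) = (0, x)" unfolding J_def using the_inv_into_f_f[OF inj, of "(0, x)"] by simp
    then show ?thesis by simp
  qed
  show ?thesis
    unfolding fibre_transport_def F
    by (rule exI[of _ "\<lambda>x. snd (J (1, \<Phi> x))"], rule exI[of _ "\<lambda>y. snd (J (fst y, \<Phi> (snd y)))"])
       (use H HJ H0 in auto)
qed

section \<open>A free basis for the base\<close>

text \<open>Multiplication by \<open>k\<close> rotates an avoided ray onto the slit of
  \<open>Ln\<close>, so a single branch serves the whole path.\<close>

lemma winding_number_slit:
  assumes "path g" "k \<noteq> 0" "\<And>t. t \<in> {0..1} \<Longrightarrow> k * g t \<notin> \<real>\<^sub>\<le>\<^sub>0"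
  shows "winding_number g 0 = (Ln (k * g 1) - Ln (k * g 0)) / (2 * of_real pi * \<i>)"
proof -
  have nz: "g t \<noteq> 0" if "t \<in> {0..1}" for t using assms(3)[OF that] by auto
  have "path (\<lambda>t. Ln (k * g t) - Ln k)"
    using assms unfolding path_def by (intro continuous_intros) auto
  moreover have "g t = exp (Ln (k * g t) - Ln k)" if "t \<in> {0..1}" for t
    using nz[OF that] assms(2) by (simp add: exp_diff)
  ultimately have "winding_number g 0 = ((Ln (k * g 1) - Ln k) - (Ln (k * g 0) - Ln k)) / (2 * of_real pi * \<i>)"
    by (rule winding_number_exp_log)
  then show ?thesis by simp
qed

definition half_chart :: "real \<Rightarrow> real3 set" where
  "half_chart \<epsilon> = {(u, v, w). 0 < \<epsilon> * w \<or> u * v \<noteq> 0}"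

definition quadrant :: "bool \<times> bool \<Rightarrow> real3 set" where
  "quadrant k = {(u, v, w). (if fst k then 0 < u else u < 0) \<and> (if snd k then 0 < v else v < 0)}"

definition quadrant_point :: "bool \<times> bool \<Rightarrow> real3" where
  "quadrant_point k = (if fst k then 1 else -1, if snd k then 1 else -1, 0)"

text \<open>A vertical push moves every point into the convex open half-space without leaving the
  chart.\<close>

lemma simply_connected_half_chart:
  assumes \<epsilon>: "\<epsilon> = 1 \<or> \<epsilon> = -1"
  shows "simply_connected (half_chart \<epsilon>)"
proof (rule contractible_imp_simply_connected)
  \<comment> \<open>The push by 1 + |w| exceeds |w|, so every point reaches positive signed
    height.\<close>
  define lift where "lift = (\<lambda>(u, v, w). (u, v, w + \<epsilon> * (1 + \<bar>w\<bar>)) :: real3)"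
  have \<epsilon>2: "\<epsilon> * \<epsilon> = 1" using \<epsilon> by auto
  have lc: "continuous_on S lift" for S
    unfolding lift_def case_prod_unfold by (intro continuous_intros)
  have conv: "convex {q :: real3. 0 < \<epsilon> * snd (snd q)}"
  proof -
    have "{q :: real3. 0 < \<epsilon> * snd (snd q)} = {x. (0, 0, \<epsilon>) \<bullet> x > 0}" by (auto simp: inner_prod_def)
    then show ?thesis by (simp only: convex_halfspace_gt)
  qed
  have sub: "{q :: real3. 0 < \<epsilon> * snd (snd q)} \<subseteq> half_chart \<epsilon>" by (auto simp: half_chart_def)
  have up: "lift x \<in> {q. 0 < \<epsilon> * snd (snd q)}" for x
  proof -
    obtain u v w where x: "x = (u, v, w)" by (cases x)
    have "\<epsilon> * (w + \<epsilon> * (1 + \<bar>w\<bar>)) = \<epsilon> * w + (1 + \<bar>w\<bar>)" using \<epsilon>2 by (simp add: algebra_simps)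
    also have "\<dots> > 0" using \<epsilon> by auto
    finally show ?thesis by (simp add: lift_def x)
  qed
  have "homotopic_with_canon (\<lambda>x. True) (half_chart \<epsilon>) (half_chart \<epsilon>) id lift"
  proof (rule homotopic_with_linear)
    fix x assume x: "x \<in> half_chart \<epsilon>"
    show "closed_segment (id x) (lift x) \<subseteq> half_chart \<epsilon>"
    proof
      fix y assume "y \<in> closed_segment (id x) (lift x)"
      then obtain t where t: "0 \<le> t" "t \<le> 1" "y = (1 - t) *\<^sub>R x + t *\<^sub>R lift x" by (auto simp: in_segment)
      obtain u v w where xe: "x = (u, v, w)" by (cases x)
      have y: "y = (u, v, w + t * (\<epsilon> * (1 + \<bar>w\<bar>)))"
        unfolding t xe lift_def by (simp add: algebra_simps)
      have "\<epsilon> * (w + t * (\<epsilon> * (1 + \<bar>w\<bar>))) = \<epsilon> * w + (\<epsilon> * \<epsilon>) * (t * (1 + \<bar>w\<bar>))" by (simp add: algebra_simps)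
      also have "\<dots> \<ge> \<epsilon> * w" using \<epsilon>2 t by simp
      finally show "y \<in> half_chart \<epsilon>" using x by (auto simp: y xe half_chart_def)
    qed
  qed (auto intro: lc continuous_on_id)
  moreover have "homotopic_with_canon (\<lambda>x. True) (half_chart \<epsilon>) (half_chart \<epsilon>) lift (\<lambda>x. (0, 0, \<epsilon>))"
  proof (rule homotopic_with_linear)
    fix x
    have "(0, 0, \<epsilon>) \<in> {q :: real3. 0 < \<epsilon> * snd (snd q)}" using \<epsilon>2 by simp
    then show "closed_segment (lift x) (0, 0, \<epsilon>) \<subseteq> half_chart \<epsilon>"
      using closed_segment_subset[OF up _ conv] sub by blast
  qed (auto intro: lc continuous_on_const)
  ultimately show "contractible (half_chart \<epsilon>)"
    unfolding contractible_def using homotopic_with_trans by blast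
qed

text \<open>In the chart \<open>u = 0\<close> forces \<open>0 < \<epsilon> * w\<close>, so
  \<open>plane_u\<close> misses the ray from 0 in the direction \<open>- \<epsilon> * \<i>\<close>.
  The factor \<open>- \<i> * \<epsilon>\<close> turns this ray onto the slit of \<open>Ln\<close>;
  likewise for \<open>v\<close>.\<close>

lemma half_chart_turns:
  assumes \<epsilon>: "\<epsilon> = 1 \<or> \<epsilon> = -1" and g: "path_in (half_chart \<epsilon>) g x y"
  shows "winding_number (plane_u \<circ> g) 0 = (Ln (- \<i> * of_real \<epsilon> * plane_u y) - Ln (- \<i> * of_real \<epsilon> * plane_u x)) / (2 * of_real pi * \<i>)"
    and "winding_number (plane_v \<circ> g) 0 = (Ln (- \<i> * of_real \<epsilon> * plane_v y) - Ln (- \<i> * of_real \<epsilon> * plane_v x)) / (2 * of_real pi * \<i>)"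
    and "path (plane_u \<circ> g)" "0 \<notin> path_image (plane_u \<circ> g)" "path (plane_v \<circ> g)" "0 \<notin> path_image (plane_v \<circ> g)"
proof -
  have slit: "- \<i> * of_real \<epsilon> * plane_u q \<notin> \<real>\<^sub>\<le>\<^sub>0" "- \<i> * of_real \<epsilon> * plane_v q \<notin> \<real>\<^sub>\<le>\<^sub>0" if "q \<in> half_chart \<epsilon>" for q
    using that \<epsilon> by (auto simp: half_chart_def plane_u_def plane_v_def complex_nonpos_Reals_iff split: prod.splits)
  have k: "- \<i> * of_real \<epsilon> \<noteq> 0" using \<epsilon> by auto
  have im: "g t \<in> half_chart \<epsilon>" if "t \<in> {0..1}" for t using g that by (auto simp: path_in_def path_image_def)
  have e: "g 0 = x" "g 1 = y" using g by (auto simp: path_in_def pathstart_def pathfinish_def)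
  show p: "path (plane_u \<circ> g)" "path (plane_v \<circ> g)"
    using g continuous_on_plane by (auto simp: path_in_def intro!: path_continuous_image)
  show "0 \<notin> path_image (plane_u \<circ> g)" "0 \<notin> path_image (plane_v \<circ> g)"
  proof -
    have "plane_u (g t) \<noteq> 0" "plane_v (g t) \<noteq> 0" if "t \<in> {0..1}" for t
      using slit[OF im[OF that]] by auto
    then show "0 \<notin> path_image (plane_u \<circ> g)" "0 \<notin> path_image (plane_v \<circ> g)"
      by (auto simp: path_image_def)
  qed
  show "winding_number (plane_u \<circ> g) 0 = (Ln (- \<i> * of_real \<epsilon> * plane_u y) - Ln (- \<i> * of_real \<epsilon> * plane_u x)) / (2 * of_real pi * \<i>)"
    using winding_number_slit[OF p(1) k] slit(1)[OF im] e by simp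
  show "winding_number (plane_v \<circ> g) 0 = (Ln (- \<i> * of_real \<epsilon> * plane_v y) - Ln (- \<i> * of_real \<epsilon> * plane_v x)) / (2 * of_real pi * \<i>)"
    using winding_number_slit[OF p(2) k] slit(2)[OF im] e by simp
qed

lemma Ln_i_sign:
  assumes "\<sigma> = 1 \<or> \<sigma> = (-1 :: real)"
  shows "Ln (\<i> * of_real \<sigma>) = \<i> * of_real (\<sigma> * pi / 2)"
  using assms by (auto simp: Ln_minus_ii)

text \<open>On the door points the two branches of the logarithm differ by \<open>\<plusminus>\<pi>\<i>\<close>.\<close>

lemma generator_turns:
  assumes \<epsilon>: "\<epsilon> = 1 \<or> \<epsilon> = -1"
    and a: "path_in (half_chart \<epsilon>) a p (quadrant_point s)"
    and b: "path_in (half_chart (- \<epsilon>)) b (quadrant_point s) (quadrant_point t)"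
    and a': "path_in (half_chart \<epsilon>) a' (quadrant_point t) p"
  shows "winding_number (plane_u \<circ> (a +++ (b +++ a'))) 0 = of_real (\<epsilon> * (of_bool (fst t) - of_bool (fst s)))"
    and "winding_number (plane_v \<circ> (a +++ (b +++ a'))) 0 = of_real (\<epsilon> * (of_bool (snd t) - of_bool (snd s)))"
proof -
  have \<epsilon>': "- \<epsilon> = 1 \<or> - \<epsilon> = -1" using \<epsilon> by auto
  note A = half_chart_turns[OF \<epsilon> a] and B = half_chart_turns[OF \<epsilon>' b] and A' = half_chart_turns[OF \<epsilon> a']
  have ends: "pathfinish (f \<circ> a) = pathstart (f \<circ> b)" "pathfinish (f \<circ> b) = pathstart (f \<circ> a')" for f :: "real3 \<Rightarrow> complex"
    using a b a' by (auto simp: path_in_def pathfinish_compose pathstart_compose)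
  define sgb where "sgb c = (if c then 1 else (-1::real))" for c
  have q: "plane_u (quadrant_point k) = of_real (sgb (fst k))" "plane_v (quadrant_point k) = of_real (sgb (snd k))" for k
    by (auto simp: plane_u_def plane_v_def quadrant_point_def sgb_def complex_eq_iff)
  have L: "Ln (- \<i> * of_real \<sigma> * of_real (sgb c)) = - (\<i> * of_real (\<sigma> * sgb c * pi / 2))" if "\<sigma> = 1 \<or> \<sigma> = -1" for \<sigma> c
  proof -
    have "- (\<sigma> * sgb c) = 1 \<or> - (\<sigma> * sgb c) = -1" using that by (auto simp: sgb_def)
    from Ln_i_sign[OF this] show ?thesis by (simp add: mult.assoc)
  qed
  \<comment> \<open>\<open>P\<close> stands for the logarithm at the base point, which cancels
    because the path returns there.\<close>
  have sum: "(- (\<i> * of_real (\<epsilon> * sgb c * pi / 2)) - P) / (2 * of_real pi * \<i>) +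
      ((- (\<i> * of_real (- \<epsilon> * sgb d * pi / 2)) - - (\<i> * of_real (- \<epsilon> * sgb c * pi / 2))) / (2 * of_real pi * \<i>) +
      (P - - (\<i> * of_real (\<epsilon> * sgb d * pi / 2))) / (2 * of_real pi * \<i>)) = of_real (\<epsilon> * (of_bool d - of_bool c))" for P c d
    by (cases c; cases d) (simp_all add: sgb_def field_simps)
  have "winding_number (plane_u \<circ> (a +++ (b +++ a'))) 0 =
     winding_number (plane_u \<circ> a) 0 + (winding_number (plane_u \<circ> b) 0 + winding_number (plane_u \<circ> a') 0)"
    using A(3-6) B(3-6) A'(3-6) ends[of plane_u]
    by (simp add: path_compose_join winding_number_join not_in_path_image_join)
  then show "winding_number (plane_u \<circ> (a +++ (b +++ a'))) 0 = of_real (\<epsilon> * (of_bool (fst t) - of_bool (fst s)))"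
    unfolding A(1) B(1) A'(1) q L[OF \<epsilon>] L[OF \<epsilon>'] sum .
  have "winding_number (plane_v \<circ> (a +++ (b +++ a'))) 0 =
     winding_number (plane_v \<circ> a) 0 + (winding_number (plane_v \<circ> b) 0 + winding_number (plane_v \<circ> a') 0)"
    using A(3-6) B(3-6) A'(3-6) ends[of plane_v]
    by (simp add: path_compose_join winding_number_join not_in_path_image_join)
  then show "winding_number (plane_v \<circ> (a +++ (b +++ a'))) 0 = of_real (\<epsilon> * (of_bool (snd t) - of_bool (snd s)))"
    unfolding A(2) B(2) A'(2) q L[OF \<epsilon>] L[OF \<epsilon>'] sum .
qed

text \<open>The doors form the chain \<open>(-,+)\<close>, \<open>(+,+)\<close>, \<open>(+,-)\<close>, \<open>(-,-)\<close>, with edges \<open>2\<close>, \<open>1\<close>, \<open>3\<close>.\<close>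

definition gen_source :: "3 \<Rightarrow> bool \<times> bool" where
  "gen_source i = (if i = 1 then (True, True) else if i = 2 then (False, True) else (True, False))"

definition gen_target :: "3 \<Rightarrow> bool \<times> bool" where
  "gen_target i = (if i = 1 then (True, False) else if i = 2 then (True, True) else (False, False))"

text \<open>The solution of the equations \<open>step\<close> along the chain of doors, starting
  from the identity at (False, False).\<close>

definition door_perm :: "bool \<times> bool \<Rightarrow> (3 \<times> bool) list \<Rightarrow> (3 \<times> bool) list" where
  "door_perm k = (if k = (False, False) then (\<lambda>r. r) else if k = (True, False) then push_letter (3, True)
     else if k = (True, True) then (\<lambda>r. push_letter (3, True) (push_letter (1, True) r))
     else (\<lambda>r. push_letter (3, True) (push_letter (1, True) (push_letter (2, True) r))))"

lemma free_basis_U_base: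
  assumes p: "p \<in> U_base"
  obtains \<epsilon> :: int and \<gamma> :: "3 \<Rightarrow> real \<Rightarrow> real3" where "\<epsilon> = 1 \<or> \<epsilon> = -1"
    "free_basis (fundamental_group U_base p) (\<lambda>i. loop_class U_base (\<gamma> i))"
    "\<And>i. \<gamma> i \<in> loops_at U_base p"
    "u_turns (\<gamma> 1) = 0" "v_turns (\<gamma> 1) = - \<epsilon>" "u_turns (\<gamma> 2) = \<epsilon>" "v_turns (\<gamma> 2) = 0"
    "u_turns (\<gamma> 3) = - \<epsilon>" "v_turns (\<gamma> 3) = 0"
proof -
  \<comment> \<open>\<open>door_tree\<close> wants the base point in the first chart;
    \<open>\<epsilon>\<close> selects which half-space chart plays that role.\<close>
  define \<epsilon> :: int where "\<epsilon> = (if p \<in> half_chart 1 then 1 else -1)"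
  have \<epsilon>: "\<epsilon> = 1 \<or> \<epsilon> = -1" "(of_int \<epsilon> :: real) = 1 \<or> of_int \<epsilon> = (-1 :: real)" "- (of_int \<epsilon> :: real) = 1 \<or> - of_int \<epsilon> = (-1 :: real)"
    by (auto simp: \<epsilon>_def)
  have pA: "p \<in> half_chart (of_int \<epsilon>)"
    using p by (auto simp: \<epsilon>_def half_chart_def U_base_def)
  define f where "f \<sigma> = (\<lambda>(u, v, w). max (\<sigma> * w) 0 + \<bar>u * v\<bar> :: real)" for \<sigma> :: real
  have fpos: "0 < f \<sigma> q \<longleftrightarrow> q \<in> half_chart \<sigma>" for \<sigma> q
    by (cases q) (auto simp: f_def half_chart_def max_def add_pos_nonneg add_nonneg_pos)
  have fcont: "continuous_on S (f \<sigma>)" for S \<sigma>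
    unfolding f_def case_prod_unfold by (intro continuous_intros)
  have sub: "half_chart \<sigma> \<subseteq> U_base" for \<sigma> by (auto simp: half_chart_def U_base_def)
  have quad: "half_chart (of_int \<epsilon>) \<inter> half_chart (- of_int \<epsilon>) = (\<Union>k. quadrant k)"
  proof -
    have "(u, v, w) \<in> half_chart (of_int \<epsilon>) \<inter> half_chart (- of_int \<epsilon>) \<longleftrightarrow> u * v \<noteq> 0" for u v w
    proof -
      have "\<not> (0 < of_int \<epsilon> * w \<and> 0 < - of_int \<epsilon> * w)"
        using mult_minus_left[of "of_int \<epsilon>" w] by linarith
      then show ?thesis unfolding half_chart_def by blast
    qed
    moreover have "(u, v, w) \<in> (\<Union>k. quadrant k) \<longleftrightarrow> u * v \<noteq> 0" for u v w
    proof
      assume "u * v \<noteq> 0"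
      then show "(u, v, w) \<in> (\<Union>k. quadrant k)"
        by (intro UN_I[of "(0 < u, 0 < v)"]) (auto simp: quadrant_def)
    qed (auto simp: quadrant_def split: if_splits)
    ultimately show ?thesis by (intro Set.set_eqI) (metis prod_cases3)
  qed
  have quad_sub: "quadrant k \<subseteq> half_chart \<sigma>" for k \<sigma> by (auto simp: quadrant_def half_chart_def)
  have qp: "quadrant_point k \<in> quadrant k" for k by (auto simp: quadrant_def quadrant_point_def)
  have qopen: "open (quadrant k)" for k
  proof -
    have "quadrant k = {q. 0 < (if fst k then fst q else - fst q)} \<inter> {q. 0 < (if snd k then fst (snd q) else - fst (snd q))}"
      by (auto simp: quadrant_def)
    also have "open \<dots>"
      by (intro open_Int open_Collect_less continuous_intros; cases "fst k"; cases "snd k"; auto intro!: continuous_intros)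
    finally show ?thesis .
  qed
  have qconv: "convex (quadrant k)" for k
  proof -
    have "quadrant k = (if fst k then {0<..} else {..<0}) \<times> (if snd k then {0<..} else {..<0}) \<times> UNIV"
      by (auto simp: quadrant_def)
    then show ?thesis by (simp add: convex_Times)
  qed
  have con: "\<exists>g. path_in (half_chart \<sigma>) g x y" if "\<sigma> = 1 \<or> \<sigma> = -1" "x \<in> half_chart \<sigma>" "y \<in> half_chart \<sigma>" for \<sigma> x y
    using simply_connected_imp_path_connected[OF simply_connected_half_chart[OF that(1)]] that(2,3)
    unfolding path_connected_def path_in_def by blast
  have qA: "quadrant_point k \<in> half_chart \<sigma>" for k \<sigma> using qp quad_sub by blast
  have "\<exists>a. path_in (half_chart (of_int \<epsilon>)) a p (quadrant_point (gen_source i))" for i using con[OF \<epsilon>(2) pA qA] .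
  then obtain a where a: "\<And>i. path_in (half_chart (of_int \<epsilon>)) (a i) p (quadrant_point (gen_source i))" by metis
  have "\<exists>a. path_in (half_chart (of_int \<epsilon>)) a (quadrant_point (gen_target i)) p" for i using con[OF \<epsilon>(2) qA pA] .
  then obtain a' where a': "\<And>i. path_in (half_chart (of_int \<epsilon>)) (a' i) (quadrant_point (gen_target i)) p" by metis
  have "\<exists>b. path_in (half_chart (- of_int \<epsilon>)) b (quadrant_point (gen_source i)) (quadrant_point (gen_target i))" for i
    using con[OF \<epsilon>(3) qA qA] .
  then obtain b where b: "\<And>i. path_in (half_chart (- of_int \<epsilon>)) (b i) (quadrant_point (gen_source i)) (quadrant_point (gen_target i))" by metis
  interpret G: glued_charts U_base "f (of_int \<epsilon>)" "f (- of_int \<epsilon>)" quadrant "{r :: (3 \<times> bool) list. reduced_word r}" door_perm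
  proof
    show "continuous_on U_base (f (of_int \<epsilon>))" "continuous_on U_base (f (- of_int \<epsilon>))" by (rule fcont)+
    show "0 \<le> f (of_int \<epsilon>) x" "0 \<le> f (- of_int \<epsilon>) x" for x by (auto simp: f_def split: prod.splits)
    show "0 < f (of_int \<epsilon>) x \<or> 0 < f (- of_int \<epsilon>) x" if "x \<in> U_base" for x
      unfolding fpos using that \<epsilon>(1) by (auto simp: half_chart_def U_base_def)
    show "{x \<in> U_base. 0 < f (of_int \<epsilon>) x \<and> 0 < f (- of_int \<epsilon>) x} = (\<Union>k. quadrant k)"
      unfolding fpos using quad sub by blast
    show "openin (top_of_set U_base) (quadrant k)" for k
      using qopen quad_sub sub by (intro open_openin_trans[OF _ _ ] open_subset) blast+
    show "quadrant k \<inter> quadrant l = {}" if "k \<noteq> l" for k l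
      using that by (cases k; cases l) (auto simp: quadrant_def split: if_splits)
    show "bij_betw (door_perm k) {r. reduced_word r} {r. reduced_word r}" for k
    proof -
      note B = bij_betw_push_letter
      have "bij_betw (\<lambda>r. push_letter (3, True) (push_letter (1, True) r)) {r :: (3 \<times> bool) list. reduced_word r} {r. reduced_word r}"
        using bij_betw_trans[OF B B] by (simp add: o_def)
      moreover have "bij_betw (\<lambda>r. push_letter (3, True) (push_letter (1, True) (push_letter (2, True) r))) {r :: (3 \<times> bool) list. reduced_word r} {r. reduced_word r}"
        using bij_betw_trans[OF bij_betw_trans[OF B B] B] by (simp add: o_def)
      moreover have "bij_betw (\<lambda>r. r) {r :: (3 \<times> bool) list. reduced_word r} {r. reduced_word r}"
        using bij_betw_id by (simp add: id_def)
      moreover have "door_perm k = (\<lambda>r. r) \<or> door_perm k = push_letter (3, True) \<or>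
          door_perm k = (\<lambda>r. push_letter (3, True) (push_letter (1, True) r)) \<or>
          door_perm k = (\<lambda>r. push_letter (3, True) (push_letter (1, True) (push_letter (2, True) r)))"
        by (simp add: door_perm_def)
      ultimately show ?thesis
        using B[of 3 True] by (elim disjE) (simp_all only:)
    qed
  qed
  have GA: "G.A = half_chart (of_int \<epsilon>)" "G.B = half_chart (- of_int \<epsilon>)"
    using sub by (auto simp: G.A_def G.B_def fpos)
  interpret D: door_tree U_base "f (of_int \<epsilon>)" "f (- of_int \<epsilon>)" quadrant door_perm p quadrant_point gen_source gen_target a b a' "(False, False)"
  proof
    show "simply_connected G.A" "simply_connected G.B"
      unfolding GA by (rule simply_connected_half_chart[OF \<epsilon>(2)], rule simply_connected_half_chart[OF \<epsilon>(3)])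
    show "path_connected (quadrant k)" for k by (rule convex_imp_path_connected[OF qconv])
    show "quadrant_point k \<in> quadrant k" for k by (rule qp)
    show "p \<in> G.A" unfolding GA by (rule pA)
    show "path_in G.A (a i) p (quadrant_point (gen_source i))" for i unfolding GA by (rule a)
    show "path_in G.B (b i) (quadrant_point (gen_source i)) (quadrant_point (gen_target i))" for i unfolding GA by (rule b)
    show "path_in G.A (a' i) (quadrant_point (gen_target i)) p" for i unfolding GA by (rule a')
    show "door_perm (gen_source i) r = door_perm (gen_target i) (push_letter (i, True) r)" for i r
      using exhaust_3[of i] by (auto simp: door_perm_def gen_source_def gen_target_def)
    let ?E = "range (\<lambda>i. (gen_source i, gen_target i)) \<union> (range (\<lambda>i. (gen_source i, gen_target i)))\<inverse>"
    have e3: "((False, False), (True, False)) \<in> ?E" "((True, False), (True, True)) \<in> ?E" "((True, True), (False, True)) \<in> ?E"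
      by (rule UnI2, rule converseI, rule range_eqI[of _ _ 3], simp add: gen_source_def gen_target_def,
          rule UnI2, rule converseI, rule range_eqI[of _ _ 1], simp add: gen_source_def gen_target_def,
          rule UnI2, rule converseI, rule range_eqI[of _ _ 2], simp add: gen_source_def gen_target_def)
    show "((False, False), k) \<in> ?E\<^sup>*" for k
      using r_into_rtrancl[OF e3(1)] rtrancl_into_rtrancl[OF r_into_rtrancl[OF e3(1)] e3(2)]
        rtrancl_into_rtrancl[OF rtrancl_into_rtrancl[OF r_into_rtrancl[OF e3(1)] e3(2)] e3(3)]
      by (cases k; cases "fst k"; cases "snd k") auto
  qed
  have turns: "of_int (u_turns (D.\<gamma> i)) = complex_of_real (of_int \<epsilon> * (of_bool (fst (gen_target i)) - of_bool (fst (gen_source i))))"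
    "of_int (v_turns (D.\<gamma> i)) = complex_of_real (of_int \<epsilon> * (of_bool (snd (gen_target i)) - of_bool (snd (gen_source i))))" for i
    using generator_turns[OF \<epsilon>(2) a[of i] b[of i] a'[of i]] of_int_turns[OF D.\<gamma>_loop[of i]] unfolding D.\<gamma>_def by simp_all
  have t: "u_turns (D.\<gamma> i) = \<epsilon> * (of_bool (fst (gen_target i)) - of_bool (fst (gen_source i)))"
    "v_turns (D.\<gamma> i) = \<epsilon> * (of_bool (snd (gen_target i)) - of_bool (snd (gen_source i)))" for i
  proof -
    have "complex_of_int (u_turns (D.\<gamma> i)) = of_int (\<epsilon> * (of_bool (fst (gen_target i)) - of_bool (fst (gen_source i))))"
      "complex_of_int (v_turns (D.\<gamma> i)) = of_int (\<epsilon> * (of_bool (snd (gen_target i)) - of_bool (snd (gen_source i))))"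
      using turns[of i] by (auto simp: of_bool_def)
    then show "u_turns (D.\<gamma> i) = \<epsilon> * (of_bool (fst (gen_target i)) - of_bool (fst (gen_source i)))"
      "v_turns (D.\<gamma> i) = \<epsilon> * (of_bool (snd (gen_target i)) - of_bool (snd (gen_source i)))"
      by (simp_all only: of_int_eq_iff)
  qed
  show thesis
    by (rule that[OF \<epsilon>(1) D.free_basis_door_tree D.\<gamma>_loop]) (simp_all add: t gen_source_def gen_target_def)
qed

section \<open>Monodromy\<close>

lemma nonvanishing_on_cong:
  "nonvanishing_on F \<phi> \<Longrightarrow> (\<And>x. x \<in> F \<Longrightarrow> \<phi> x = \<psi> x) \<Longrightarrow> nonvanishing_on F \<psi>"
  unfolding nonvanishing_on_def by (metis continuous_on_cong)

text \<open>Obtained from a homotopy that is constant on \<open>F\<close> and whose two ends are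
  written with the two functions.\<close>

lemma turning_class_cong:
  assumes \<phi>: "nonvanishing_on F \<phi>" and eq: "\<And>x. x \<in> F \<Longrightarrow> \<phi> x = \<psi> x"
  shows "turning_class F \<phi> = turning_class F \<psi>"
proof -
  let ?H = "\<lambda>p :: real \<times> _. if fst p = 0 then \<phi> (snd p) else \<psi> (snd p)"
  have "continuous_on ({0..1} \<times> F) (\<lambda>p. \<phi> (snd p))"
    using \<phi> by (auto simp: nonvanishing_on_def intro!: continuous_on_compose2[of F \<phi>] continuous_intros)
  then have "continuous_on ({0..1} \<times> F) ?H"
    by (rule continuous_on_eq) (use eq in auto)
  from turning_class_homotopic[OF this] show ?thesis
    using \<phi> eq by (auto simp: nonvanishing_on_def)
qed

text \<open>Moving the modulus linearly from 1 to its actual value never meets 0.\<close>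

lemma turning_class_sgn:
  assumes \<phi>: "nonvanishing_on F \<phi>"
  shows "nonvanishing_on F (\<lambda>x. sgn (\<phi> x))" "turning_class F (\<lambda>x. sgn (\<phi> x)) = turning_class F \<phi>"
proof -
  have c: "continuous_on F \<phi>" and nz: "\<And>x. x \<in> F \<Longrightarrow> \<phi> x \<noteq> 0"
    using \<phi> by (auto simp: nonvanishing_on_def)
  show s: "nonvanishing_on F (\<lambda>x. sgn (\<phi> x))"
    using c nz by (auto simp: nonvanishing_on_def sgn_zero_iff intro: continuous_on_sgn)
  let ?H = "\<lambda>p :: real \<times> _. of_real (1 - fst p + fst p * cmod (\<phi> (snd p))) * sgn (\<phi> (snd p))"
  have cs: "continuous_on ({0..1} \<times> F) (\<lambda>p. \<phi> (snd p))"
    by (rule continuous_on_compose2[OF c]) (auto intro!: continuous_intros)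
  have "continuous_on ({0..1} \<times> F) ?H"
    by (intro continuous_intros continuous_on_sgn cs) (use nz in auto)
  moreover have "?H (t, x) \<noteq> 0" if "t \<in> {0..1}" "x \<in> F" for t x
  proof -
    have "0 < 1 - t + t * cmod (\<phi> x)"
    proof (cases "t = 0")
      case False
      then have "0 < t * cmod (\<phi> x)" using that nz by simp
      then show ?thesis using that by simp
    qed simp
    then have "complex_of_real (1 - t + t * cmod (\<phi> x)) \<noteq> 0" by (metis less_irrefl of_real_eq_0_iff)
    then show ?thesis using nz[OF that(2)] by (simp add: sgn_zero_iff del: of_real_add of_real_diff of_real_mult)
  qed
  ultimately have "turning_class F (\<lambda>x. ?H (0, x)) = turning_class F (\<lambda>x. ?H (1, x))"
    by (rule turning_class_homotopic)
  moreover have "?H (1, x) = \<phi> x" for x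
    by (simp add: sgn_eq)
  ultimately show "turning_class F (\<lambda>x. sgn (\<phi> x)) = turning_class F \<phi>" by simp
qed

section \<open>Phase coordinates and their transport\<close>

definition phase_x :: "int \<Rightarrow> real3 \<Rightarrow> complex5 \<Rightarrow> complex" where
  "phase_x a = (\<lambda>(u, v, w) (x, x', y, y', z). phase a (base_angle a u w) x x' z)"

definition phase_y :: "int \<Rightarrow> real3 \<Rightarrow> complex5 \<Rightarrow> complex" where
  "phase_y b = (\<lambda>(u, v, w) (x, x', y, y', z). phase b (base_angle b v w) y y' z)"

definition coord_z :: "complex5 \<Rightarrow> complex" where
  "coord_z = (\<lambda>(x, x', y, y', z). z)"

lemma is_angle_base_angle:
  assumes "a \<noteq> 0" "u \<noteq> 0 \<or> w \<noteq> 0"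
  shows "is_angle a u w (base_angle a u w)"
proof -
  let ?g = "Complex u (sgn (of_int a) * w)"
  have nz: "?g \<noteq> 0" using assms by (auto simp: complex_eq_iff sgn_zero_iff)
  have "?g = of_real (cmod ?g) * cis (Im (Ln ?g))"
    using exp_Ln[OF nz] nz by (metis exp_eq_polar norm_exp_eq_Re cis_conv_exp of_real_exp)
  from arg_cong[OF this, of Re] arg_cong[OF this, of Im]
  show ?thesis
    unfolding is_angle_def base_angle_def using nz by (intro exI[of _ "cmod ?g"]) simp
qed

text \<open>Nothing is assumed about the origin of \<open>T\<close>. Along any transport
  \<open>H\<close>, the phase at the lifted angle is a homotopy from \<open>phase_x a p\<close> to
  the phase of \<open>T q\<close> at the final angle. The angle has grown by 2 pi times
  \<open>sgn a * u_turns \<gamma>\<close>, which costs \<open>z\<close> to the power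
  \<open>\<bar>a\<bar> * u_turns \<gamma>\<close> by \<open>phase_turns\<close>.\<close>

lemma transport_turning_class:
  assumes ab: "a \<noteq> 0" "b \<noteq> 0" and \<gamma>: "\<gamma> \<in> loops_at U_base p" and T: "fibre_transport (X_ab a b) h_map \<gamma> T"
  defines "F \<equiv> h_fibre a b p"
  shows "continuous_on F T" "T ` F \<subseteq> F"
    "nonvanishing_on F (phase_x a p)" "nonvanishing_on F (phase_y b p)" "nonvanishing_on F coord_z"
    "turning_class F (coord_z \<circ> T) = turning_class F coord_z"
    "turning_class F (phase_x a p) = turning_class F coord_z [^]\<^bsub>cohomology_group 1 (top_of_set F)\<^esub> (\<bar>a\<bar> * u_turns \<gamma>)
        \<otimes>\<^bsub>cohomology_group 1 (top_of_set F)\<^esub> turning_class F (phase_x a p \<circ> T)"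
    "turning_class F (phase_y b p) = turning_class F coord_z [^]\<^bsub>cohomology_group 1 (top_of_set F)\<^esub> (\<bar>b\<bar> * v_turns \<gamma>)
        \<otimes>\<^bsub>cohomology_group 1 (top_of_set F)\<^esub> turning_class F (phase_y b p \<circ> T)"
proof -
  obtain u v w where p: "p = (u, v, w)" by (cases p)
  have ends: "\<gamma> 0 = p" "\<gamma> 1 = p" "pathstart \<gamma> = p"
    using loops_atD[OF \<gamma>] by (auto simp: pathstart_def pathfinish_def)
  obtain H where H: "continuous_on ({0..1} \<times> F) H"
    and HF: "\<And>t x. t \<in> {0..1} \<Longrightarrow> x \<in> F \<Longrightarrow> H (t, x) \<in> h_fibre a b (\<gamma> t)"
    and H0: "\<And>x. x \<in> F \<Longrightarrow> H (0, x) = x" and H1: "\<And>x. x \<in> F \<Longrightarrow> H (1, x) = T x"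
    using T unfolding fibre_transport_def ends F_def by blast
  have "continuous_on F (\<lambda>x. H (1, x))"
    by (rule continuous_on_compose2[OF H]) (auto intro!: continuous_intros)
  then show cT: "continuous_on F T" by (rule continuous_on_eq) (rule H1)
  show TF: "T ` F \<subseteq> F" using HF[of 1] H1 ends by (auto simp: F_def)
  obtain \<theta> \<theta>' where \<theta>: "continuous_on {0..1} \<theta>" "continuous_on {0..1} \<theta>'"
    "\<theta> 0 = base_angle a u w" "\<theta>' 0 = base_angle b v w"
    and ang: "\<And>t u v w. t \<in> {0..1} \<Longrightarrow> \<gamma> t = (u, v, w) \<Longrightarrow> is_angle a u w (\<theta> t) \<and> is_angle b v w (\<theta>' t)"
    and \<theta>1: "\<theta> 1 = base_angle a u w + 2 * pi * of_int (sgn a * u_turns \<gamma>)"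
      "\<theta>' 1 = base_angle b v w + 2 * pi * of_int (sgn b * v_turns \<gamma>)"
    using loop_angles[OF ab \<gamma>[unfolded p]] by metis
  let ?x = "\<lambda>q :: complex5. fst q" and ?x' = "\<lambda>q :: complex5. fst (snd q)" and ?y = "\<lambda>q :: complex5. fst (snd (snd q))"
    and ?y' = "\<lambda>q :: complex5. fst (snd (snd (snd q)))" and ?z = "\<lambda>q :: complex5. snd (snd (snd (snd q)))"
  define X where "X p = phase a (\<theta> (fst p)) (?x (H p)) (?x' (H p)) (?z (H p))" for p
  define Y where "Y p = phase b (\<theta>' (fst p)) (?y (H p)) (?y' (H p)) (?z (H p))" for p
  define Z where "Z p = ?z (H p)" for p
  have nz: "X (t, x) \<noteq> 0 \<and> Y (t, x) \<noteq> 0 \<and> Z (t, x) \<noteq> 0" if t: "t \<in> {0..1}" and x: "x \<in> F" for t x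
  proof -
    obtain u v w where e: "\<gamma> t = (u, v, w)" by (cases "\<gamma> t")
    have "(?x (H (t, x)), ?x' (H (t, x)), ?y (H (t, x)), ?y' (H (t, x)), ?z (H (t, x))) \<in> h_fibre a b (u, v, w)"
      using HF[OF t x] e by simp
    then show ?thesis
      unfolding h_fibre_iff X_def Y_def Z_def
      using is_angle_phase_nonzero[OF ab(1)] is_angle_phase_nonzero[OF ab(2)] ang[OF t e] by fastforce
  qed
  have cZ: "continuous_on ({0..1} \<times> F) Z"
    unfolding Z_def by (intro continuous_intros H)
  have Znz: "?z (H y) \<noteq> 0" if "y \<in> {0..1} \<times> F" for y using nz that by (auto simp: Z_def)
  have cX: "continuous_on ({0..1} \<times> F) X"
    unfolding X_def
    by (intro continuous_on_phase continuous_intros H continuous_on_compose2[OF \<theta>(1)]) (use Znz in auto)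
  have cY: "continuous_on ({0..1} \<times> F) Y"
    unfolding Y_def
    by (intro continuous_on_phase continuous_intros H continuous_on_compose2[OF \<theta>(2)]) (use Znz in auto)
  have X0: "X (0, q) = phase_x a p q" "Y (0, q) = phase_y b p q" "Z (0, q) = coord_z q" if "q \<in> F" for q
    using H0[OF that] by (auto simp: X_def Y_def Z_def phase_x_def phase_y_def coord_z_def p \<theta> split: prod.splits)
  have nv0: "nonvanishing_on F (\<lambda>q. f (0, q))" if "continuous_on ({0..1} \<times> F) f" "\<And>q. q \<in> F \<Longrightarrow> f (0, q) \<noteq> 0"
    for f :: "real \<times> complex5 \<Rightarrow> complex"
    unfolding nonvanishing_on_def using that(2)
    by (auto intro!: continuous_on_compose2[OF that(1)] continuous_intros)
  have nvX: "nonvanishing_on F (\<lambda>q. X (0, q))" using nv0[OF cX] nz by auto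
  have nvY: "nonvanishing_on F (\<lambda>q. Y (0, q))" using nv0[OF cY] nz by auto
  have nvZ: "nonvanishing_on F (\<lambda>q. Z (0, q))" using nv0[OF cZ] nz by auto
  show nx: "nonvanishing_on F (phase_x a p)" using nvX by (rule nonvanishing_on_cong) (rule X0)
  show ny: "nonvanishing_on F (phase_y b p)" using nvY by (rule nonvanishing_on_cong) (rule X0)
  show nzc: "nonvanishing_on F coord_z" using nvZ by (rule nonvanishing_on_cong) (rule X0)
  note nT = nonvanishing_on_compose[OF _ cT TF]
  have Z1: "Z (1, q) = (coord_z \<circ> T) q" if "q \<in> F" for q
    using H1[OF that] by (auto simp: Z_def coord_z_def split: prod.splits)
  have Tnz: "coord_z (T q) \<noteq> 0" if "q \<in> F" for q
    using nzc TF that by (auto simp: nonvanishing_on_def)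
  have X1: "X (1, q) = coord_z (T q) powi (\<bar>a\<bar> * u_turns \<gamma>) * (phase_x a p \<circ> T) q" if "q \<in> F" for q
  proof -
    obtain x x' y y' z where e: "T q = (x, x', y, y', z)" by (metis prod_cases5)
    have z: "z \<noteq> 0" using Tnz[OF that] by (simp add: e coord_z_def)
    have s: "a * (sgn a * u_turns \<gamma>) = \<bar>a\<bar> * u_turns \<gamma>" by (simp add: abs_sgn mult.assoc)
    show ?thesis
      using phase_turns[OF z, of a "base_angle a u w" "sgn a * u_turns \<gamma>" x x'] H1[OF that]
      by (simp add: X_def \<theta>1 e s phase_x_def p coord_z_def)
  qed
  have Y1: "Y (1, q) = coord_z (T q) powi (\<bar>b\<bar> * v_turns \<gamma>) * (phase_y b p \<circ> T) q" if "q \<in> F" for q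
  proof -
    obtain x x' y y' z where e: "T q = (x, x', y, y', z)" by (metis prod_cases5)
    have z: "z \<noteq> 0" using Tnz[OF that] by (simp add: e coord_z_def)
    have s: "b * (sgn b * v_turns \<gamma>) = \<bar>b\<bar> * v_turns \<gamma>" by (simp add: abs_sgn mult.assoc)
    show ?thesis
      using phase_turns[OF z, of b "base_angle b v w" "sgn b * v_turns \<gamma>" y y'] H1[OF that]
      by (simp add: Y_def \<theta>1 e s phase_y_def p coord_z_def)
  qed
  have hZ: "turning_class F (\<lambda>q. Z (0, q)) = turning_class F (\<lambda>q. Z (1, q))"
    by (rule turning_class_homotopic[OF cZ]) (use nz in auto)
  have hX: "turning_class F (\<lambda>q. X (0, q)) = turning_class F (\<lambda>q. X (1, q))"
    by (rule turning_class_homotopic[OF cX]) (use nz in auto)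
  have hY: "turning_class F (\<lambda>q. Y (0, q)) = turning_class F (\<lambda>q. Y (1, q))"
    by (rule turning_class_homotopic[OF cY]) (use nz in auto)
  have "turning_class F (\<lambda>q. Z (0, q)) = turning_class F coord_z"
    by (rule turning_class_cong[OF nvZ X0(3)])
  moreover have "turning_class F (coord_z \<circ> T) = turning_class F (\<lambda>q. Z (1, q))"
    by (rule turning_class_cong[OF nT[OF nzc]]) (simp add: Z1)
  ultimately show zT: "turning_class F (coord_z \<circ> T) = turning_class F coord_z" using hZ by simp
  have pw: "turning_class F (\<lambda>q. coord_z (T q) powi n * (f \<circ> T) q) =
     turning_class F coord_z [^]\<^bsub>cohomology_group 1 (top_of_set F)\<^esub> n \<otimes>\<^bsub>cohomology_group 1 (top_of_set F)\<^esub> turning_class F (f \<circ> T)"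
    if "nonvanishing_on F f" for f and n :: int
  proof -
    have "turning_class F (\<lambda>q. (coord_z \<circ> T) q powi n * (f \<circ> T) q) =
      turning_class F (\<lambda>q. (coord_z \<circ> T) q powi n) \<otimes>\<^bsub>cohomology_group 1 (top_of_set F)\<^esub> turning_class F (f \<circ> T)"
      by (rule turning_class_mult[OF nonvanishing_on_powi[OF nT[OF nzc]] nT[OF that]])
    then show ?thesis
      unfolding turning_class_powi[OF nT[OF nzc]] zT by simp
  qed
  have "turning_class F (phase_x a p) = turning_class F (\<lambda>q. X (1, q))"
    using turning_class_cong[OF nvX X0(1)] hX by simp
  also have "\<dots> = turning_class F (\<lambda>q. coord_z (T q) powi (\<bar>a\<bar> * u_turns \<gamma>) * (phase_x a p \<circ> T) q)"
    by (rule turning_class_cong[symmetric, OF nonvanishing_on_mult[OF nonvanishing_on_powi[OF nT[OF nzc], unfolded o_apply] nT[OF nx]]])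
       (simp only: X1)
  finally show "turning_class F (phase_x a p) = turning_class F coord_z [^]\<^bsub>cohomology_group 1 (top_of_set F)\<^esub> (\<bar>a\<bar> * u_turns \<gamma>)
        \<otimes>\<^bsub>cohomology_group 1 (top_of_set F)\<^esub> turning_class F (phase_x a p \<circ> T)"
    unfolding pw[OF nx] .
  have "turning_class F (phase_y b p) = turning_class F (\<lambda>q. Y (1, q))"
    using turning_class_cong[OF nvY X0(2)] hY by simp
  also have "\<dots> = turning_class F (\<lambda>q. coord_z (T q) powi (\<bar>b\<bar> * v_turns \<gamma>) * (phase_y b p \<circ> T) q)"
    by (rule turning_class_cong[symmetric, OF nonvanishing_on_mult[OF nonvanishing_on_powi[OF nT[OF nzc], unfolded o_apply] nT[OF ny]]])
       (simp only: Y1)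
  finally show "turning_class F (phase_y b p) = turning_class F coord_z [^]\<^bsub>cohomology_group 1 (top_of_set F)\<^esub> (\<bar>b\<bar> * v_turns \<gamma>)
        \<otimes>\<^bsub>cohomology_group 1 (top_of_set F)\<^esub> turning_class F (phase_y b p \<circ> T)"
    unfolding pw[OF ny] .
qed

text \<open>The signs of the first two coordinates are free; they are chosen at the end so that the
  entries of the monodromy matrices come out as in the statement.\<close>

definition fibre_coord :: "int \<Rightarrow> int \<Rightarrow> real3 \<Rightarrow> int \<Rightarrow> int \<Rightarrow> 3 \<Rightarrow> complex5 \<Rightarrow> complex" where
  "fibre_coord a b p \<sigma> \<tau> i =
     (if i = 1 then (\<lambda>q. sgn (phase_x a p q) powi \<sigma>) else if i = 2 then (\<lambda>q. sgn (phase_y b p q) powi \<tau>)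
      else (\<lambda>q. sgn (coord_z q)))"

lemma powi_sign_twice:
  fixes x :: complex
  assumes "s = 1 \<or> s = -1"
  shows "(x powi s) powi s = x"
  using assms by (auto simp: power_int_minus)

text \<open>The inverse of the phase map after the exponential map onto \<open>torus3\<close> is the
  \<open>P\<close> required by \<open>integral_basis_turning_class\<close>. Raising to the power
  \<open>\<sigma>\<close> or \<open>\<tau>\<close> is an involution and merely reverses a
  circle.\<close>

lemma integral_basis_fibre_coord:
  assumes ab: "a \<noteq> 0" "b \<noteq> 0" and pU: "p \<in> U_base" and s: "\<sigma> = 1 \<or> \<sigma> = -1" "\<tau> = 1 \<or> \<tau> = -1"
  defines "F \<equiv> h_fibre a b p"
  shows "integral_basis (cohomology_group 1 (top_of_set F)) (\<lambda>i. turning_class F (fibre_coord a b p \<sigma> \<tau> i))"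
proof -
  obtain u v w where p: "p = (u, v, w)" by (cases p)
  have nz: "u \<noteq> 0 \<or> w \<noteq> 0" "v \<noteq> 0 \<or> w \<noteq> 0" using pU by (auto simp: U_base_def p)
  note ang = is_angle_base_angle[OF ab(1) nz(1)] is_angle_base_angle[OF ab(2) nz(2)]
  define \<Phi> where "\<Phi> = phase_map a b (base_angle a u w) (base_angle b v w)"
  have \<Phi>e: "\<Phi> q = (sgn (phase_x a p q), sgn (phase_y b p q), sgn (coord_z q))" for q
    by (auto simp: \<Phi>_def phase_map_def phase_x_def phase_y_def coord_z_def p split: prod.splits)
  have bij: "bij_betw \<Phi> F torus3"
    unfolding \<Phi>_def F_def p by (rule bij_betw_phase_map[OF ab ang])
  have cont: "continuous_on F \<Phi>"
    unfolding \<Phi>_def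
    by (rule continuous_on_phase_map[OF ab])
       (use ang in \<open>auto simp: F_def p intro!: continuous_intros\<close>)
  have "compact F"
    unfolding F_def p fibre_param_image[symmetric]
    by (rule compact_continuous_image[OF continuous_on_fibre_param compact_torus3])
  define \<Psi> where "\<Psi> = the_inv_into F \<Phi>"
  have inj: "inj_on \<Phi> F" and im: "\<Phi> ` F = torus3" using bij by (auto simp: bij_betw_def)
  have c\<Psi>: "continuous_on torus3 \<Psi>"
    using continuous_on_inv_into[OF cont \<open>compact F\<close> inj] by (simp add: \<Psi>_def im)
  have \<Psi>: "\<Psi> x \<in> F" "\<Phi> (\<Psi> x) = x" if "x \<in> torus3" for x
    using the_inv_into_into[OF inj _ subset_refl, of x] f_the_inv_into_f[OF inj, of x] that im by (auto simp: \<Psi>_def)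
  define E where "E r = exp (2 * of_real pi * \<i> * complex_of_real r)" for r
  have E: "cmod (E r) = 1" "E r \<noteq> 0" for r by (auto simp: E_def)
  have Es: "E (of_int k * r) = E r powi k" for k r
    by (simp add: E_def exp_power_int mult_ac)
  define P where "P v = \<Psi> (E (of_int \<sigma> * v $ 1), E (of_int \<tau> * v $ 2), E (v $ 3))" for v :: "real ^ 3"
  have T: "(E r, E r', E r'') \<in> torus3" for r r' r'' by (simp add: torus3_def E)
  show ?thesis
  proof (rule integral_basis_turning_class)
    have c: "continuous_on F (\<lambda>q. sgn (phase_x a p q))" "continuous_on F (\<lambda>q. sgn (phase_y b p q))" "continuous_on F (\<lambda>q. sgn (coord_z q))"
      using continuous_on_fst[OF cont] continuous_on_fst[OF continuous_on_snd[OF cont]] continuous_on_snd[OF continuous_on_snd[OF cont]]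
      by (simp_all add: \<Phi>e)
    have n: "cmod (sgn (phase_x a p q)) = 1" "cmod (sgn (phase_y b p q)) = 1" "cmod (sgn (coord_z q)) = 1" if "q \<in> F" for q
      using imageI[OF that, of \<Phi>] unfolding im by (auto simp: \<Phi>e torus3_def)
    have n0: "sgn (phase_x a p q) \<noteq> 0" "sgn (phase_y b p q) \<noteq> 0" if "q \<in> F" for q
      using n[OF that] by (metis norm_zero zero_neq_one)+
    show "continuous_on F (fibre_coord a b p \<sigma> \<tau> i)" for i
      using exhaust_3[of i] c n0 by (auto simp: fibre_coord_def intro!: continuous_intros)
    show "cmod (fibre_coord a b p \<sigma> \<tau> i x) = 1" if "x \<in> F" for i x
      using exhaust_3[of i] n[OF that] by (auto simp: fibre_coord_def norm_power_int)
    show "continuous_on UNIV P"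
      unfolding P_def
    proof (rule continuous_on_compose2[OF c\<Psi>])
      show "continuous_on UNIV (\<lambda>v :: real ^ 3. (E (of_int \<sigma> * v $ 1), E (of_int \<tau> * v $ 2), E (v $ 3)))"
        unfolding E_def by (intro continuous_intros)
    qed (use T in blast)
    show "P v \<in> F" for v unfolding P_def by (rule \<Psi>(1)[OF T])
    show "fibre_coord a b p \<sigma> \<tau> i (P v) = exp (2 * of_real pi * \<i> * of_real (v $ i))" for i v
    proof -
      have "\<Phi> (P v) = (E (of_int \<sigma> * v $ 1), E (of_int \<tau> * v $ 2), E (v $ 3))"
        unfolding P_def by (rule \<Psi>(2)[OF T])
      then show ?thesis
        using exhaust_3[of i] unfolding \<Phi>e Es
        by (auto simp: fibre_coord_def powi_sign_twice[OF s(1)] powi_sign_twice[OF s(2)] E_def)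
    qed
    fix x v assume x: "x \<in> F" and eq: "\<And>i. fibre_coord a b p \<sigma> \<tau> i x = exp (2 * of_real pi * \<i> * of_real (v $ i))"
    have "sgn (phase_x a p x) powi \<sigma> = E (v $ 1)" "sgn (phase_y b p x) powi \<tau> = E (v $ 2)" "sgn (coord_z x) = E (v $ 3)"
      using eq[of 1] eq[of 2] eq[of 3] by (simp_all add: fibre_coord_def E_def)
    then have "sgn (phase_x a p x) = E (v $ 1) powi \<sigma>" "sgn (phase_y b p x) = E (v $ 2) powi \<tau>" "sgn (coord_z x) = E (v $ 3)"
      using powi_sign_twice[OF s(1)] powi_sign_twice[OF s(2)] by metis+
    then have "\<Phi> x = (E (of_int \<sigma> * v $ 1), E (of_int \<tau> * v $ 2), E (v $ 3))"
      by (simp add: \<Phi>e Es)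
    then show "P v = x"
      unfolding P_def \<Psi>_def using the_inv_into_f_f[OF inj x] by simp
  qed
qed

section \<open>Matrices and homomorphisms on an integral basis\<close>

lemma (in comm_group) finprod_UNIV_3:
  fixes f :: "3 \<Rightarrow> 'a"
  assumes "range f \<subseteq> carrier G"
  shows "(\<Otimes>i\<in>UNIV. f i) = f 1 \<otimes> (f 2 \<otimes> f 3)"
proof -
  have c: "f i \<in> carrier G" for i using assms by auto
  have "(\<Otimes>i\<in>{3}. f i) = f 3"
    using finprod_insert[of "{}" 3 f] c by simp
  moreover have "(\<Otimes>i\<in>{2, 3}. f i) = f 2 \<otimes> (\<Otimes>i\<in>{3}. f i)"
    by (rule finprod_insert) (use c in auto)
  moreover have "(\<Otimes>i\<in>{1, 2, 3}. f i) = f 1 \<otimes> (\<Otimes>i\<in>{2, 3}. f i)"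
    by (rule finprod_insert) (use c in auto)
  ultimately show ?thesis unfolding UNIV_3 by (simp only:)
qed

lemma acts_by_lower_matrix:
  fixes e :: "3 \<Rightarrow> 'a"
  assumes "comm_group G" "range e \<subseteq> carrier G"
    and f: "f (e 1) = e 1 \<otimes>\<^bsub>G\<^esub> e 3 [^]\<^bsub>G\<^esub> (\<alpha>::int)" "f (e 2) = e 2 \<otimes>\<^bsub>G\<^esub> e 3 [^]\<^bsub>G\<^esub> (\<beta>::int)" "f (e 3) = e 3"
  shows "acts_by_matrix G e f (vector [vector [1, 0, 0], vector [0, 1, 0], vector [\<alpha>, \<beta>, 1]])"
  unfolding acts_by_matrix_def
proof
  interpret comm_group G by (rule assms(1))
  fix j :: 3
  have c: "e i \<in> carrier G" for i using assms(2) by auto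
  have r: "range (\<lambda>i. e i [^]\<^bsub>G\<^esub> (k i :: int)) \<subseteq> carrier G" for k using c by auto
  show "f (e j) = (\<Otimes>\<^bsub>G\<^esub>i\<in>UNIV. e i [^]\<^bsub>G\<^esub> ((vector [vector [1, 0, 0], vector [0, 1, 0], vector [\<alpha>, \<beta>, 1]] :: int ^ 3 ^ 3) $ i $ j))"
    unfolding finprod_UNIV_3[OF r] using exhaust_3[of j] c f
    by (auto simp: vector_3 int_pow_1)
qed

lemma hom_agree_on_integral_basis:
  fixes e :: "'n::finite \<Rightarrow> 'a"
  assumes e: "integral_basis G e" and f: "f \<in> hom G G" and g: "g \<in> hom G G" and eq: "\<And>i. f (e i) = g (e i)"
    and c: "c \<in> carrier G"
  shows "f c = g c"
proof -
  interpret comm_group G using e by (simp add: integral_basis_def)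
  have ec: "e i \<in> carrier G" for i using e by (auto simp: integral_basis_def)
  obtain k :: "int ^ 'n" where k: "c = (\<Otimes>\<^bsub>G\<^esub>i\<in>UNIV. e i [^]\<^bsub>G\<^esub> (k $ i))"
    using e c unfolding integral_basis_def bij_betw_def by blast
  have "(\<Otimes>\<^bsub>G\<^esub>i\<in>I. e i [^]\<^bsub>G\<^esub> (k $ i)) \<in> carrier G \<and>
      f (\<Otimes>\<^bsub>G\<^esub>i\<in>I. e i [^]\<^bsub>G\<^esub> (k $ i)) = g (\<Otimes>\<^bsub>G\<^esub>i\<in>I. e i [^]\<^bsub>G\<^esub> (k $ i))" if "finite I" for I
    using that
  proof induction
    case empty
    then show ?case using hom_one[OF f is_group is_group] hom_one[OF g is_group is_group] by simp
  next
    case (insert i I)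
    have "f (e i [^]\<^bsub>G\<^esub> (k $ i)) = g (e i [^]\<^bsub>G\<^esub> (k $ i))"
      using hom_int_pow[OF f ec is_group is_group] hom_int_pow[OF g ec is_group is_group] eq by simp
    then show ?case
      using insert ec hom_mult[OF f] hom_mult[OF g] by (simp add: Pi_iff)
  qed
  then show ?thesis unfolding k by simp
qed

lemma transport_fibre_coord:
  fixes \<sigma> \<tau> :: int
  assumes ab: "a \<noteq> 0" "b \<noteq> 0" and \<gamma>: "\<gamma> \<in> loops_at U_base p" and T: "fibre_transport (X_ab a b) h_map \<gamma> T"
  defines "F \<equiv> h_fibre a b p"
  defines "e \<equiv> (\<lambda>i. turning_class F (fibre_coord a b p \<sigma> \<tau> i))" and "G \<equiv> cohomology_group 1 (top_of_set F)"
  shows "cohomology_induced 1 (top_of_set F) T \<in> hom G G"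
    "cohomology_induced 1 (top_of_set F) T (e 1) = e 1 \<otimes>\<^bsub>G\<^esub> e 3 [^]\<^bsub>G\<^esub> (- (\<sigma> * \<bar>a\<bar> * u_turns \<gamma>))"
    "cohomology_induced 1 (top_of_set F) T (e 2) = e 2 \<otimes>\<^bsub>G\<^esub> e 3 [^]\<^bsub>G\<^esub> (- (\<tau> * \<bar>b\<bar> * v_turns \<gamma>))"
    "cohomology_induced 1 (top_of_set F) T (e 3) = e 3"
proof -
  note t = transport_turning_class[OF ab \<gamma> T, folded F_def G_def]
  interpret comm_group G unfolding G_def by (rule comm_group_cohomology_group)
  let ?T = "cohomology_induced 1 (top_of_set F) T"
  have "continuous_map (top_of_set F) (top_of_set F) T"
    using t(1,2) by (simp add: continuous_map_in_subtopology flip: image_subset_iff_funcset)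
  then show hom: "?T \<in> hom G G" unfolding G_def by (rule hom_cohomology_induced)
  have ind: "?T (turning_class F \<phi>) = turning_class F (\<phi> \<circ> T)" if "nonvanishing_on F \<phi>" for \<phi>
    by (rule turning_class_induced[OF t(1,2) that])
  have e: "e 1 = turning_class F (phase_x a p) [^]\<^bsub>G\<^esub> \<sigma>" "e 2 = turning_class F (phase_y b p) [^]\<^bsub>G\<^esub> \<tau>" "e 3 = turning_class F coord_z"
    using turning_class_powi[OF turning_class_sgn(1)[OF t(3)]] turning_class_powi[OF turning_class_sgn(1)[OF t(4)]]
      turning_class_sgn(2)[OF t(3)] turning_class_sgn(2)[OF t(4)] turning_class_sgn(2)[OF t(5)]
    by (simp_all add: e_def fibre_coord_def G_def)
  have cl: "turning_class F \<phi> \<in> carrier G" if "nonvanishing_on F \<phi>" for \<phi>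
    unfolding G_def by (rule turning_class_closed[OF that])
  note nT = nonvanishing_on_compose[OF _ t(1,2)]
  show "?T (e 3) = e 3" unfolding e ind[OF t(5)] by (rule t(6))
  \<comment> \<open>\<open>transport_turning_class\<close> expresses the original class through the
    transported one; here the relation is solved for the latter.\<close>
  have solve: "?T (turning_class F \<phi> [^]\<^bsub>G\<^esub> s) = turning_class F \<phi> [^]\<^bsub>G\<^esub> s \<otimes>\<^bsub>G\<^esub> turning_class F coord_z [^]\<^bsub>G\<^esub> (- (s * n))"
    if \<phi>: "nonvanishing_on F \<phi>"
      and eq: "turning_class F \<phi> = turning_class F coord_z [^]\<^bsub>G\<^esub> n \<otimes>\<^bsub>G\<^esub> turning_class F (\<phi> \<circ> T)" for \<phi> and s n :: int
  proof -
    let ?z = "turning_class F coord_z" and ?\<phi> = "turning_class F \<phi>" and ?\<phi>T = "turning_class F (\<phi> \<circ> T)"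
    have c: "?z \<in> carrier G" "?\<phi> \<in> carrier G" "?\<phi>T \<in> carrier G"
      using cl t(5) \<phi> nT[OF \<phi>] by auto
    have "?\<phi>T = ?z [^]\<^bsub>G\<^esub> (- n) \<otimes>\<^bsub>G\<^esub> ?\<phi>"
      unfolding eq using c by (simp add: m_assoc[symmetric] int_pow_mult[symmetric])
    then have "?\<phi>T = ?\<phi> \<otimes>\<^bsub>G\<^esub> ?z [^]\<^bsub>G\<^esub> (- n)"
      using c by (simp add: m_comm)
    then have "?\<phi>T [^]\<^bsub>G\<^esub> s = ?\<phi> [^]\<^bsub>G\<^esub> s \<otimes>\<^bsub>G\<^esub> (?z [^]\<^bsub>G\<^esub> (- n)) [^]\<^bsub>G\<^esub> s"
      using c int_pow_mult_distrib[of ?\<phi> "?z [^]\<^bsub>G\<^esub> (- n)" s] by (simp add: m_comm)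
    then show ?thesis
      using hom_int_pow[OF hom c(2) is_group is_group, of s] ind[OF \<phi>] c
      by (simp add: int_pow_pow mult.commute)
  qed
  show "?T (e 1) = e 1 \<otimes>\<^bsub>G\<^esub> e 3 [^]\<^bsub>G\<^esub> (- (\<sigma> * \<bar>a\<bar> * u_turns \<gamma>))"
    unfolding e using solve[OF t(3) t(7), of \<sigma>] by (simp add: mult.assoc)
  show "?T (e 2) = e 2 \<otimes>\<^bsub>G\<^esub> e 3 [^]\<^bsub>G\<^esub> (- (\<tau> * \<bar>b\<bar> * v_turns \<gamma>))"
    unfolding e using solve[OF t(4) t(8), of \<tau>] by (simp add: mult.assoc)
qed

lemma monodromy_over_U_base:
  assumes ab: "a \<noteq> 0" "b \<noteq> 0" and p: "p \<in> U_base"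
  defines "F \<equiv> h_fibre a b p"
  shows "\<exists>g :: 3 \<Rightarrow> (real \<Rightarrow> real3) set. \<exists>e :: 3 \<Rightarrow> (complex5 chain \<Rightarrow> int) set. \<exists>\<rho>.
          free_basis (fundamental_group U_base p) g \<and>
          integral_basis (cohomology_group 1 (top_of_set F)) e \<and>
          monodromy_action 1 (X_ab a b) h_map U_base p \<rho> \<and>
          acts_by_matrix (cohomology_group 1 (top_of_set F)) e (\<rho> (g 1))
            (vector [vector [1, 0, 0], vector [0, 1, 0], vector [0, b, 1]]) \<and>
          acts_by_matrix (cohomology_group 1 (top_of_set F)) e (\<rho> (g 2))
            (vector [vector [1, 0, 0], vector [0, 1, 0], vector [a, 0, 1]]) \<and>
          acts_by_matrix (cohomology_group 1 (top_of_set F)) e (\<rho> (g 3))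
            (vector [vector [1, 0, 0], vector [0, 1, 0], vector [- a, 0, 1]])"
proof -
  let ?G = "cohomology_group 1 (top_of_set F)"
  obtain \<epsilon> :: int and \<gamma> :: "3 \<Rightarrow> real \<Rightarrow> real3" where \<epsilon>: "\<epsilon> = 1 \<or> \<epsilon> = -1"
    and free: "free_basis (fundamental_group U_base p) (\<lambda>i. loop_class U_base (\<gamma> i))"
    and \<gamma>: "\<And>i. \<gamma> i \<in> loops_at U_base p"
    and turns: "u_turns (\<gamma> 1) = 0" "v_turns (\<gamma> 1) = - \<epsilon>" "u_turns (\<gamma> 2) = \<epsilon>" "v_turns (\<gamma> 2) = 0"
    "u_turns (\<gamma> 3) = - \<epsilon>" "v_turns (\<gamma> 3) = 0"
    using free_basis_U_base[OF p] by blast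
  \<comment> \<open>The sign that gives generator 2, with \<open>u_turns\<close> equal to
    \<open>\<epsilon>\<close>, the entry \<open>a\<close>. Likewise \<open>\<tau>\<close> is
    adjusted to generator 1, with \<open>v_turns\<close> equal to \<open>- \<epsilon>\<close> and
    entry \<open>b\<close>.\<close>
  define \<sigma> where "\<sigma> = - (\<epsilon> * sgn a)"
  define \<tau> where "\<tau> = \<epsilon> * sgn b"
  have st: "\<sigma> = 1 \<or> \<sigma> = -1" "\<tau> = 1 \<or> \<tau> = -1"
    using \<epsilon> ab by (auto simp: \<sigma>_def \<tau>_def sgn_if)
  define e where "e i = turning_class F (fibre_coord a b p \<sigma> \<tau> i)" for i
  have basis: "integral_basis ?G e"
    unfolding e_def[abs_def] F_def by (rule integral_basis_fibre_coord[OF ab p st])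
  \<comment> \<open>Some transport along some loop of the class; the choice is harmless because any
    two induce the same map on cohomology, as is checked on the basis.\<close>
  define tr where "tr A = (SOME T. \<exists>\<delta>\<in>loops_at U_base p. \<delta> \<in> A \<and> fibre_transport (X_ab a b) h_map \<delta> T)" for A
  define \<rho> where "\<rho> A = cohomology_induced 1 (top_of_set F) (tr A)" for A
  note tf = transport_fibre_coord(1)[OF ab, where p = p, folded F_def]
    transport_fibre_coord(2-4)[OF ab, where p = p and \<sigma> = \<sigma> and \<tau> = \<tau>, folded F_def, folded e_def]
  have tr: "\<exists>\<delta>\<in>loops_at U_base p. homotopic_paths U_base \<delta>' \<delta> \<and>
      fibre_transport (X_ab a b) h_map \<delta> (tr (loop_class U_base \<delta>'))" if \<delta>': "\<delta>' \<in> loops_at U_base p" for \<delta>'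
  proof -
    have "\<exists>T. \<exists>\<delta>\<in>loops_at U_base p. \<delta> \<in> loop_class U_base \<delta>' \<and> fibre_transport (X_ab a b) h_map \<delta> T"
    proof -
      have "homotopic_paths U_base \<delta>' \<delta>'" using loops_atD[OF \<delta>'] by simp
      then show ?thesis using fibre_transport_exists[OF ab \<delta>'] \<delta>' unfolding loop_class_def by blast
    qed
    from someI_ex[OF this] show ?thesis unfolding tr_def by (auto simp: loop_class_def)
  qed
  have \<rho>: "\<rho> (loop_class U_base \<delta>) (e 1) = e 1 \<otimes>\<^bsub>?G\<^esub> e 3 [^]\<^bsub>?G\<^esub> (- (\<sigma> * \<bar>a\<bar> * u_turns \<delta>))"
      "\<rho> (loop_class U_base \<delta>) (e 2) = e 2 \<otimes>\<^bsub>?G\<^esub> e 3 [^]\<^bsub>?G\<^esub> (- (\<tau> * \<bar>b\<bar> * v_turns \<delta>))"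
      "\<rho> (loop_class U_base \<delta>) (e 3) = e 3" "\<rho> (loop_class U_base \<delta>) \<in> hom ?G ?G"
    if \<delta>: "\<delta> \<in> loops_at U_base p" for \<delta>
  proof -
    obtain \<delta>' where \<delta>': "\<delta>' \<in> loops_at U_base p" "homotopic_paths U_base \<delta> \<delta>'"
      "fibre_transport (X_ab a b) h_map \<delta>' (tr (loop_class U_base \<delta>))" using tr[OF \<delta>] by blast
    show "\<rho> (loop_class U_base \<delta>) (e 1) = e 1 \<otimes>\<^bsub>?G\<^esub> e 3 [^]\<^bsub>?G\<^esub> (- (\<sigma> * \<bar>a\<bar> * u_turns \<delta>))"
      "\<rho> (loop_class U_base \<delta>) (e 2) = e 2 \<otimes>\<^bsub>?G\<^esub> e 3 [^]\<^bsub>?G\<^esub> (- (\<tau> * \<bar>b\<bar> * v_turns \<delta>))"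
      "\<rho> (loop_class U_base \<delta>) (e 3) = e 3" "\<rho> (loop_class U_base \<delta>) \<in> hom ?G ?G"
      unfolding \<rho>_def turns_homotopic[OF \<delta> \<delta>'(2)] using tf[OF \<delta>'(1,3)] by blast+
  qed
  have "monodromy_action 1 (X_ab a b) h_map U_base p \<rho>"
    unfolding monodromy_action_def F_def[symmetric]
  proof (intro ballI conjI allI impI)
    fix \<delta> assume \<delta>: "\<delta> \<in> loops_at U_base p"
    show "\<exists>T. fibre_transport (X_ab a b) h_map \<delta> T" by (rule fibre_transport_exists[OF ab \<delta>])
    fix T c assume T: "fibre_transport (X_ab a b) h_map \<delta> T" and c: "c \<in> carrier ?G"
    note tT = tf[OF \<delta> T]
    show "\<rho> (loop_class U_base \<delta>) c = cohomology_induced 1 (top_of_set F) T c"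
    \<comment> \<open>On the basis every transport acts through the turning numbers alone, and these
      are constant on the homotopy class.\<close>
    proof (rule hom_agree_on_integral_basis[OF basis \<rho>(4)[OF \<delta>] tT(1) _ c])
      show "\<rho> (loop_class U_base \<delta>) (e i) = cohomology_induced 1 (top_of_set F) T (e i)" for i
        using exhaust_3[of i] \<rho>(1-3)[OF \<delta>] tT(2-4) by metis
    qed
  qed
  moreover have "acts_by_matrix ?G e (\<rho> (loop_class U_base (\<gamma> i)))
      (vector [vector [1, 0, 0], vector [0, 1, 0], vector [\<alpha>, \<beta>, 1]])"
    if "- (\<sigma> * \<bar>a\<bar> * u_turns (\<gamma> i)) = \<alpha>" "- (\<tau> * \<bar>b\<bar> * v_turns (\<gamma> i)) = \<beta>" for i \<alpha> \<beta>
    using basis \<rho>(1-3)[OF \<gamma>[of i]] that unfolding integral_basis_def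
    by (intro acts_by_lower_matrix) auto
  moreover have "- (\<sigma> * \<bar>a\<bar> * \<epsilon>) = a" "- (\<sigma> * \<bar>a\<bar> * - \<epsilon>) = - a" "- (\<tau> * \<bar>b\<bar> * - \<epsilon>) = b"
    using \<epsilon> by (auto simp: \<sigma>_def \<tau>_def abs_if sgn_if)
  ultimately show ?thesis
    using free basis turns
    by (intro exI[of _ "\<lambda>i. loop_class U_base (\<gamma> i)"] exI[of _ e] exI[of _ \<rho>] conjI) simp_all
qed

theorem theorem1p5:
  fixes a b :: int
  assumes "a \<noteq> 0" and "b \<noteq> 0"
  shows
    "(\<forall>p \<in> U_base. h_fibre a b p homeomorphic torus3) \<and>
     (\<forall>p \<in> U_base.
        \<exists>g :: 3 \<Rightarrow> (real \<Rightarrow> real3) set.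
        \<exists>e :: 3 \<Rightarrow> (complex5 chain \<Rightarrow> int) set.
        \<exists>\<rho>.
          free_basis (fundamental_group U_base p) g \<and>
          integral_basis (cohomology_group 1 (top_of_set (h_fibre a b p))) e \<and>
          monodromy_action 1 (X_ab a b) h_map U_base p \<rho> \<and>
          acts_by_matrix (cohomology_group 1 (top_of_set (h_fibre a b p))) e (\<rho> (g 1))
            (vector [vector [1, 0, 0], vector [0, 1, 0], vector [0, b, 1]]) \<and>
          acts_by_matrix (cohomology_group 1 (top_of_set (h_fibre a b p))) e (\<rho> (g 2))
            (vector [vector [1, 0, 0], vector [0, 1, 0], vector [a, 0, 1]]) \<and>
          acts_by_matrix (cohomology_group 1 (top_of_set (h_fibre a b p))) e (\<rho> (g 3))
            (vector [vector [1, 0, 0], vector [0, 1, 0], vector [- a, 0, 1]])) \<and>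
     (\<forall>u. u \<noteq> 0 \<longrightarrow> collapsed_torus3 (nat \<bar>b\<bar>) 0 (h_fibre a b (u, 0, 0))) \<and>
     (\<forall>v. v \<noteq> 0 \<longrightarrow> collapsed_torus3 (nat \<bar>a\<bar>) 0 (h_fibre a b (0, v, 0))) \<and>
     (multiplicity 2 a \<noteq> multiplicity 2 b \<longrightarrow>
        collapsed_torus3 (nat \<bar>a\<bar> + nat \<bar>b\<bar>) 0 (h_fibre a b (0, 0, 0))) \<and>
     (multiplicity 2 a = multiplicity 2 b \<longrightarrow>
        collapsed_torus3 (nat \<bar>a\<bar> + nat \<bar>b\<bar> - nat (gcd a b)) (nat (gcd a b))
          (h_fibre a b (0, 0, 0)))"
  using h_fibre_homeomorphic_torus3[OF assms] monodromy_over_U_base[OF assms]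
    collapsed_torus3_h_fibres[OF assms] by (intro conjI ballI allI impI)

end
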